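(* Let $M$ be a smooth connected Riemannian manifold without boundary. a) One has $\|f\|_{\mathsf{BV}}=\|f\|_{1,1}$ for all $f\in\mathsf{W}^{1,1}(M)$. In particular, $\mathsf{H}^{1,1}(M)$ and $\mathsf{W}^{1,1}(M)$ are closed subspaces of $\mathsf{BV}(M)$. b) A function $f\in\mathsf{BV}(M)$ is in $\mathsf{W}^{1,1}(M)$ if and only if $|\mathrm{D}f|\ll\mathrm{vol}$ as Borel measures.
   Context: Notation: $\mathrm{vol}$ is the Riemannian volume measure. All functions and forms are complex-valued; $\mathrm{T}^*M$ denotes the complexified cotangent bundle with the Hermitian structure $(\cdot,\cdot)_x$ induced by the metric (linear in the second argument, conjugate-linear in the first) and norm $|\cdot|_x$. $\Omega^1_{\mathsf{C}^\infty_0}(M)$ is the space of smooth compactly supported $1$-forms, $\Omega^1_{\mathsf{L}^p}(M)$ the $\mathsf{L}^p$ $1$-forms; $\|\cdot\|_p$ is the $\mathsf{L}^p$-norm of functions or $1$-forms. $\mathrm{d}$ is the (distributional) exterior derivative on functions and $\mathrm{d}^\dagger$ the formal adjoint of $\mathrm{d}$. For $f\in\mathsf{L}^1_{\mathrm{loc}}(M)$, $\mathrm{d}f$ is identified with the functional $\mathrm{d}f(\alpha)=\int_M\overline{f}\,\mathrm{d}^\dagger\alpha\,\mathrm{d}\mathrm{vol}$ on $\Omega^1_{\mathsf{C}^\infty_0}(M)$. $$\mathrm{Var}(f)=\sup\left\{\left|\int_M\overline{f(x)}\,\mathrm{d}^\dagger\alpha(x)\,\mathrm{vol}(\mathrm{d}x)\right|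 : \alpha\in\Omega^1_{\mathsf{C}^\infty_0}(M),\ \|\alpha\|_\infty\le 1\right\}.$$ $\mathsf{BV}(M)=\{f\in\mathsf{L}^1(M):\mathrm{Var}(f)<\infty\}$ with norm $\|f\|_{\mathsf{BV}}=\|f\|_1+\mathrm{Var}(f)$. $\mathsf{W}^{1,p}(M)=\{f\in\mathsf{L}^p(M):\mathrm{d}f\in\Omega^1_{\mathsf{L}^p}(M)\}$ with norm $\|f\|_{1,p}=\|f\|_p+\|\mathrm{d}f\|_p$, and $\mathsf{H}^{1,p}(M)$ is the closure in $\mathsf{W}^{1,p}(M)$, with respect to $\|\cdot\|_{1,p}$, of the set of $f\in\mathsf{L}^p(M)\cap\mathsf{C}^\infty(M)$ with $\mathrm{d}f\in\Omega^1_{\mathsf{L}^p}(M)$. For $f\in\mathsf{L}^1_{\mathrm{loc}}(M)$ with $\mathrm{Var}(f)<\infty$ there is a unique finite positive Borel measure $|\mathrm{D}f|$ on $M$ and a ($|\mathrm{D}f|$-a.e. unique) Borel section $\sigma_f$ of $\mathrm{T}^*M$ with $|\sigma_f|=1$ $|\mathrm{D}f|$-a.e. such that $\mathrm{d}f(\alpha)=\int_M(\sigma_f(x),\alpha(x))_x\,|\mathrm{D}f|(\mathrm{d}x)$ for all $\alpha\in\Omega^1_{\mathsf{C}^\infty_0}(M)$; this defines $|\mathrm{D}f|$. *)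

theory Defs
  imports "HOL-Analysis.Analysis" "HOL-Probability.Essential_Supremum"
begin

section \<open>Smooth manifolds\<close>

text \<open>For open \<open>S\<close> and \<open>k \<ge> 1\<close>: all iterated directional derivatives up to order \<open>k\<close> exist as
  derivatives of totally differentiable maps, and those of order \<open>k\<close> are continuous.\<close>

primrec Ck_on :: "nat \<Rightarrow> 'e::euclidean_space set \<Rightarrow> ('e \<Rightarrow> 'f::real_normed_vector) \<Rightarrow> bool" where
  "Ck_on 0 S f \<longleftrightarrow> continuous_on S f"
| "Ck_on (Suc k) S f \<longleftrightarrow>
     (\<forall>x\<in>S. f differentiable (at x)) \<and> (\<forall>v. Ck_on k S (\<lambda>x. frechet_derivative f (at x) v))"

definition smooth_on :: "'e::euclidean_space set \<Rightarrow> ('e \<Rightarrow> 'f::real_normed_vector) \<Rightarrow> bool" where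
  "smooth_on S f \<longleftrightarrow> (\<forall>k. Ck_on k S f)"

text \<open>The manifold is the whole type \<open>'a\<close>, and \<open>CARD('n)\<close> is its dimension. A chart is a pair of a
  domain and a coordinate map; values of the map outside the domain are irrelevant.\<close>

type_synonym ('a, 'n) chart = "'a set \<times> ('a \<Rightarrow> real ^ 'n)"

definition chart_inv :: "('a, 'n) chart \<Rightarrow> real ^ 'n \<Rightarrow> 'a" where
  "chart_inv c = inv_into (fst c) (snd c)"

definition is_chart :: "('a::topological_space, 'n::finite) chart \<Rightarrow> bool" where
  "is_chart c \<longleftrightarrow> open (fst c) \<and> open (snd c ` fst c) \<and>
     homeomorphism (fst c) (snd c ` fst c) (snd c) (chart_inv c)"

definition transition :: "('a, 'n) chart \<Rightarrow> ('a, 'n) chart \<Rightarrow> real ^ 'n \<Rightarrow> real ^ 'n" where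
  "transition c d = snd d \<circ> chart_inv c"

definition smooth_atlas :: "('a::topological_space, 'n::finite) chart set \<Rightarrow> bool" where
  "smooth_atlas A \<longleftrightarrow>
     (\<forall>c\<in>A. is_chart c) \<and> (\<Union>c\<in>A. fst c) = UNIV \<and>
     (\<forall>c\<in>A. \<forall>d\<in>A. smooth_on (snd c ` (fst c \<inter> fst d)) (transition c d))"

text \<open>The entry \<open>$ j $ i\<close> is the \<open>i\<close>-th partial derivative, in the coordinates of \<open>c\<close>, of the
  \<open>j\<close>-th coordinate of \<open>d\<close>.\<close>

definition jac :: "('a, 'n::finite) chart \<Rightarrow> ('a, 'n) chart \<Rightarrow> 'a \<Rightarrow> real ^ 'n ^ 'n" where
  "jac c d x = matrix (frechet_derivative (transition c d) (at (snd c x)))"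

text \<open>An arbitrary chart around a point, used only to evaluate chart-independent expressions.\<close>

definition chart_at :: "('a, 'n) chart set \<Rightarrow> 'a \<Rightarrow> ('a, 'n) chart" where
  "chart_at A x = (SOME c. c \<in> A \<and> x \<in> fst c)"

definition smooth_fun ::
  "('a, 'n::finite) chart set \<Rightarrow> ('a \<Rightarrow> complex) \<Rightarrow> bool" where
  "smooth_fun A f \<longleftrightarrow> (\<forall>c\<in>A. smooth_on (snd c ` fst c) (f \<circ> chart_inv c))"


section \<open>Riemannian metrics and the volume measure\<close>

text \<open>A Riemannian metric is given by its component matrices \<open>g\<^sub>i\<^sub>j\<close> in each chart of the atlas,
  related by the transformation law of a covariant 2-tensor.\<close>

definition riemannian_metric ::
  "('a, 'n::finite) chart set \<Rightarrow> (('a, 'n) chart \<Rightarrow> 'a \<Rightarrow> real ^ 'n ^ 'n) \<Rightarrow> bool" where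
  "riemannian_metric A g \<longleftrightarrow>
     (\<forall>c\<in>A. \<forall>i j. smooth_on (snd c ` fst c) (\<lambda>y. g c (chart_inv c y) $ i $ j)) \<and>
     (\<forall>c\<in>A. \<forall>x\<in>fst c. transpose (g c x) = g c x \<and> (\<forall>v. v \<noteq> 0 \<longrightarrow> 0 < v \<bullet> (g c x *v v))) \<and>
     (\<forall>c\<in>A. \<forall>d\<in>A. \<forall>x\<in>fst c \<inter> fst d. g c x = transpose (jac c d x) ** g d x ** jac c d x)"

definition connected_riemannian_manifold ::
  "('a::{second_countable_topology, t2_space}, 'n::finite) chart set \<Rightarrow>
   (('a, 'n) chart \<Rightarrow> 'a \<Rightarrow> real ^ 'n ^ 'n) \<Rightarrow> bool" where
  "connected_riemannian_manifold A g \<longleftrightarrow>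
     smooth_atlas A \<and> riemannian_metric A g \<and> connected (UNIV :: 'a set)"

text \<open>The Borel measure given by \<open>sqrt (det g) dx\<close> in every chart; it is unique because countably
  many chart domains cover the manifold.\<close>

definition vol ::
  "('a::topological_space, 'n::finite) chart set \<Rightarrow>
   (('a, 'n) chart \<Rightarrow> 'a \<Rightarrow> real ^ 'n ^ 'n) \<Rightarrow> 'a measure" where
  "vol A g = (THE \<mu>. sets \<mu> = sets borel \<and>
     (\<forall>c\<in>A. \<forall>B\<in>sets borel. B \<subseteq> fst c \<longrightarrow>
        emeasure \<mu> B =
          (\<integral>\<^sup>+y\<in>snd c ` B. ennreal (sqrt (det (g c (chart_inv c y)))) \<partial>lborel)))"


section \<open>Complex 1-forms\<close>

text \<open>A section of the complexified cotangent bundle is given by its component vectors in each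
  chart of the atlas, related by the transformation law of covectors. Only the values at
  charts of the atlas and points of their domains matter.\<close>

type_synonym ('a, 'n) form = "('a, 'n) chart \<Rightarrow> 'a \<Rightarrow> complex ^ 'n"

definition is_form :: "('a, 'n::finite) chart set \<Rightarrow> ('a, 'n) form \<Rightarrow> bool" where
  "is_form A \<alpha> \<longleftrightarrow>
     (\<forall>c\<in>A. \<forall>d\<in>A. \<forall>x\<in>fst c \<inter> fst d. \<forall>i.
        \<alpha> c x $ i = (\<Sum>j\<in>UNIV. of_real (jac c d x $ j $ i) * \<alpha> d x $ j))"

definition form_inner ::
  "('a, 'n::finite) chart set \<Rightarrow> (('a, 'n) chart \<Rightarrow> 'a \<Rightarrow> real ^ 'n ^ 'n) \<Rightarrow>
   ('a, 'n) form \<Rightarrow> ('a, 'n) form \<Rightarrow> 'a \<Rightarrow> complex" where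
  "form_inner A g \<alpha> \<beta> x =
     (let c = chart_at A x in
       \<Sum>i\<in>UNIV. \<Sum>j\<in>UNIV.
         of_real (matrix_inv (g c x) $ i $ j) * cnj (\<alpha> c x $ i) * \<beta> c x $ j)"

definition form_norm ::
  "('a, 'n::finite) chart set \<Rightarrow> (('a, 'n) chart \<Rightarrow> 'a \<Rightarrow> real ^ 'n ^ 'n) \<Rightarrow>
   ('a, 'n) form \<Rightarrow> 'a \<Rightarrow> real" where
  "form_norm A g \<alpha> x = sqrt (Re (form_inner A g \<alpha> \<alpha> x))"

definition borel_form :: "('a::topological_space, 'n::finite) chart set \<Rightarrow> ('a, 'n) form \<Rightarrow> bool" where
  "borel_form A \<alpha> \<longleftrightarrow>
     is_form A \<alpha> \<and> (\<forall>c\<in>A. \<alpha> c \<in> borel_measurable (restrict_space borel (fst c)))"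

definition form_support ::
  "('a::topological_space, 'n::finite) chart set \<Rightarrow> ('a, 'n) form \<Rightarrow> 'a set" where
  "form_support A \<alpha> = closure {x. \<exists>c\<in>A. x \<in> fst c \<and> \<alpha> c x \<noteq> 0}"

definition test_functions ::
  "('a::topological_space, 'n::finite) chart set \<Rightarrow> ('a \<Rightarrow> complex) set" where
  "test_functions A = {\<psi>. smooth_fun A \<psi> \<and> compact (closure {x. \<psi> x \<noteq> 0})}"

definition test_forms ::
  "('a::topological_space, 'n::finite) chart set \<Rightarrow> ('a, 'n) form set" where
  "test_forms A = {\<alpha>. is_form A \<alpha> \<and> compact (form_support A \<alpha>) \<and>
     (\<forall>c\<in>A. \<forall>i. smooth_on (snd c ` fst c) (\<lambda>y. \<alpha> c (chart_inv c y) $ i))}"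

definition L1_norm_form ::
  "('a::topological_space, 'n::finite) chart set \<Rightarrow>
   (('a, 'n) chart \<Rightarrow> 'a \<Rightarrow> real ^ 'n ^ 'n) \<Rightarrow> ('a, 'n) form \<Rightarrow> ennreal" where
  "L1_norm_form A g \<alpha> = (\<integral>\<^sup>+x. ennreal (form_norm A g \<alpha> x) \<partial>vol A g)"

definition Linf_norm_form ::
  "('a::topological_space, 'n::finite) chart set \<Rightarrow>
   (('a, 'n) chart \<Rightarrow> 'a \<Rightarrow> real ^ 'n ^ 'n) \<Rightarrow> ('a, 'n) form \<Rightarrow> ennreal" where
  "Linf_norm_form A g \<alpha> = esssup (vol A g) (\<lambda>x. ennreal (form_norm A g \<alpha> x))"

definition L1_forms ::
  "('a::topological_space, 'n::finite) chart set \<Rightarrow>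
   (('a, 'n) chart \<Rightarrow> 'a \<Rightarrow> real ^ 'n ^ 'n) \<Rightarrow> ('a, 'n) form set" where
  "L1_forms A g = {\<alpha>. borel_form A \<alpha> \<and> L1_norm_form A g \<alpha> < \<infinity>}"


section \<open>The exterior derivative and its formal adjoint\<close>

definition ext_d :: "('a \<Rightarrow> complex) \<Rightarrow> ('a, 'n::finite) form" where
  "ext_d \<psi> c x = (\<chi> i. frechet_derivative (\<psi> \<circ> chart_inv c) (at (snd c x)) (axis i 1))"

definition codiff ::
  "('a::topological_space, 'n::finite) chart set \<Rightarrow>
   (('a, 'n) chart \<Rightarrow> 'a \<Rightarrow> real ^ 'n ^ 'n) \<Rightarrow> ('a, 'n) form \<Rightarrow> 'a \<Rightarrow> complex" where
  "codiff A g \<alpha> = (THE h. smooth_fun A h \<and>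
     (\<forall>\<psi>\<in>test_functions A.
        (\<integral>x. form_inner A g (ext_d \<psi>) \<alpha> x \<partial>vol A g) = (\<integral>x. cnj (\<psi> x) * h x \<partial>vol A g)))"

text \<open>The functional on test forms that represents the distribution \<open>df\<close>.\<close>

definition dist_d ::
  "('a::topological_space, 'n::finite) chart set \<Rightarrow>
   (('a, 'n) chart \<Rightarrow> 'a \<Rightarrow> real ^ 'n ^ 'n) \<Rightarrow> ('a \<Rightarrow> complex) \<Rightarrow> ('a, 'n) form \<Rightarrow> complex" where
  "dist_d A g f \<alpha> = (\<integral>x. cnj (f x) * codiff A g \<alpha> x \<partial>vol A g)"

definition is_weak_d ::
  "('a::topological_space, 'n::finite) chart set \<Rightarrow>
   (('a, 'n) chart \<Rightarrow> 'a \<Rightarrow> real ^ 'n ^ 'n) \<Rightarrow> ('a \<Rightarrow> complex) \<Rightarrow> ('a, 'n) form \<Rightarrow> bool" where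
  "is_weak_d A g f \<beta> \<longleftrightarrow>
     \<beta> \<in> L1_forms A g \<and>
     (\<forall>\<alpha>\<in>test_forms A. dist_d A g f \<alpha> = (\<integral>x. form_inner A g \<beta> \<alpha> x \<partial>vol A g))"

text \<open>The integrable form representing \<open>df\<close>, when there is one; it is unique up to null sets.\<close>

definition weak_d ::
  "('a::topological_space, 'n::finite) chart set \<Rightarrow>
   (('a, 'n) chart \<Rightarrow> 'a \<Rightarrow> real ^ 'n ^ 'n) \<Rightarrow> ('a \<Rightarrow> complex) \<Rightarrow> ('a, 'n) form" where
  "weak_d A g f = (SOME \<beta>. is_weak_d A g f \<beta>)"


section \<open>Function spaces\<close>

text \<open>The spaces below are sets of functions rather than of classes modulo null sets. The
  norms do not see null sets, and so they are seminorms.\<close>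

definition L1_norm :: "'a measure \<Rightarrow> ('a \<Rightarrow> complex) \<Rightarrow> ennreal" where
  "L1_norm M f = (\<integral>\<^sup>+x. ennreal (cmod (f x)) \<partial>M)"

definition Var ::
  "('a::topological_space, 'n::finite) chart set \<Rightarrow>
   (('a, 'n) chart \<Rightarrow> 'a \<Rightarrow> real ^ 'n ^ 'n) \<Rightarrow> ('a \<Rightarrow> complex) \<Rightarrow> ennreal" where
  "Var A g f = (SUP \<alpha>\<in>{\<alpha>\<in>test_forms A. Linf_norm_form A g \<alpha> \<le> 1}. ennreal (cmod (dist_d A g f \<alpha>)))"

definition BV ::
  "('a::topological_space, 'n::finite) chart set \<Rightarrow>
   (('a, 'n) chart \<Rightarrow> 'a \<Rightarrow> real ^ 'n ^ 'n) \<Rightarrow> ('a \<Rightarrow> complex) set" where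
  "BV A g = {f. integrable (vol A g) f \<and> Var A g f < \<infinity>}"

definition BV_norm ::
  "('a::topological_space, 'n::finite) chart set \<Rightarrow>
   (('a, 'n) chart \<Rightarrow> 'a \<Rightarrow> real ^ 'n ^ 'n) \<Rightarrow> ('a \<Rightarrow> complex) \<Rightarrow> ennreal" where
  "BV_norm A g f = L1_norm (vol A g) f + Var A g f"

definition W11 ::
  "('a::topological_space, 'n::finite) chart set \<Rightarrow>
   (('a, 'n) chart \<Rightarrow> 'a \<Rightarrow> real ^ 'n ^ 'n) \<Rightarrow> ('a \<Rightarrow> complex) set" where
  "W11 A g = {f. integrable (vol A g) f \<and> (\<exists>\<beta>. is_weak_d A g f \<beta>)}"

definition W11_norm ::
  "('a::topological_space, 'n::finite) chart set \<Rightarrow>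
   (('a, 'n) chart \<Rightarrow> 'a \<Rightarrow> real ^ 'n ^ 'n) \<Rightarrow> ('a \<Rightarrow> complex) \<Rightarrow> ennreal" where
  "W11_norm A g f = L1_norm (vol A g) f + L1_norm_form A g (weak_d A g f)"

definition closure_wrt ::
  "(('a \<Rightarrow> complex) \<Rightarrow> ennreal) \<Rightarrow> ('a \<Rightarrow> complex) set \<Rightarrow> ('a \<Rightarrow> complex) set \<Rightarrow>
   ('a \<Rightarrow> complex) set" where
  "closure_wrt N X S = {f\<in>X. \<forall>e>0. \<exists>h\<in>S. N (\<lambda>x. f x - h x) < e}"

definition H11 ::
  "('a::topological_space, 'n::finite) chart set \<Rightarrow>
   (('a, 'n) chart \<Rightarrow> 'a \<Rightarrow> real ^ 'n ^ 'n) \<Rightarrow> ('a \<Rightarrow> complex) set" where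
  "H11 A g = closure_wrt (W11_norm A g) (W11 A g) {f\<in>W11 A g. smooth_fun A f}"

definition closed_subspace_wrt ::
  "(('a \<Rightarrow> complex) \<Rightarrow> ennreal) \<Rightarrow> ('a \<Rightarrow> complex) set \<Rightarrow> ('a \<Rightarrow> complex) set \<Rightarrow> bool" where
  "closed_subspace_wrt N X S \<longleftrightarrow>
     S \<subseteq> X \<and> (\<lambda>x. 0) \<in> S \<and>
     (\<forall>f\<in>S. \<forall>h\<in>S. (\<lambda>x. f x + h x) \<in> S) \<and>
     (\<forall>a. \<forall>f\<in>S. (\<lambda>x. a * f x) \<in> S) \<and>
     closure_wrt N X S = S"


section \<open>The variation measure\<close>

text \<open>\<open>is_variation_measure A g f \<mu>\<close> says that \<open>\<mu>\<close> is the measure \<open>|Df|\<close>. By the polar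
  decomposition theorem there is exactly one such \<open>\<mu>\<close> whenever \<open>Var A g f < \<infinity>\<close>.\<close>

definition is_variation_measure ::
  "('a::topological_space, 'n::finite) chart set \<Rightarrow>
   (('a, 'n) chart \<Rightarrow> 'a \<Rightarrow> real ^ 'n ^ 'n) \<Rightarrow> ('a \<Rightarrow> complex) \<Rightarrow> 'a measure \<Rightarrow> bool" where
  "is_variation_measure A g f \<mu> \<longleftrightarrow>
     sets \<mu> = sets borel \<and> finite_measure \<mu> \<and>
     (\<exists>\<sigma>. borel_form A \<sigma> \<and> (AE x in \<mu>. form_norm A g \<sigma> x = 1) \<and>
        (\<forall>\<alpha>\<in>test_forms A. dist_d A g f \<alpha> = (\<integral>x. form_inner A g \<sigma> \<alpha> x \<partial>\<mu>)))"

end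

(* A test form pairs with df through the codifferential, which exists chartwise by integration by parts
   and globally by a finite smooth partition. The key fact is a density statement: for a finite Borel
   measure m, every Borel form of pointwise norm 0 or 1 is an m-a.e. limit of test forms of norm at
   most 1. Applied to beta/|beta| and |beta| vol, it gives Var f = ||beta||_1 for every weak derivative
   beta of f, hence the equality of norms. Together with the completeness of the integrable forms this
   makes W^{1,1} closed in BV, and then also H^{1,1}. If |Df| = m has polar section sigma and
   m << vol, Radon-Nikodym turns sigma m into an integrable form representing df. Conversely, for f in
   W^{1,1} and a vol-null set N, testing df with an approximation of 1_N sigma gives m(N) = 0. *)
theory Submission
  imports Defs
begin

section \<open>Calculus of smooth maps\<close>

text \<open>\<open>vol\<close> and \<open>codiff\<close> are definite descriptions, so
  \<open>Var\<close> is opaque until existence and uniqueness are settled; this is what coordinates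
  and the change of variables formula are for. The other obstacle is that \<beta>/|\<beta>| and the
  polar section are merely Borel. Density is therefore measured by the integral of min(1, |\<gamma>
  - \<alpha>|), a metric for convergence in measure: it is finite for all Borel forms on a finite
  measure and stable under pointwise limits, so a Dynkin argument applies, and countable covers do
  the work of partitions of unity. The bound |\<alpha>| <= 1 demanded by \<open>Var\<close> is
  restored at the end by a smooth map that acts on norms as t -> 2t/(1 + t^2); its fixed points 0
  and 1 are the reason for the restriction to norms 0 and 1. To compare |Df| with |\<beta>| vol, one
  sequence of test forms must converge for both, so density is applied to a finite measure that
  dominates them. Convergence for |\<beta>| vol is enough on the other side, since a pairing with
  \<beta> sees only points where \<beta> is nonzero.\<close>

lemma Ck_on_cong:
  assumes S: "open S" and eq: "\<And>x. x \<in> S \<Longrightarrow> f x = g x" and "Ck_on k S f"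
  shows "Ck_on k S g"
  using eq \<open>Ck_on k S f\<close>
proof (induction k arbitrary: f g)
  case 0
  then show ?case by (simp cong: continuous_on_cong)
next
  case (Suc k)
  have der: "(g has_derivative frechet_derivative f (at x)) (at x)" if "x \<in> S" for x
  proof (rule has_derivative_transform_within_open[OF _ S that])
    show "(f has_derivative frechet_derivative f (at x)) (at x)"
      using Suc.prems(2) that by (simp add: frechet_derivative_works)
  qed (use Suc.prems in auto)
  have "Ck_on k S (\<lambda>x. frechet_derivative g (at x) v)" for v
  proof (rule Suc.IH)
    show "Ck_on k S (\<lambda>x. frechet_derivative f (at x) v)"
      using Suc.prems(2) by simp
    show "frechet_derivative f (at x) v = frechet_derivative g (at x) v" if "x \<in> S" for x
      using frechet_derivative_at[OF der[OF that]] by simp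
  qed
  then show ?case
    using der by (auto simp: differentiable_def)
qed

text \<open>With this rule an induction on k only has to exhibit a formula for the derivative and
  treat it in each fixed direction; most closure properties below follow this pattern.\<close>

lemma Ck_on_SucI:
  assumes "open S" "\<And>x. x \<in> S \<Longrightarrow> (f has_derivative f' x) (at x)"
    and "\<And>v. Ck_on k S (\<lambda>x. f' x v)"
  shows "Ck_on (Suc k) S f"
proof -
  have "Ck_on k S (\<lambda>x. frechet_derivative f (at x) v)" for v
    by (rule Ck_on_cong[OF assms(1) _ assms(3)[of v]])
      (simp add: frechet_derivative_at[OF assms(2), symmetric])
  then show ?thesis
    using assms(2) by (auto simp: differentiable_def)
qed

lemma Ck_on_Suc_has_derivative:
  assumes "Ck_on (Suc k) S f" "x \<in> S"
  shows "(f has_derivative frechet_derivative f (at x)) (at x)"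
  using assms by (simp add: frechet_derivative_works)

text \<open>\<open>Ck_on\<close> demands continuity of the derivatives of top order only, so
  monotonicity in k rests on the fact that differentiability implies continuity.\<close>

lemma Ck_on_SucD: "Ck_on (Suc k) S f \<Longrightarrow> Ck_on k S f"
proof (induction k arbitrary: f)
  case 0
  then show ?case
    by (auto intro!: continuous_at_imp_continuous_on differentiable_imp_continuous_within)
next
  case (Suc k)
  then have "\<forall>x\<in>S. f differentiable (at x)" "\<And>v. Ck_on (Suc k) S (\<lambda>x. frechet_derivative f (at x) v)"
    by simp_all
  with Suc.IH show ?case by simp
qed

lemma Ck_on_imp_continuous_on: "Ck_on k S f \<Longrightarrow> continuous_on S f"
  by (induction k) (use Ck_on_SucD in auto)

lemma Ck_on_subset: "Ck_on k S f \<Longrightarrow> T \<subseteq> S \<Longrightarrow> Ck_on k T f"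
  by (induction k arbitrary: f) (auto intro: continuous_on_subset)

text \<open>Differentiability and continuity are tested at single points, so pieces that are smooth
  on overlapping open sets glue. Extension by zero relies on this.\<close>

lemma Ck_on_local:
  assumes "\<And>x. x \<in> S \<Longrightarrow> \<exists>T. open T \<and> x \<in> T \<and> Ck_on k T f"
  shows "Ck_on k S f"
  using assms
proof (induction k arbitrary: f)
  case 0
  show ?case
    unfolding Ck_on.simps
  proof (rule continuous_at_imp_continuous_on, rule ballI)
    fix x assume "x \<in> S"
    then obtain T where "open T" "x \<in> T" "continuous_on T f"
      using 0 by force
    then show "isCont f x" by (simp add: continuous_on_eq_continuous_at)
  qed
next
  case (Suc k)
  have "Ck_on k S (\<lambda>x. frechet_derivative f (at x) v)" for v
  proof (rule Suc.IH)
    fix x assume "x \<in> S"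
    from Suc.prems[OF this] show "\<exists>T. open T \<and> x \<in> T \<and> Ck_on k T (\<lambda>x. frechet_derivative f (at x) v)"
      by auto
  qed
  with Suc.prems show ?case by force
qed

lemma Ck_on_const: "Ck_on k S (\<lambda>x. c)"
  by (induction k arbitrary: c) auto

lemma Ck_on_bounded_linear_comp:
  assumes L: "bounded_linear L" and S: "open S" and f: "Ck_on k S f"
  shows "Ck_on k S (\<lambda>x. L (f x))"
  using f
proof (induction k arbitrary: f)
  case 0
  then show ?case
    using L by (simp add: linear_continuous_on_compose bounded_linear.continuous_on)
next
  case (Suc k)
  show ?case
  proof (rule Ck_on_SucI[OF S])
    show "((\<lambda>x. L (f x)) has_derivative (\<lambda>v. L (frechet_derivative f (at x) v))) (at x)"
      if "x \<in> S" for x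
      by (rule bounded_linear.has_derivative[OF L Ck_on_Suc_has_derivative[OF Suc.prems that]])
  next
    show "Ck_on k S (\<lambda>x. L (frechet_derivative f (at x) v))" for v
      using Suc.IH Suc.prems by simp
  qed
qed

lemma Ck_on_linear:
  assumes L: "bounded_linear L" and S: "open S"
  shows "Ck_on k S L"
proof (cases k)
  case 0
  then show ?thesis using L by (simp add: linear_continuous_on)
next
  case (Suc k)
  show ?thesis
    unfolding Suc
    by (rule Ck_on_SucI[OF S bounded_linear_imp_has_derivative[OF L] Ck_on_const])
qed

lemma Ck_on_add:
  assumes S: "open S" and "Ck_on k S f" "Ck_on k S g"
  shows "Ck_on k S (\<lambda>x. f x + g x)"
  using assms(2,3)
proof (induction k arbitrary: f g)
  case 0
  then show ?case by (simp add: continuous_on_add)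
next
  case (Suc k)
  show ?case
  proof (rule Ck_on_SucI[OF S])
    show "((\<lambda>x. f x + g x) has_derivative
        (\<lambda>v. frechet_derivative f (at x) v + frechet_derivative g (at x) v)) (at x)" if "x \<in> S" for x
      by (intro has_derivative_add Ck_on_Suc_has_derivative[OF Suc.prems(1) that]
          Ck_on_Suc_has_derivative[OF Suc.prems(2) that])
  qed (use Suc in auto)
qed

text \<open>Kept abstract because scalar multiplication, products in an algebra and the inner
  product are all needed.\<close>

lemma Ck_on_bilinear:
  assumes B: "bounded_bilinear pr" and S: "open S" and "Ck_on k S f" "Ck_on k S g"
  shows "Ck_on k S (\<lambda>x. pr (f x) (g x))"
  using assms(3,4)
proof (induction k arbitrary: f g)
  case 0
  then show ?case by (simp add: bounded_bilinear.continuous_on[OF B])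
next
  case (Suc k)
  show ?case
  proof (rule Ck_on_SucI[OF S])
    show "((\<lambda>x. pr (f x) (g x)) has_derivative
        (\<lambda>v. pr (f x) (frechet_derivative g (at x) v) + pr (frechet_derivative f (at x) v) (g x))) (at x)"
      if "x \<in> S" for x
      by (rule bounded_bilinear.FDERIV[OF B]; rule Ck_on_Suc_has_derivative[OF _ that])
        (use Suc.prems in auto)
  next
    fix v
    from Suc.prems have "Ck_on k S f" "Ck_on k S g" by (auto intro: Ck_on_SucD simp del: Ck_on.simps)
    then show "Ck_on k S (\<lambda>x. pr (f x) (frechet_derivative g (at x) v) + pr (frechet_derivative f (at x) v) (g x))"
      using Suc by (intro Ck_on_add[OF S] Suc.IH) auto
  qed
qed

lemma Ck_on_sum:
  assumes S: "open S" and "\<And>i. i \<in> I \<Longrightarrow> Ck_on k S (f i)"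
  shows "Ck_on k S (\<lambda>x. \<Sum>i\<in>I. f i x)"
  using assms(2)
  by (induction I rule: infinite_finite_induct) (auto intro: Ck_on_const Ck_on_add[OF S])

lemma Ck_on_compose:
  fixes T :: "'e::euclidean_space \<Rightarrow> 'd::euclidean_space" and f :: "'d \<Rightarrow> 'c::real_normed_vector"
  assumes S: "open S" and R: "open R" and T: "Ck_on k S T" and f: "Ck_on k R f" and sub: "T ` S \<subseteq> R"
  shows "Ck_on k S (\<lambda>x. f (T x))"
  using T f
proof (induction k arbitrary: f)
  case 0
  then show ?case using sub by (auto intro: continuous_on_compose2)
next
  case (Suc k)
  let ?DT = "\<lambda>x. frechet_derivative T (at x)" and ?Df = "\<lambda>x. frechet_derivative f (at x)"
  have der: "((\<lambda>x. f (T x)) has_derivative (\<lambda>v. \<Sum>b\<in>Basis. (?DT x v \<bullet> b) *\<^sub>R ?Df (T x) b)) (at x)"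
    if "x \<in> S" for x
  proof -
    have Df: "(f has_derivative ?Df (T x)) (at (T x))"
      using sub that by (intro Ck_on_Suc_has_derivative[OF Suc.prems(2)]) auto
    have "((\<lambda>x. f (T x)) has_derivative (\<lambda>v. ?Df (T x) (?DT x v))) (at x)"
      by (rule has_derivative_compose[OF Ck_on_Suc_has_derivative[OF Suc.prems(1) that] Df])
    \<comment> \<open>The direction \<open>?DT x v\<close> moves with x, while \<open>Ck_on\<close>
      speaks of derivatives in fixed directions. Expanding it in a basis leaves fixed directions
      with variable coefficients.\<close>
    moreover have "?Df (T x) w = (\<Sum>b\<in>Basis. (w \<bullet> b) *\<^sub>R ?Df (T x) b)" for w
    proof -
      have lin: "linear (?Df (T x))" using Df has_derivative_linear by blast
      have "?Df (T x) w = ?Df (T x) (\<Sum>b\<in>Basis. (w \<bullet> b) *\<^sub>R b)"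
        by (simp add: euclidean_representation)
      then show ?thesis by (simp add: linear_sum[OF lin] linear_scale[OF lin])
    qed
    then have "(\<lambda>v. ?Df (T x) (?DT x v)) = (\<lambda>v. \<Sum>b\<in>Basis. (?DT x v \<bullet> b) *\<^sub>R ?Df (T x) b)"
      by (intro ext)
    ultimately show ?thesis by simp
  qed
  show ?case
  proof (rule Ck_on_SucI[OF S der])
    fix v
    show "Ck_on k S (\<lambda>x. \<Sum>b\<in>Basis. (?DT x v \<bullet> b) *\<^sub>R ?Df (T x) b)"
    proof (intro Ck_on_sum[OF S] Ck_on_bilinear[OF bounded_bilinear_scaleR S])
      fix b :: 'd
      show "Ck_on k S (\<lambda>x. ?DT x v \<bullet> b)"
        using Suc.prems(1) by (intro Ck_on_bounded_linear_comp[OF bounded_linear_inner_left S]) simp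
      show "Ck_on k S (\<lambda>x. ?Df (T x) b)"
        using Suc.prems(2) by (intro Suc.IH Ck_on_SucD[OF Suc.prems(1)]) simp
    qed
  qed
qed

text \<open>Taking the whole sequence of derivatives as data avoids higher-order chain rules.\<close>

lemma Ck_on_real_comp:
  fixes F :: "nat \<Rightarrow> real \<Rightarrow> real"
  assumes S: "open S" and u: "Ck_on k S u" and sub: "\<And>x. x \<in> S \<Longrightarrow> u x \<in> R"
    and der: "\<And>j t. t \<in> R \<Longrightarrow> (F j has_real_derivative F (Suc j) t) (at t)"
  shows "Ck_on k S (\<lambda>x. F j (u x))"
  using u
proof (induction k arbitrary: j)
  case 0
  have "continuous_on R (F j)"
    using der by (intro continuous_at_imp_continuous_on) (auto intro: DERIV_isCont)
  then show ?case using 0 sub by (auto intro: continuous_on_compose2)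
next
  case (Suc k)
  show ?case
  proof (rule Ck_on_SucI[OF S])
    show "((\<lambda>x. F j (u x)) has_derivative (\<lambda>v. F (Suc j) (u x) * frechet_derivative u (at x) v)) (at x)"
      if "x \<in> S" for x
      using has_derivative_compose[OF Ck_on_Suc_has_derivative[OF Suc.prems that]
          der[OF sub[OF that], unfolded has_field_derivative_def]] by simp
    show "Ck_on k S (\<lambda>x. F (Suc j) (u x) * frechet_derivative u (at x) v)" for v
      using Suc.prems by (intro Ck_on_bilinear[OF bounded_bilinear_mult S] Suc.IH)
        (auto intro: Ck_on_SucD simp del: Ck_on.simps, simp)
  qed
qed

lemma smooth_on_cong:
  "open S \<Longrightarrow> (\<And>x. x \<in> S \<Longrightarrow> f x = g x) \<Longrightarrow> smooth_on S f \<Longrightarrow> smooth_on S g"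
  unfolding smooth_on_def using Ck_on_cong by blast

lemma smooth_on_subset: "smooth_on S f \<Longrightarrow> T \<subseteq> S \<Longrightarrow> smooth_on T f"
  unfolding smooth_on_def using Ck_on_subset by blast

lemma smooth_on_Un:
  "open S \<Longrightarrow> open T \<Longrightarrow> smooth_on S f \<Longrightarrow> smooth_on T f \<Longrightarrow> smooth_on (S \<union> T) f"
  unfolding smooth_on_def by (rule allI, rule Ck_on_local) (metis Un_iff)

lemma smooth_on_imp_continuous_on: "smooth_on S f \<Longrightarrow> continuous_on S f"
  unfolding smooth_on_def using Ck_on_imp_continuous_on by blast

lemma smooth_on_has_derivative:
  "smooth_on S f \<Longrightarrow> x \<in> S \<Longrightarrow> (f has_derivative frechet_derivative f (at x)) (at x)"
  unfolding smooth_on_def using Ck_on_Suc_has_derivative by blast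

lemma smooth_on_derivative:
  assumes "smooth_on S f"
  shows "smooth_on S (\<lambda>x. frechet_derivative f (at x) v)"
proof -
  have "Ck_on k S (\<lambda>x. frechet_derivative f (at x) v)" for k
    using assms unfolding smooth_on_def by (metis Ck_on.simps(2))
  then show ?thesis unfolding smooth_on_def ..
qed

lemma smooth_on_const: "smooth_on S (\<lambda>x. c)"
  unfolding smooth_on_def using Ck_on_const by blast

lemma smooth_on_bounded_linear: "bounded_linear L \<Longrightarrow> open S \<Longrightarrow> smooth_on S f \<Longrightarrow> smooth_on S (\<lambda>x. L (f x))"
  unfolding smooth_on_def using Ck_on_bounded_linear_comp by blast

lemma smooth_on_linear: "bounded_linear L \<Longrightarrow> open S \<Longrightarrow> smooth_on S L"
  unfolding smooth_on_def using Ck_on_linear by blast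

lemma smooth_on_add: "open S \<Longrightarrow> smooth_on S f \<Longrightarrow> smooth_on S g \<Longrightarrow> smooth_on S (\<lambda>x. f x + g x)"
  unfolding smooth_on_def using Ck_on_add by blast

lemma smooth_on_mult:
  fixes f g :: "'e::euclidean_space \<Rightarrow> 'a::real_normed_algebra"
  shows "open S \<Longrightarrow> smooth_on S f \<Longrightarrow> smooth_on S g \<Longrightarrow> smooth_on S (\<lambda>x. f x * g x)"
  unfolding smooth_on_def using Ck_on_bilinear[OF bounded_bilinear_mult] by blast

lemma smooth_on_inner:
  "open S \<Longrightarrow> smooth_on S f \<Longrightarrow> smooth_on S g \<Longrightarrow> smooth_on S (\<lambda>x. f x \<bullet> g x)"
  unfolding smooth_on_def using Ck_on_bilinear[OF bounded_bilinear_inner] by blast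

lemma smooth_on_sum:
  "open S \<Longrightarrow> (\<And>i. i \<in> I \<Longrightarrow> smooth_on S (f i)) \<Longrightarrow> smooth_on S (\<lambda>x. \<Sum>i\<in>I. f i x)"
  by (simp add: smooth_on_def Ck_on_sum)

lemma smooth_on_diff:
  assumes "open S" "smooth_on S f" "smooth_on S g"
  shows "smooth_on S (\<lambda>x. f x - g x)"
  using smooth_on_add[OF assms(1,2) smooth_on_bounded_linear[OF bounded_linear_minus[OF bounded_linear_ident] assms(1,3)]]
  by simp

lemma smooth_on_prod:
  fixes f :: "'i \<Rightarrow> 'e::euclidean_space \<Rightarrow> 'a::real_normed_field"
  assumes "open S" "\<And>i. i \<in> I \<Longrightarrow> smooth_on S (f i)"
  shows "smooth_on S (\<lambda>x. \<Prod>i\<in>I. f i x)"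
  using assms(2)
  by (induction I rule: infinite_finite_induct) (simp_all add: smooth_on_const smooth_on_mult[OF assms(1)])

lemma smooth_on_compose:
  fixes T :: "'e::euclidean_space \<Rightarrow> 'd::euclidean_space"
  shows "open S \<Longrightarrow> open R \<Longrightarrow> smooth_on S T \<Longrightarrow> smooth_on R f \<Longrightarrow> T ` S \<subseteq> R \<Longrightarrow>
    smooth_on S (\<lambda>x. f (T x))"
  unfolding smooth_on_def using Ck_on_compose by blast

lemma smooth_on_real_comp:
  fixes F :: "nat \<Rightarrow> real \<Rightarrow> real"
  assumes "open S" "smooth_on S u" "\<And>x. x \<in> S \<Longrightarrow> u x \<in> R"
    and "\<And>j t. t \<in> R \<Longrightarrow> (F j has_real_derivative F (Suc j) t) (at t)"
  shows "smooth_on S (\<lambda>x. F j (u x))"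
  using assms Ck_on_real_comp[of S _ u R F] unfolding smooth_on_def by blast

lemma smooth_on_powr:
  fixes u :: "'e::euclidean_space \<Rightarrow> real"
  assumes S: "open S" and u: "smooth_on S u" and pos: "\<And>x. x \<in> S \<Longrightarrow> 0 < u x"
  shows "smooth_on S (\<lambda>x. u x powr a)"
proof -
  \<comment> \<open>\<open>F j\<close> is the j-th derivative of t powr a on the positive
    half-line.\<close>
  define F where "F = (\<lambda>j t. (\<Prod>i<j. a - real i) * t powr (a - real j))"
  have der: "(F j has_real_derivative F (Suc j) t) (at t)" if "t \<in> {0<..}" for j t
    using that unfolding F_def
    by (auto intro!: derivative_eq_intros simp: algebra_simps)
  have "smooth_on S (\<lambda>x. F 0 (u x))"
    by (rule smooth_on_real_comp[where R = "{0<..}" and F = F, OF S u _ der]) (use pos in auto)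
  then show ?thesis by (simp add: F_def)
qed

lemma smooth_on_sqrt:
  fixes u :: "'e::euclidean_space \<Rightarrow> real"
  assumes S: "open S" and u: "smooth_on S u" and pos: "\<And>x. x \<in> S \<Longrightarrow> 0 < u x"
  shows "smooth_on S (\<lambda>x. sqrt (u x))"
proof (rule smooth_on_cong[OF S])
  show "smooth_on S (\<lambda>x. u x powr (1/2))"
    using S u pos by (rule smooth_on_powr)
  show "u x powr (1/2) = sqrt (u x)" if "x \<in> S" for x
    using pos[OF that] by (simp add: powr_half_sqrt)
qed

lemma smooth_on_inverse:
  fixes u :: "'e::euclidean_space \<Rightarrow> real"
  assumes S: "open S" and u: "smooth_on S u" and nz: "\<And>x. x \<in> S \<Longrightarrow> u x \<noteq> 0"
  shows "smooth_on S (\<lambda>x. inverse (u x))"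
proof (rule smooth_on_cong[OF S])
  \<comment> \<open>\<open>u\<close> may be negative, but its square is positive, and 1/u = u
    (u^2)^(-1).\<close>
  have "smooth_on S (\<lambda>x. (u x * u x) powr (-1))"
    by (intro smooth_on_powr[OF S] smooth_on_mult[OF S] u) (use nz in \<open>auto simp: zero_less_mult_iff linorder_neq_iff\<close>)
  then show "smooth_on S (\<lambda>x. u x * (u x * u x) powr (-1))"
    by (intro smooth_on_mult[OF S] u)
  show "u x * (u x * u x) powr (-1) = inverse (u x)" if "x \<in> S" for x
    using nz[OF that] by (auto simp: powr_minus_divide field_simps zero_less_mult_iff)
qed

section \<open>Determinants and inverses of matrices of smooth functions\<close>

lemma smooth_on_det:
  fixes M :: "'e::euclidean_space \<Rightarrow> real^'n^'n"
  assumes "open S" "\<And>i j. smooth_on S (\<lambda>x. M x $ i $ j)"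
  shows "smooth_on S (\<lambda>x. det (M x))"
  unfolding det_def
  by (intro smooth_on_sum smooth_on_mult smooth_on_prod smooth_on_const assms)

lemma matrix_inv_inverse:
  fixes G :: "real^'n^'n"
  assumes "invertible G"
  shows "G ** matrix_inv G = mat 1" "matrix_inv G ** G = mat 1"
proof -
  have "G ** matrix_inv G = mat 1 \<and> matrix_inv G ** G = mat 1"
    unfolding matrix_inv_def by (rule someI_ex) (use assms in \<open>simp add: invertible_def\<close>)
  then show "G ** matrix_inv G = mat 1" "matrix_inv G ** G = mat 1" by simp_all
qed

text \<open>Cramer's rule makes each entry of the inverse a quotient of determinants, to which the
  smoothness of determinants applies.\<close>

lemma matrix_inv_cramer:
  fixes G :: "real^'n^'n"
  assumes "det G \<noteq> 0"
  shows "matrix_inv G $ k $ l = det (\<chi> i j. if j = k then axis l 1 $ i else G $ i $ j) * inverse (det G)"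
proof -
  have "invertible G" using assms by (simp add: invertible_det_nz)
  then have "G ** matrix_inv G = mat 1"
    by (rule matrix_inv_inverse)
  then have "G *v (matrix_inv G *v axis l 1) = axis l 1"
    by (simp add: matrix_vector_mul_assoc)
  then have "matrix_inv G *v axis l 1 =
      (\<chi> k. det (\<chi> i j. if j = k then axis l 1 $ i else G $ i $ j) / det G)"
    using cramer[OF assms] by blast
  then show ?thesis
    by (simp add: vec_eq_iff matrix_vector_mult_basis column_def divide_inverse)
qed

lemma smooth_on_matrix_inv:
  fixes M :: "'e::euclidean_space \<Rightarrow> real^'n^'n"
  assumes S: "open S" and M: "\<And>i j. smooth_on S (\<lambda>x. M x $ i $ j)"
    and nz: "\<And>x. x \<in> S \<Longrightarrow> det (M x) \<noteq> 0"
  shows "smooth_on S (\<lambda>x. matrix_inv (M x) $ k $ l)"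
proof (rule smooth_on_cong[OF S])
  have "smooth_on S (\<lambda>x. (\<chi> i j. if j = k then axis l 1 $ i else M x $ i $ j) $ i $ j)" for i j
    using M smooth_on_const by (cases "j = k") auto
  then show "smooth_on S (\<lambda>x. det (\<chi> i j. if j = k then axis l 1 $ i else M x $ i $ j) * inverse (det (M x)))"
    by (intro smooth_on_mult smooth_on_inverse smooth_on_det S M nz)
qed (simp add: matrix_inv_cramer nz)

section \<open>Bump functions\<close>

text \<open>A class that contains the cut-off function exp(-1/t), namely \<open>flat 1\<close>, and
  is closed under differentiation, so that all derivatives are described by polynomials.\<close>

definition flat :: "real poly \<Rightarrow> real \<Rightarrow> real" where
  "flat p t = (if 0 < t then poly p (1 / t) * exp (- (1 / t)) else 0)"

text \<open>The derivative of p(1/t) exp(-1/t) is (1/t)^2 (p - p')(1/t) exp(-1/t).\<close>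

definition flat_next :: "real poly \<Rightarrow> real poly" where
  "flat_next p = pCons 0 (pCons 0 (p - pderiv p))"

text \<open>The power \<open>s ^ k\<close> is there to absorb the factor s that each further
  coefficient of the polynomial brings into the induction.\<close>

lemma poly_div_exp_tendsto_0: "((\<lambda>s. s ^ k * poly p s / exp s) \<longlongrightarrow> (0::real)) at_top"
proof (induction p arbitrary: k)
  case 0
  then show ?case by simp
next
  case (pCons a p)
  have "((\<lambda>s. a * (s ^ k / exp s) + s ^ Suc k * poly p s / exp s) \<longlongrightarrow> a * 0 + 0) at_top"
    by (intro tendsto_add tendsto_mult tendsto_const tendsto_power_div_exp_0 pCons.IH)
  then show ?case by (simp add: field_simps)
qed

lemma flat_has_derivative: "(flat p has_real_derivative flat (flat_next p) t) (at t)"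
proof -
  consider "t > 0" | "t < 0" | "t = 0" by linarith
  then show ?thesis
  proof cases
    case 1
    have "((\<lambda>t. poly p (1 / t) * exp (- (1 / t))) has_real_derivative flat (flat_next p) t) (at t)"
      using 1 by (auto intro!: derivative_eq_intros DERIV_chain2[OF poly_DERIV]
          simp: flat_def flat_next_def field_simps power2_eq_square)
    then show ?thesis
      by (rule has_field_derivative_transform_within_open[where S = "{0<..}"]) (use 1 in \<open>auto simp: flat_def\<close>)
  next
    case 2
    have "((\<lambda>t. 0) has_real_derivative flat (flat_next p) t) (at t)"
      using 2 by (simp add: flat_def)
    then show ?thesis
      by (rule has_field_derivative_transform_within_open[where S = "{..<0}"]) (use 2 in \<open>auto simp: flat_def\<close>)
  next
    case 3
    \<comment> \<open>With s = 1/h the difference quotient becomes s p(s) / exp s, which tends to 0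
      at infinity.\<close>
    have "((\<lambda>h. flat p h / h) \<longlongrightarrow> 0) (at_right 0)"
      unfolding at_right_to_top filterlim_filtermap
    proof (rule Lim_transform_eventually[OF poly_div_exp_tendsto_0[of 1 p]])
      show "\<forall>\<^sub>F s in at_top. s ^ 1 * poly p s / exp s = flat p (inverse s) / inverse s"
        using eventually_gt_at_top[of 0]
        by eventually_elim (simp add: flat_def divide_inverse exp_minus)
    qed
    moreover have "((\<lambda>h. flat p h / h) \<longlongrightarrow> 0) (at_left 0)"
      by (rule Lim_transform_eventually[OF tendsto_const])
        (auto simp: eventually_at_filter flat_def)
    ultimately have "((\<lambda>h. flat p h / h) \<longlongrightarrow> 0) (at 0)"
      by (simp add: filterlim_at_split)
    then show ?thesis
      using 3 by (simp add: DERIV_def flat_def)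
  qed
qed

lemma smooth_on_flat:
  assumes "open S" "smooth_on S u"
  shows "smooth_on S (\<lambda>x. flat 1 (u x))"
proof -
  have "smooth_on S (\<lambda>x. (\<lambda>j. flat ((flat_next ^^ j) 1)) 0 (u x))"
    using assms by (rule smooth_on_real_comp[where R = UNIV]) (simp_all add: flat_has_derivative)
  then show ?thesis by simp
qed

text \<open>The quotient f/(f + h), where f is positive for |y - a|^2 < 2r^2 and h for |y - a|^2 >
  r^2. These regions cover the space, so the denominator is positive; 2r^2 is just a value strictly
  between r^2 and (2r)^2.\<close>

lemma smooth_bump:
  fixes a :: "'e::euclidean_space"
  assumes r: "r > 0"
  obtains b :: "'e \<Rightarrow> real" where "smooth_on UNIV b" "\<And>y. 0 \<le> b y \<and> b y \<le> 1"
    "\<And>y. y \<in> ball a r \<Longrightarrow> b y = 1" "\<And>y. y \<notin> cball a (2 * r) \<Longrightarrow> b y = 0"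
proof -
  define q where "q y = (y - a) \<bullet> (y - a)" for y
  define f where "f y = flat 1 (2 * r\<^sup>2 - q y)" for y
  define h where "h y = flat 1 (q y - r\<^sup>2)" for y
  have q: "smooth_on UNIV q"
    unfolding q_def
    by (intro smooth_on_inner smooth_on_diff smooth_on_linear[OF bounded_linear_ident] smooth_on_const open_UNIV)
  have f: "smooth_on UNIV f" and h: "smooth_on UNIV h"
    unfolding f_def h_def by (intro smooth_on_flat smooth_on_diff smooth_on_const open_UNIV q)+
  have nonneg: "0 \<le> f y" "0 \<le> h y" for y
    by (simp_all add: f_def h_def flat_def)
  have "0 < f y \<or> 0 < h y" for y
  proof (cases "q y < 2 * r\<^sup>2")
    case False
    moreover have "0 < r\<^sup>2" using r by simp
    ultimately have "r\<^sup>2 < q y" by linarith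
    then show ?thesis by (simp add: h_def flat_def)
  qed (simp add: f_def flat_def)
  then have pos: "0 < f y + h y" for y
    using nonneg by (metis add_nonneg_pos add_pos_nonneg)
  have qn: "q y = (dist a y)\<^sup>2" for y
    by (simp add: q_def power2_norm_eq_inner[symmetric] dist_norm norm_minus_commute)
  show ?thesis
  proof
    show "smooth_on UNIV (\<lambda>y. f y * inverse (f y + h y))"
      by (intro smooth_on_mult smooth_on_inverse smooth_on_add f h open_UNIV) (use pos in \<open>simp add: less_imp_neq[symmetric]\<close>)
    show "0 \<le> f y * inverse (f y + h y) \<and> f y * inverse (f y + h y) \<le> 1" for y
      using pos[of y] nonneg[of y] by (simp add: field_simps)
    show "f y * inverse (f y + h y) = 1" if "y \<in> ball a r" for y
    proof -
      have "q y < r\<^sup>2" using that r unfolding qn by (simp add: power_strict_mono)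
      then have "h y = 0" by (simp add: h_def flat_def)
      then show ?thesis using pos[of y] by simp
    qed
    show "f y * inverse (f y + h y) = 0" if "y \<notin> cball a (2 * r)" for y
    proof -
      have "(2 * r)\<^sup>2 < q y" using that r unfolding qn by (intro power_strict_mono) auto
      then have "2 * r\<^sup>2 - q y < 0" using r by (simp add: power2_eq_square) (smt (verit) mult_pos_pos)
      then show ?thesis by (simp add: f_def flat_def)
    qed
  qed
qed

section \<open>Change of variables and integration by parts\<close>

text \<open>A bridge: the change of variables formula used below is about the gauge integral,
  whereas the volume measure is given by nonnegative Lebesgue integrals.\<close>

lemma has_integral_iff_nn_integral:
  fixes f :: "'a::euclidean_space \<Rightarrow> real"
  assumes meas: "(\<lambda>x. f x * indicator S x) \<in> borel_measurable borel"
    and nonneg: "\<And>x. x \<in> S \<Longrightarrow> 0 \<le> f x" and r: "0 \<le> r"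
  shows "(f has_integral r) S \<longleftrightarrow> (\<integral>\<^sup>+x\<in>S. ennreal (f x) \<partial>lborel) = ennreal r"
proof
  assume "(f has_integral r) S"
  with nonneg show "(\<integral>\<^sup>+x\<in>S. ennreal (f x) \<partial>lborel) = ennreal r"
    by (rule nn_integral_has_integral_lebesgue')
next
  assume "(\<integral>\<^sup>+x\<in>S. ennreal (f x) \<partial>lborel) = ennreal r"
  moreover have "(\<integral>\<^sup>+x\<in>S. ennreal (f x) \<partial>lborel) = (\<integral>\<^sup>+x. ennreal (f x * indicator S x) \<partial>lborel)"
    by (intro nn_integral_cong) (auto simp: indicator_def)
  ultimately have "((\<lambda>x. f x * indicator S x) has_integral r) UNIV"
    using nonneg r by (intro nn_integral_has_integral meas) (auto simp: indicator_def)
  moreover have "(\<lambda>x. f x * indicator S x) = (\<lambda>x. if x \<in> S then f x else 0)"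
    by (auto simp: indicator_def)
  ultimately show "(f has_integral r) S"
    by (simp add: has_integral_restrict_UNIV)
qed

lemma nn_integral_change_of_variables_wellorder:
  fixes T :: "real^'m::{finite,wellorder} \<Rightarrow> real^'m::_"
  assumes S: "S \<in> sets borel" and inj: "inj_on T S"
    and der: "\<And>x. x \<in> S \<Longrightarrow> (T has_derivative T' x) (at x)"
    and f: "(\<lambda>y. f y * indicator (T ` S) y) \<in> borel_measurable borel" "\<And>y. y \<in> T ` S \<Longrightarrow> 0 \<le> f y"
    and h: "(\<lambda>x. h x * indicator S x) \<in> borel_measurable borel"
    and hf: "\<And>x. x \<in> S \<Longrightarrow> h x = \<bar>det (matrix (T' x))\<bar> * f (T x)"
  shows "(\<integral>\<^sup>+y\<in>T ` S. ennreal (f y) \<partial>lborel) = (\<integral>\<^sup>+x\<in>S. ennreal (h x) \<partial>lborel)"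
proof -
  have h_nonneg: "0 \<le> h x" if "x \<in> S" for x
    using that f(2) hf by simp
  have cv: "(h has_integral r) S \<longleftrightarrow> (f has_integral r) (T ` S)" for r
  proof -
    \<comment> \<open>Real values are treated as vectors with one coordinate, the kind of codomain
      for which the formula is stated.\<close>
    let ?v = "vec :: real \<Rightarrow> real^1"
    have "(\<lambda>x. \<bar>det (matrix (T' x))\<bar> *\<^sub>R ?v (f (T x))) absolutely_integrable_on S \<and>
           integral S (\<lambda>x. \<bar>det (matrix (T' x))\<bar> *\<^sub>R ?v (f (T x))) = ?v r
     \<longleftrightarrow> (\<lambda>y. ?v (f y)) absolutely_integrable_on (T ` S) \<and> integral (T ` S) (\<lambda>y. ?v (f y)) = ?v r"
      by (rule has_absolute_integral_change_of_variables[OF _ has_derivative_at_withinI[OF der] inj])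
        (use S in auto)
    then have "(\<lambda>x. \<bar>det (matrix (T' x))\<bar> * f (T x)) absolutely_integrable_on S \<and>
           integral S (\<lambda>x. \<bar>det (matrix (T' x))\<bar> * f (T x)) = r
     \<longleftrightarrow> f absolutely_integrable_on (T ` S) \<and> integral (T ` S) f = r"
      by (simp add: absolutely_integrable_on_1_iff integral_on_1_eq)
    then have "(\<lambda>x. \<bar>det (matrix (T' x))\<bar> * f (T x)) integrable_on S \<and>
           integral S (\<lambda>x. \<bar>det (matrix (T' x))\<bar> * f (T x)) = r
     \<longleftrightarrow> f integrable_on (T ` S) \<and> integral (T ` S) f = r"
      using f(2) by (subst (asm) (1 2) absolutely_integrable_on_iff_nonneg) auto
    then have "((\<lambda>x. \<bar>det (matrix (T' x))\<bar> * f (T x)) has_integral r) S \<longleftrightarrow> (f has_integral r) (T ` S)"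
      by (simp add: has_integral_iff)
    moreover have "((\<lambda>x. \<bar>det (matrix (T' x))\<bar> * f (T x)) has_integral r) S \<longleftrightarrow> (h has_integral r) S"
      by (rule has_integral_cong) (simp add: hf)
    ultimately show ?thesis by simp
  qed
  have *: "(\<integral>\<^sup>+y\<in>T ` S. ennreal (f y) \<partial>lborel) = ennreal r \<longleftrightarrow> (\<integral>\<^sup>+x\<in>S. ennreal (h x) \<partial>lborel) = ennreal r"
    if "0 \<le> r" for r
    using has_integral_iff_nn_integral[OF f that] has_integral_iff_nn_integral[OF h h_nonneg that] cv[of r]
    by blast
  \<comment> \<open>By \<open>*\<close> the two integrals take the same finite values, so if one of
    them is infinite, the other is infinite too.\<close>
  show ?thesis
  proof (cases "(\<integral>\<^sup>+y\<in>T ` S. ennreal (f y) \<partial>lborel)")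
    case (real r)
    with *[of r] show ?thesis by simp
  next
    case top
    show ?thesis
    proof (cases "(\<integral>\<^sup>+x\<in>S. ennreal (h x) \<partial>lborel)")
      case (real r)
      with *[of r] top show ?thesis by simp
    qed (use top in simp)
  qed
qed

text \<open>The library proves the change of variables formula only for index types of class
  \<open>wellorder\<close>; a copy of an arbitrary finite index type is made an instance.\<close>

typedef 'n wo = "UNIV :: 'n set" morphisms un_wo mk_wo by simp

lemma bij_un_wo: "bij un_wo"
  by (metis bijI' mk_wo_inverse un_wo_inject UNIV_I)

instance wo :: (finite) finite
proof
  show "finite (UNIV :: 'a wo set)"
    using bij_un_wo[where ?'a = 'a] by (metis finite bij_betw_finite)
qed

instantiation wo :: (finite) wellorder
begin

definition less_eq_wo :: "'a wo \<Rightarrow> 'a wo \<Rightarrow> bool" where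
  "less_eq_wo x y \<longleftrightarrow> to_nat (un_wo x) \<le> to_nat (un_wo y)"

definition less_wo :: "'a wo \<Rightarrow> 'a wo \<Rightarrow> bool" where
  "less_wo x y \<longleftrightarrow> to_nat (un_wo x) < to_nat (un_wo y)"

instance
proof
  fix P :: "'a wo \<Rightarrow> bool" and a
  assume "\<And>x. (\<And>y. y < x \<Longrightarrow> P y) \<Longrightarrow> P x"
  then show "P a"
    unfolding less_wo_def by (induction a rule: measure_induct_rule[where f = "\<lambda>x. to_nat (un_wo x)"]) blast
qed (auto simp: less_eq_wo_def less_wo_def un_wo_inject)

end

text \<open>Relabelling by \<open>r\<close> turns a transposition into a transposition, and every
  permutation is a product of these.\<close>

lemma sign_conj_bij:
  fixes r :: "'m::finite \<Rightarrow> 'n::finite"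
  assumes r: "bij r" and p: "p permutes (UNIV :: 'm set)"
  shows "sign (r \<circ> p \<circ> inv r) = sign p"
  using p finite
proof (induction rule: permutes_induct)
  case id
  have "r \<circ> id \<circ> inv r = id"
    using r by (auto simp: fun_eq_iff bij_is_surj surj_f_inv_f)
  then show ?case by simp
next
  case (swap a b p)
  have "r \<circ> (Transposition.transpose a b \<circ> p) \<circ> inv r = Transposition.transpose (r a) (r b) \<circ> (r \<circ> p \<circ> inv r)"
    using r by (auto simp: fun_eq_iff Transposition.transpose_def bij_def inj_eq)
  moreover have "permutation (r \<circ> p \<circ> inv r)"
    unfolding permutation
    by (intro conjI bij_comp bij_imp_bij_inv r permutes_bij[OF swap(4)] finite)
  moreover have "permutation p"
    unfolding permutation by (intro conjI permutes_bij[OF swap(4)] finite)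
  moreover have "r a \<noteq> r b" using r swap(3) by (simp add: bij_def inj_eq)
  ultimately show ?case
    using swap(3,5) by (simp only: sign_compose[OF permutation_swap_id] sign_swap_id if_False)
qed

text \<open>In the Leibniz formula, relabelling rows and columns together conjugates the
  permutations, which changes neither their signs nor the products.\<close>

lemma det_reindex:
  fixes A :: "'a::comm_ring_1^'n^'n" and r :: "'m::finite \<Rightarrow> 'n::finite"
  assumes r: "bij r"
  shows "det (\<chi> i j. A $ r i $ r j :: 'a^'m^'m) = det A"
proof -
  define c where "c p = r \<circ> p \<circ> inv r" for p
  have inv: "inv r (r i) = i" "r (inv r j) = j" for i j
    using r by (simp_all add: bij_def surj_f_inv_f)
  have bij_c: "bij_betw c {p. p permutes UNIV} {p. p permutes UNIV}"
  proof (rule bij_betw_byWitness[where f' = "\<lambda>q. inv r \<circ> q \<circ> r"])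
    show "c ` {p. p permutes UNIV} \<subseteq> {p. p permutes UNIV}"
      using r by (auto simp: c_def permutes_univ bij_def Ex1_def) (metis inv)+
    show "(\<lambda>q. inv r \<circ> q \<circ> r) ` {p. p permutes UNIV} \<subseteq> {p. p permutes UNIV}"
      by (auto simp: permutes_univ) (metis inv)+
  qed (auto simp: c_def fun_eq_iff inv)
  have "det A = (\<Sum>p | p permutes UNIV. of_int (sign (c p)) * (\<Prod>i\<in>UNIV. A $ i $ c p i))"
    unfolding det_def by (rule sum.reindex_bij_betw[OF bij_c, symmetric])
  also have "\<dots> = (\<Sum>p | p permutes UNIV. of_int (sign p) * (\<Prod>i\<in>UNIV. A $ r i $ r (p i)))"
  proof (rule sum.cong)
    fix p :: "'m \<Rightarrow> 'm" assume "p \<in> {p. p permutes UNIV}"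
    then have "sign (c p) = sign p" unfolding c_def using r by (simp add: sign_conj_bij)
    moreover have "(\<Prod>i\<in>UNIV. A $ i $ c p i) = (\<Prod>i\<in>UNIV. A $ r i $ c p (r i))"
      by (rule prod.reindex_bij_betw[OF r, symmetric])
    ultimately show "of_int (sign (c p)) * (\<Prod>i\<in>UNIV. A $ i $ c p i) = of_int (sign p) * (\<Prod>i\<in>UNIV. A $ r i $ r (p i))"
      by (simp add: c_def inv)
  qed simp
  finally show ?thesis by (simp add: det_def)
qed

definition reindex :: "('m \<Rightarrow> 'n) \<Rightarrow> real^'n \<Rightarrow> real^'m" where
  "reindex r x = (\<chi> i. x $ r i)"

lemma bounded_linear_reindex: "bounded_linear (reindex r :: real^'n::finite \<Rightarrow> real^'m::finite)"
  by (auto intro!: linear_conv_bounded_linear[THEN iffD1] linearI simp: reindex_def vec_eq_iff)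

lemma reindex_inv:
  assumes "bij r"
  shows "reindex (inv r) (reindex r x) = x" "reindex r (reindex (inv r) y) = y"
  using assms by (simp_all add: reindex_def vec_eq_iff bij_def surj_f_inv_f)

lemma prod_Basis_cart: "(\<Prod>b\<in>Basis. (x :: real^'n) \<bullet> b) = (\<Prod>i\<in>UNIV. x $ i)"
proof -
  have "(Basis :: (real^'n) set) = range (\<lambda>i. axis i 1)"
    by (auto simp: Basis_vec_def)
  then have "(\<Prod>b\<in>Basis. x \<bullet> b) = (\<Prod>b\<in>range (\<lambda>i. axis i 1). x \<bullet> b)"
    by (simp only:)
  also have "\<dots> = (\<Prod>i\<in>UNIV. x \<bullet> axis i 1)"
    by (subst prod.reindex) (auto simp: inj_on_def axis_eq_axis)
  finally show ?thesis by (simp add: inner_axis)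
qed

text \<open>Relabelling coordinates maps boxes to boxes with the same side lengths, and the volumes
  of boxes determine Lebesgue measure.\<close>

lemma distr_reindex_lborel:
  fixes r :: "'m::finite \<Rightarrow> 'n::finite"
  assumes r: "bij r"
  shows "distr lborel borel (reindex r) = (lborel :: (real^'m) measure)"
proof (rule lborel_eqI[symmetric])
  have meas: "reindex r \<in> borel_measurable (borel :: (real^'n) measure)"
    using bounded_linear_reindex by (intro borel_measurable_continuous_onI linear_continuous_on)
  fix l u :: "real^'m"
  assume lu: "\<And>b. b \<in> Basis \<Longrightarrow> l \<bullet> b \<le> u \<bullet> b"
  have lu': "l $ i \<le> u $ i" for i
    using lu[of "axis i 1"] by (simp add: inner_axis)
  have inv: "inv r (r i) = i" "r (inv r j) = j" for i j
    using r by (simp_all add: bij_def surj_f_inv_f)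
  have vim: "reindex r -` box l u = box (reindex (inv r) l) (reindex (inv r) u)"
    by (auto simp: mem_box_cart reindex_def) (metis inv)+
  have "emeasure (distr lborel borel (reindex r)) (box l u) = emeasure lborel (box (reindex (inv r) l) (reindex (inv r) u))"
    using meas by (simp add: emeasure_distr vim)
  also have "\<dots> = (\<Prod>b\<in>Basis. (reindex (inv r) u - reindex (inv r) l) \<bullet> b)"
    by (rule emeasure_lborel_box) (auto simp: Basis_vec_def inner_axis reindex_def lu')
  also have "(\<Prod>b\<in>Basis. (reindex (inv r) u - reindex (inv r) l) \<bullet> b) = (\<Prod>i\<in>UNIV. (u - l) $ inv r i)"
    by (simp add: prod_Basis_cart reindex_def)
  also have "\<dots> = (\<Prod>i\<in>UNIV. (u - l) $ i)"
    by (rule prod.reindex_bij_betw) (simp add: r bij_imp_bij_inv)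
  also have "\<dots> = (\<Prod>b\<in>Basis. (u - l) \<bullet> b)"
    by (simp only: prod_Basis_cart)
  finally show "emeasure (distr lborel borel (reindex r)) (box l u) = (\<Prod>b\<in>Basis. (u - l) \<bullet> b)" .
qed simp

lemma nn_integral_change_of_variables:
  fixes T :: "real^'n \<Rightarrow> real^'n"
  assumes S: "S \<in> sets borel" and inj: "inj_on T S"
    and der: "\<And>x. x \<in> S \<Longrightarrow> (T has_derivative T' x) (at x)"
    and f: "(\<lambda>y. f y * indicator (T ` S) y) \<in> borel_measurable borel" "\<And>y. y \<in> T ` S \<Longrightarrow> 0 \<le> f y"
    and h: "(\<lambda>x. h x * indicator S x) \<in> borel_measurable borel"
    and hf: "\<And>x. x \<in> S \<Longrightarrow> h x = \<bar>det (matrix (T' x))\<bar> * f (T x)"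
  shows "(\<integral>\<^sup>+y\<in>T ` S. ennreal (f y) \<partial>lborel) = (\<integral>\<^sup>+x\<in>S. ennreal (h x) \<partial>lborel)"
proof -
  \<comment> \<open>Conjugating \<open>T\<close> by the relabelling isomorphisms \<open>L\<close>
    and \<open>R\<close> moves the problem to the well-ordered copy of the index type; neither
    Lebesgue measure nor the Jacobian determinant changes.\<close>
  define L where "L = (reindex un_wo :: real^'n \<Rightarrow> real^'n wo)"
  define R where "R = (reindex (inv un_wo) :: real^'n wo \<Rightarrow> real^'n)"
  have RL: "R (L x) = x" and LR: "L (R y) = y" for x y
    by (simp_all add: L_def R_def reindex_inv bij_un_wo)
  have blL: "bounded_linear L" and blR: "bounded_linear R"
    by (simp_all add: L_def R_def bounded_linear_reindex)
  have mL[measurable]: "L \<in> borel_measurable borel" and mR[measurable]: "R \<in> borel_measurable borel"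
    using blL blR by (auto intro!: borel_measurable_continuous_onI linear_continuous_on)
  have imL: "L ` X = R -` X" for X
    using RL LR by (auto simp: image_iff) metis
  have LS: "L ` S \<in> sets borel"
    unfolding imL using measurable_sets[OF mR S] by simp
  have ind: "indicator (L ` X) y = (indicator X (R y) :: 'b::zero_neq_one)" for X y
    using RL LR by (simp add: imL indicator_def)
  have TLS: "(L \<circ> T \<circ> R) ` (L ` S) = L ` T ` S"
    by (simp add: image_comp comp_def RL)
  have pull: "(\<integral>\<^sup>+y\<in>L ` X. ennreal (u (R y)) \<partial>lborel) = (\<integral>\<^sup>+x\<in>X. ennreal (u x) \<partial>lborel)"
    if "(\<lambda>x. u x * indicator X x) \<in> borel_measurable borel" for u :: "real^'n \<Rightarrow> real" and X
  proof -
    have [measurable]: "(\<lambda>x. ennreal (u x * indicator X x)) \<in> borel_measurable borel"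
      using that by measurable
    have eq: "ennreal (u x) * indicator X x = ennreal (u x * indicator X x)" for x
      by (auto simp: indicator_def)
    have "(\<integral>\<^sup>+x\<in>X. ennreal (u x) \<partial>lborel) = (\<integral>\<^sup>+x. ennreal (u x * indicator X x) \<partial>distr lborel borel R)"
      unfolding R_def by (simp add: eq distr_reindex_lborel bij_imp_bij_inv bij_un_wo)
    also have "\<dots> = (\<integral>\<^sup>+y. ennreal (u (R y) * indicator X (R y)) \<partial>lborel)"
      by (rule nn_integral_distr) measurable
    finally show ?thesis by (simp add: ind eq)
  qed
  have "(\<integral>\<^sup>+y\<in>(L \<circ> T \<circ> R) ` (L ` S). ennreal (f (R y)) \<partial>lborel) = (\<integral>\<^sup>+x\<in>L ` S. ennreal (h (R x)) \<partial>lborel)"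
  proof (rule nn_integral_change_of_variables_wellorder[OF LS, where T' = "\<lambda>y. L \<circ> T' (R y) \<circ> R"])
    show "inj_on (L \<circ> T \<circ> R) (L ` S)"
      using inj by (auto simp: inj_on_def RL) (metis RL)
    show "(L \<circ> T \<circ> R has_derivative L \<circ> T' (R y) \<circ> R) (at y)" if "y \<in> L ` S" for y
    proof -
      have "(T has_derivative T' (R y)) (at (R y))"
        using that by (auto simp: RL intro!: der)
      then show ?thesis
        by (intro diff_chain_at bounded_linear_imp_has_derivative blL blR)
    qed
    have "(\<lambda>y. (\<lambda>x. f x * indicator (T ` S) x) (R y)) \<in> borel_measurable borel"
      by (rule measurable_compose[OF mR f(1)])
    then show "(\<lambda>y. f (R y) * indicator ((L \<circ> T \<circ> R) ` L ` S) y) \<in> borel_measurable borel"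
      unfolding TLS ind by simp
    have "(\<lambda>y. (\<lambda>x. h x * indicator S x) (R y)) \<in> borel_measurable borel"
      by (rule measurable_compose[OF mR h])
    then show "(\<lambda>y. h (R y) * indicator (L ` S) y) \<in> borel_measurable borel"
      unfolding ind by simp
    show "0 \<le> f (R y)" if "y \<in> (L \<circ> T \<circ> R) ` L ` S" for y
      using that f(2) by (auto simp: RL)
    show "h (R y) = \<bar>det (matrix (L \<circ> T' (R y) \<circ> R))\<bar> * f (R ((L \<circ> T \<circ> R) y))" if "y \<in> L ` S" for y
    proof -
      have "R y \<in> S" using that by (auto simp: RL)
      have ax: "R (axis j 1) = axis (un_wo j) 1" for j
      proof -
        have "inv un_wo i = j \<longleftrightarrow> i = un_wo j" for i
          using bij_inv_eq_iff[OF bij_un_wo, of j i] by auto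
        then show ?thesis by (simp add: R_def reindex_def vec_eq_iff axis_def)
      qed
      have "matrix (L \<circ> T' (R y) \<circ> R) = (\<chi> i j. matrix (T' (R y)) $ un_wo i $ un_wo j)"
        by (simp add: matrix_def vec_eq_iff ax) (simp add: L_def reindex_def)
      then have "det (matrix (L \<circ> T' (R y) \<circ> R)) = det (matrix (T' (R y)))"
        using det_reindex[OF bij_un_wo] by simp
      then show ?thesis using hf[OF \<open>R y \<in> S\<close>] by (simp add: RL)
    qed
  qed
  then show ?thesis
    unfolding TLS pull[OF f(1)] pull[OF h] .
qed

section \<open>Integration by parts\<close>

lemma integral_derivative_compact_support:
  fixes w :: "'e::euclidean_space \<Rightarrow> 'b::euclidean_space"
  assumes w: "Ck_on 1 UNIV w" and K: "compact K" and supp: "\<And>x. x \<notin> K \<Longrightarrow> w x = 0"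
  shows "(\<integral>x. frechet_derivative w (at x) e \<partial>lborel) = 0"
proof -
  define D where "D x = frechet_derivative w (at x) e" for x
  have der: "(w has_derivative frechet_derivative w (at x)) (at x)" for x
    using Ck_on_Suc_has_derivative[of 0 UNIV w] w by simp
  have contD: "continuous_on UNIV D"
    using w unfolding D_def by simp
  have contw: "continuous_on UNIV w"
    using Ck_on_imp_continuous_on[OF w] .
  have D0: "D x = 0" if "x \<notin> K" for x
  proof -
    have "open (- K)" using K by (simp add: compact_imp_closed open_Compl)
    have "((\<lambda>x. 0) has_derivative frechet_derivative w (at x)) (at x)"
      by (rule has_derivative_transform_within_open[OF der \<open>open (- K)\<close>]) (use that supp in auto)
    then have "frechet_derivative w (at x) = (\<lambda>x. 0)"
      using frechet_derivative_at by fastforce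
    then show ?thesis by (simp add: D_def)
  qed
  obtain B where B: "\<And>x. norm (D x) \<le> B" and "B \<ge> 0"
  proof -
    have "bounded (D ` K)"
      using K contD by (intro compact_imp_bounded compact_continuous_image) (auto intro: continuous_on_subset)
    then obtain B where B: "\<And>x. x \<in> K \<Longrightarrow> norm (D x) \<le> B"
      by (auto simp: bounded_iff)
    show ?thesis
      by (rule that[of "max B 0"]) (use B D0 in \<open>fastforce simp: le_max_iff_disj\<close>)+
  qed
  obtain R where R: "\<And>x. x \<in> K \<Longrightarrow> norm x \<le> R"
    using compact_imp_bounded[OF K] by (auto simp: bounded_iff)
  \<comment> \<open>The difference quotients below have step at most 1, so they vanish outside the
    ball around the support enlarged by \<open>norm e\<close>; inside it they share the bound
    \<open>B\<close>.\<close>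
  define C where "C = cball (0::'e) (R + norm e)"
  have line: "norm (w (x + t *\<^sub>R e) - w x) \<le> B * t" if "t \<ge> 0" for x t
  proof -
    have "norm ((\<lambda>s. w (x + s *\<^sub>R e)) t - (\<lambda>s. w (x + s *\<^sub>R e)) 0) \<le> B * norm (t - 0)"
    proof (rule differentiable_bound[where S = UNIV])
      show "((\<lambda>s. w (x + s *\<^sub>R e)) has_derivative (\<lambda>h. h *\<^sub>R D (x + s *\<^sub>R e))) (at s within UNIV)" for s
      proof -
        have "((\<lambda>s. w (x + s *\<^sub>R e)) has_derivative (\<lambda>h. frechet_derivative w (at (x + s *\<^sub>R e)) (h *\<^sub>R e))) (at s)"
          by (rule has_derivative_compose[OF _ der]) (auto intro!: derivative_eq_intros)
        then show ?thesis
          using linear_scale[OF has_derivative_linear[OF der]] by (simp add: D_def)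
      qed
      show "onorm (\<lambda>h. h *\<^sub>R D (x + s *\<^sub>R e)) \<le> B" for s
        using mult_left_mono[OF B abs_ge_zero] by (intro onorm_bound \<open>B \<ge> 0\<close>) (simp add: mult.commute)
    qed auto
    then show ?thesis using that by simp
  qed
  \<comment> \<open>Difference quotients of step 1/(n+1) in direction \<open>e\<close>. Translation
    invariance makes each of them integrate to 0, and dominated convergence carries this over to the
    derivative.\<close>
  define q where "q n x = real (Suc n) *\<^sub>R (w (x + (1 / real (Suc n)) *\<^sub>R e) - w x)" for n x
  have meas_w[measurable]: "w \<in> borel_measurable borel"
    using contw by (rule borel_measurable_continuous_onI)
  have int_w: "integrable lborel w"
  proof -
    have "integrable lborel (\<lambda>x. indicator K x *\<^sub>R w x)"
      using contw by (intro borel_integrable_compact K) (auto intro: continuous_on_subset)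
    moreover have "(\<lambda>x. indicator K x *\<^sub>R w x) = w"
      using supp by (auto simp: indicator_def)
    ultimately show ?thesis by simp
  qed
  have shift: "integrable lborel (\<lambda>x. w (x + v))" "(\<integral>x. w (x + v) \<partial>lborel) = (\<integral>x. w x \<partial>lborel)" for v
  proof -
    have "integrable (distr lborel borel ((+) v)) w" using int_w by (simp add: lborel_distr_plus)
    then show "integrable lborel (\<lambda>x. w (x + v))"
      by (subst (asm) integrable_distr_eq) (auto simp: add.commute)
    have "(\<integral>x. w x \<partial>lborel) = (\<integral>x. w x \<partial>distr lborel borel ((+) v))" by (simp add: lborel_distr_plus)
    also have "\<dots> = (\<integral>x. w (v + x) \<partial>lborel)" by (rule integral_distr) auto
    finally show "(\<integral>x. w (x + v) \<partial>lborel) = (\<integral>x. w x \<partial>lborel)" by (simp add: add.commute)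
  qed
  have q0: "(\<integral>x. q n x \<partial>lborel) = 0" for n
    unfolding q_def using shift int_w by simp
  have "(\<lambda>n. \<integral>x. q n x \<partial>lborel) \<longlonglongrightarrow> (\<integral>x. D x \<partial>lborel)"
  proof (rule integral_dominated_convergence)
    show "D \<in> borel_measurable lborel"
      using borel_measurable_continuous_onI[OF contD] by simp
    show "q n \<in> borel_measurable lborel" for n
      unfolding q_def by measurable
    show "integrable lborel (\<lambda>x. indicator C x *\<^sub>R B)"
      unfolding C_def by (intro borel_integrable_compact compact_cball continuous_on_const)
    show "AE x in lborel. (\<lambda>n. q n x) \<longlonglongrightarrow> D x"
    proof (rule AE_I2)
      fix x
      have "((\<lambda>s. w (x + s *\<^sub>R e)) has_derivative (\<lambda>h. frechet_derivative w (at x) (h *\<^sub>R e))) (at 0)"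
        by (rule has_derivative_compose[where f = "\<lambda>s. x + s *\<^sub>R e"]) (auto intro!: derivative_eq_intros der)
      then have "((\<lambda>s. w (x + s *\<^sub>R e)) has_vector_derivative D x) (at 0)"
        using linear_scale[OF has_derivative_linear[OF der]] by (simp add: D_def has_vector_derivative_def)
      then have lim: "((\<lambda>h. (w (x + h *\<^sub>R e) - w x - h *\<^sub>R D x) /\<^sub>R \<bar>h\<bar>) \<longlongrightarrow> 0) (at 0)"
        by (simp add: has_vector_derivative_def has_derivative_def)
      have "((\<lambda>h. norm ((w (x + h *\<^sub>R e) - w x) /\<^sub>R h - D x)) \<longlongrightarrow> 0) (at 0)"
      proof (rule Lim_transform_eventually[OF tendsto_norm_zero[OF lim]])
        have "norm ((w (x + h *\<^sub>R e) - w x - h *\<^sub>R D x) /\<^sub>R \<bar>h\<bar>) = norm ((w (x + h *\<^sub>R e) - w x) /\<^sub>R h - D x)"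
          if "h \<noteq> 0" for h
        proof -
          have "(w (x + h *\<^sub>R e) - w x) /\<^sub>R h - D x = (w (x + h *\<^sub>R e) - w x - h *\<^sub>R D x) /\<^sub>R h"
            using that by (simp add: scaleR_diff_right)
          then show ?thesis by simp
        qed
        then show "\<forall>\<^sub>F h in at 0. norm ((w (x + h *\<^sub>R e) - w x - h *\<^sub>R D x) /\<^sub>R \<bar>h\<bar>) =
            norm ((w (x + h *\<^sub>R e) - w x) /\<^sub>R h - D x)"
          by (simp add: eventually_at_filter)
      qed
      then have "((\<lambda>h. (w (x + h *\<^sub>R e) - w x) /\<^sub>R h) \<longlongrightarrow> D x) (at 0)"
        by (simp add: tendsto_norm_zero_iff LIM_zero_iff)
      moreover have "filterlim (\<lambda>n. 1 / real (Suc n)) (at 0) sequentially"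
      proof (rule filterlim_atI)
        show "(\<lambda>n. 1 / real (Suc n)) \<longlonglongrightarrow> 0"
          by (rule LIMSEQ_Suc[OF lim_1_over_n])
      qed simp
      ultimately have "((\<lambda>n. (w (x + (1 / real (Suc n)) *\<^sub>R e) - w x) /\<^sub>R (1 / real (Suc n))) \<longlonglongrightarrow> D x)"
        by (rule filterlim_compose)
      then show "(\<lambda>n. q n x) \<longlonglongrightarrow> D x"
        by (simp add: q_def)
    qed
    show "AE x in lborel. norm (q n x) \<le> indicator C x *\<^sub>R B" for n
    proof (rule AE_I2)
      fix x
      show "norm (q n x) \<le> indicator C x *\<^sub>R B"
      proof (cases "x \<in> C")
        case True
        have "norm (q n x) = real (Suc n) * norm (w (x + (1 / real (Suc n)) *\<^sub>R e) - w x)"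
          by (simp add: q_def)
        also have "\<dots> \<le> real (Suc n) * (B * (1 / real (Suc n)))"
          by (intro mult_left_mono line) auto
        finally show ?thesis using True by simp
      next
        case False
        then have xC: "R + norm e < norm x" by (simp add: C_def)
        have "norm ((1 / real (Suc n)) *\<^sub>R e) \<le> norm e"
          by (simp add: divide_le_eq mult_le_cancel_left1)
        then have "R < norm (x + (1 / real (Suc n)) *\<^sub>R e)"
          using xC norm_diff_ineq[of x "(1 / real (Suc n)) *\<^sub>R e"] by linarith
        then have "w (x + (1 / real (Suc n)) *\<^sub>R e) = 0"
          using R supp by (meson not_le)
        moreover have "w x = 0"
          using xC R supp norm_ge_zero[of e] by (metis add_increasing2 not_le)
        ultimately show ?thesis using \<open>x \<notin> C\<close> by (simp add: q_def)
      qed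
    qed
  qed
  then have "(\<integral>x. D x \<partial>lborel) = 0"
    unfolding q0 using LIMSEQ_unique[OF _ tendsto_const] by blast
  then show ?thesis by (simp add: D_def)
qed

text \<open>The product p F extended by zero is smooth everywhere: it is smooth on \<open>S\<close>,
  vanishes on the complement of \<open>K\<close>, and these two open sets cover the space. Its
  derivatives therefore integrate to 0.\<close>

lemma integration_by_parts:
  fixes p F :: "'e::euclidean_space \<Rightarrow> complex"
  assumes S: "open S" and p: "smooth_on S p" and F: "smooth_on S F"
    and K: "compact K" "K \<subseteq> S" and supp: "\<And>y. y \<in> S - K \<Longrightarrow> F y = 0"
  shows "(\<integral>y. indicator S y *\<^sub>R (frechet_derivative p (at y) e * F y) \<partial>lborel) =
    - (\<integral>y. indicator S y *\<^sub>R (p y * frechet_derivative F (at y) e) \<partial>lborel)"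
    and "integrable lborel (\<lambda>y. indicator S y *\<^sub>R (frechet_derivative p (at y) e * F y))"
    and "integrable lborel (\<lambda>y. indicator S y *\<^sub>R (p y * frechet_derivative F (at y) e))"
proof -
  have openK: "open (- K)" using K by (simp add: compact_imp_closed open_Compl)
  define w where "w y = (if y \<in> S then p y * F y else 0)" for y
  have "smooth_on S w"
    by (rule smooth_on_cong[OF S _ smooth_on_mult[OF S p F]]) (simp add: w_def)
  moreover have "smooth_on (- K) w"
    by (rule smooth_on_cong[OF openK _ smooth_on_const[of _ 0]]) (use supp in \<open>auto simp: w_def\<close>)
  ultimately have "smooth_on (S \<union> - K) w" by (rule smooth_on_Un[OF S openK])
  moreover have "S \<union> - K = UNIV" using K by auto
  ultimately have w: "Ck_on 1 UNIV w" by (simp add: smooth_on_def)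
  have dF0: "frechet_derivative F (at y) e = 0" if "y \<in> S - K" for y
  proof -
    have "open (S - K)" using S K by (simp add: open_Diff compact_imp_closed)
    have "((\<lambda>y. 0) has_derivative frechet_derivative F (at y)) (at y)"
      by (rule has_derivative_transform_within_open[OF smooth_on_has_derivative[OF F] \<open>open (S - K)\<close> that])
        (use that supp in auto)
    then have "frechet_derivative F (at y) = (\<lambda>y. 0)"
      using frechet_derivative_at by fastforce
    then show ?thesis by simp
  qed
  have dw: "frechet_derivative w (at y) e = indicator S y *\<^sub>R (frechet_derivative p (at y) e * F y)
      + indicator S y *\<^sub>R (p y * frechet_derivative F (at y) e)" for y
  proof (cases "y \<in> S")
    case True
    have "((\<lambda>y. p y * F y) has_derivative
        (\<lambda>h. p y * frechet_derivative F (at y) h + frechet_derivative p (at y) h * F y)) (at y)"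
      by (intro has_derivative_mult smooth_on_has_derivative[OF p True] smooth_on_has_derivative[OF F True])
    then have "(w has_derivative
        (\<lambda>h. p y * frechet_derivative F (at y) h + frechet_derivative p (at y) h * F y)) (at y)"
      by (rule has_derivative_transform_within_open[OF _ S True]) (simp add: w_def)
    from frechet_derivative_at[OF this, symmetric] True show ?thesis by simp
  next
    case False
    then have "y \<in> - K" using K by auto
    have "(w has_derivative (\<lambda>h. 0)) (at y)"
      by (rule has_derivative_transform_within_open[OF has_derivative_const openK \<open>y \<in> - K\<close>])
        (use supp in \<open>auto simp: w_def\<close>)
    from frechet_derivative_at[OF this, symmetric] False show ?thesis by simp
  qed
  have int: "integrable lborel (\<lambda>y. indicator S y *\<^sub>R h y)"
    if h: "continuous_on S h" "\<And>y. y \<in> S - K \<Longrightarrow> h y = 0" for h :: "'e \<Rightarrow> complex"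
  proof -
    have "integrable lborel (\<lambda>y. indicator K y *\<^sub>R h y)"
      using h K by (intro borel_integrable_compact) (auto intro: continuous_on_subset)
    moreover have "(\<lambda>y. indicator K y *\<^sub>R h y) = (\<lambda>y. indicator S y *\<^sub>R h y)"
      using h K by (auto simp: indicator_def fun_eq_iff)
    ultimately show ?thesis by simp
  qed
  show i1: "integrable lborel (\<lambda>y. indicator S y *\<^sub>R (frechet_derivative p (at y) e * F y))"
    using p F supp by (intro int continuous_on_mult smooth_on_imp_continuous_on smooth_on_derivative) auto
  show i2: "integrable lborel (\<lambda>y. indicator S y *\<^sub>R (p y * frechet_derivative F (at y) e))"
    using p F dF0 by (intro int continuous_on_mult smooth_on_imp_continuous_on smooth_on_derivative) auto
  have "0 = (\<integral>y. frechet_derivative w (at y) e \<partial>lborel)"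
    by (rule integral_derivative_compact_support[OF w K(1), symmetric]) (use supp in \<open>auto simp: w_def\<close>)
  then show "(\<integral>y. indicator S y *\<^sub>R (frechet_derivative p (at y) e * F y) \<partial>lborel) =
    - (\<integral>y. indicator S y *\<^sub>R (p y * frechet_derivative F (at y) e) \<partial>lborel)"
    unfolding dw Bochner_Integration.integral_add[OF i1 i2] by (simp add: eq_neg_iff_add_eq_0)
qed

section \<open>Charts and the volume measure\<close>

text \<open>Every matrix on the segment from the identity to \<open>G\<close> is positive definite,
  hence injective; the determinant is 1 at the start and cannot vanish on the way.\<close>

lemma det_pos_definite:
  fixes G :: "real^'n^'n"
  assumes G: "\<And>v. v \<noteq> 0 \<Longrightarrow> 0 < v \<bullet> (G *v v)"
  shows "0 < det G"
proof (rule ccontr)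
  assume "\<not> 0 < det G"
  define M where "M t = (\<chi> i j. (1 - t) * (mat 1 :: real^'n^'n) $ i $ j + t * G $ i $ j)" for t :: real
  have "smooth_on UNIV (\<lambda>t. det (M t))"
    unfolding M_def
    by (rule smooth_on_det)
      (auto intro!: smooth_on_add smooth_on_mult smooth_on_diff smooth_on_const smooth_on_linear[OF bounded_linear_ident])
  then have "continuous_on {0..1} (\<lambda>t. det (M t))"
    by (intro smooth_on_imp_continuous_on) (rule smooth_on_subset, auto)
  moreover have "M 0 = mat 1" "M 1 = G" by (simp_all add: M_def vec_eq_iff)
  ultimately obtain t where t: "0 \<le> t" "t \<le> 1" "det (M t) = 0"
    using IVT2'[of "\<lambda>t. det (M t)" 1 0 0] \<open>\<not> 0 < det G\<close> by auto
  then have "\<not> invertible (M t)" by (simp add: invertible_det_nz)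
  then obtain v where v: "v \<noteq> 0" "M t *v v = 0"
    by (metis invertible_left_inverse matrix_left_invertible_ker)
  have "M t *v v = (1 - t) *\<^sub>R v + t *\<^sub>R (G *v v)"
  proof -
    have "M t = (1 - t) *\<^sub>R mat 1 + t *\<^sub>R G" by (simp add: M_def vec_eq_iff)
    then show ?thesis
      by (simp add: matrix_vector_mult_add_rdistrib scaleR_matrix_vector_assoc[symmetric])
  qed
  then have "0 = (1 - t) * (v \<bullet> v) + t * (v \<bullet> (G *v v))"
    using v by (metis inner_add_right inner_scaleR_right inner_zero_right)
  moreover have "0 < (1 - t) * (v \<bullet> v) + t * (v \<bullet> (G *v v))"
  proof (cases "t = 0")
    case False
    then have "0 < t * (v \<bullet> (G *v v))" using t G[OF v(1)] by simp
    moreover have "0 \<le> (1 - t) * (v \<bullet> v)" using t by simp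
    ultimately show ?thesis by linarith
  qed (use v in simp)
  ultimately show False by simp
qed

text \<open>Second countability reduces a local property to countably many open sets; such sequences
  of charts, bumps and frames take the place of partitions of unity. A nonempty \<open>S\<close>
  ensures a nonempty subcover, which can then be indexed by all natural numbers.\<close>

lemma Lindelof_sequence:
  fixes S :: "'a::second_countable_topology set"
  assumes "S \<noteq> {}" and ex: "\<And>x. x \<in> S \<Longrightarrow> \<exists>U. open U \<and> x \<in> U \<and> U \<subseteq> S \<and> P U"
  obtains U :: "nat \<Rightarrow> 'a set" where "\<And>k. open (U k)" "\<And>k. P (U k)" "(\<Union>k. U k) = S"
proof -
  define \<U> where "\<U> = {U. open U \<and> U \<subseteq> S \<and> P U}"
  have "\<And>U. U \<in> \<U> \<Longrightarrow> open U" by (simp add: \<U>_def)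
  then obtain \<F> where \<F>: "\<F> \<subseteq> \<U>" "countable \<F>" "\<Union>\<F> = \<Union>\<U>"
    by (rule Lindelof)
  have "\<Union>\<U> = S" using ex unfolding \<U>_def by blast
  then have cover: "\<Union>\<F> = S" and ne: "\<F> \<noteq> {}" using \<F>(3) \<open>S \<noteq> {}\<close> by auto
  have mem: "from_nat_into \<F> k \<in> \<U>" for k
    using from_nat_into[OF ne, of k] \<F>(1) by blast
  show ?thesis
  proof (rule that)
    show "(\<Union>k. from_nat_into \<F> k) = S"
      using cover range_from_nat_into[OF ne \<F>(2)] by simp
  qed (use mem in \<open>simp_all add: \<U>_def\<close>)
qed

lemma measure_series:
  fixes \<nu> :: "nat \<Rightarrow> 'b::topological_space measure"
  assumes "\<And>k. sets (\<nu> k) = sets borel"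
  obtains \<mu> where "sets \<mu> = sets borel" "\<And>B. B \<in> sets borel \<Longrightarrow> emeasure \<mu> B = (\<Sum>k. emeasure (\<nu> k) B)"
proof -
  define m where "m B = (\<Sum>k. emeasure (\<nu> k) B)" for B
  show ?thesis
  proof (rule that[of "measure_of UNIV (sets borel) m"])
    show "sets (measure_of UNIV (sets borel) m) = sets borel"
      by (metis sets.sets_measure_of_eq space_borel)
    fix B :: "'b set" assume "B \<in> sets borel"
    have "emeasure (measure_of UNIV (sets borel) m) B = m B"
    proof (rule emeasure_measure_of_sigma)
      show "sigma_algebra UNIV (sets (borel :: 'b measure))"
        by (metis sets.sigma_algebra_axioms space_borel)
      show "positive (sets borel) m" by (simp add: positive_def m_def)
      show "countably_additive (sets borel) m"
      proof (rule countably_additiveI)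
        fix F :: "nat \<Rightarrow> 'b set" assume F: "range F \<subseteq> sets borel" "disjoint_family F"
        \<comment> \<open>Reading the sum over k as an integral for counting measure allows the two
          series of nonnegative terms to be exchanged.\<close>
        have "(\<Sum>i. m (F i)) = (\<integral>\<^sup>+k. (\<Sum>i. emeasure (\<nu> k) (F i)) \<partial>count_space UNIV)"
          unfolding m_def by (subst nn_integral_suminf) (simp_all add: nn_integral_count_space_nat)
        also have "\<dots> = (\<Sum>k. emeasure (\<nu> k) (\<Union>i. F i))"
          using F assms by (simp add: nn_integral_count_space_nat suminf_emeasure)
        finally show "(\<Sum>i. m (F i)) = m (\<Union> (range F))" by (simp add: m_def)
      qed
    qed fact
    then show "emeasure (measure_of UNIV (sets borel) m) B = (\<Sum>k. emeasure (\<nu> k) B)"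
      by (simp add: m_def)
  qed
qed

section \<open>Charts of a Riemannian manifold\<close>

locale riemannian =
  fixes A :: "('a::{second_countable_topology, t2_space}, 'n::finite) chart set"
    and g :: "('a, 'n) chart \<Rightarrow> 'a \<Rightarrow> real ^ 'n ^ 'n"
  assumes manifold: "connected_riemannian_manifold A g"
begin

definition img :: "('a, 'n) chart \<Rightarrow> (real^'n) set" where
  "img c = snd c ` fst c"

lemma chart:
  assumes "c \<in> A"
  shows open_dom: "open (fst c)" and open_img: "open (img c)"
    and continuous_on_chart: "continuous_on (fst c) (snd c)"
    and continuous_on_chart_inv: "continuous_on (img c) (chart_inv c)"
    and chart_inv_chart: "\<And>x. x \<in> fst c \<Longrightarrow> chart_inv c (snd c x) = x"
    and chart_chart_inv: "\<And>y. y \<in> img c \<Longrightarrow> snd c (chart_inv c y) = y"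
    and chart_inv_in: "\<And>y. y \<in> img c \<Longrightarrow> chart_inv c y \<in> fst c"
    and chart_in: "\<And>x. x \<in> fst c \<Longrightarrow> snd c x \<in> img c"
    and inj_chart: "inj_on (snd c) (fst c)"
proof -
  have "is_chart c"
    using assms manifold by (simp add: connected_riemannian_manifold_def smooth_atlas_def)
  then have h: "homeomorphism (fst c) (img c) (snd c) (chart_inv c)"
    and "open (fst c)" "open (img c)"
    by (simp_all add: is_chart_def img_def)
  then show "open (fst c)" "open (img c)" by simp_all
  show "continuous_on (fst c) (snd c)" "continuous_on (img c) (chart_inv c)"
    "\<And>x. x \<in> fst c \<Longrightarrow> chart_inv c (snd c x) = x"
    "\<And>y. y \<in> img c \<Longrightarrow> snd c (chart_inv c y) = y"
    "\<And>y. y \<in> img c \<Longrightarrow> chart_inv c y \<in> fst c"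
    "\<And>x. x \<in> fst c \<Longrightarrow> snd c x \<in> img c"
    using h by (auto simp: homeomorphism_def)
  then show "inj_on (snd c) (fst c)" by (metis inj_onI)
qed

lemma chart_exists: "\<exists>c\<in>A. x \<in> fst c"
proof -
  have "x \<in> (\<Union>c\<in>A. fst c)"
    using manifold by (simp add: connected_riemannian_manifold_def smooth_atlas_def)
  then show ?thesis by blast
qed

lemma smooth_transition:
  "c \<in> A \<Longrightarrow> d \<in> A \<Longrightarrow> smooth_on (snd c ` (fst c \<inter> fst d)) (transition c d)"
  using manifold by (simp add: connected_riemannian_manifold_def smooth_atlas_def)

lemma open_chart_image:
  assumes "c \<in> A" "open U" "U \<subseteq> fst c"
  shows "open (snd c ` U)"
proof -
  have eq: "snd c ` U = img c \<inter> chart_inv c -` U"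
  proof safe
    fix y assume "y \<in> img c" "chart_inv c y \<in> U"
    then show "y \<in> snd c ` U" using chart_chart_inv[OF assms(1)] by (metis image_eqI)
  qed (use assms chart_in[OF assms(1)] chart_inv_chart[OF assms(1)] in auto)
  show ?thesis
    unfolding eq by (rule continuous_open_preimage[OF continuous_on_chart_inv open_img]) (use assms in auto)
qed

lemma metric: "riemannian_metric A g"
  using manifold by (simp add: connected_riemannian_manifold_def)

lemma metric_smooth: "c \<in> A \<Longrightarrow> smooth_on (img c) (\<lambda>y. g c (chart_inv c y) $ i $ j)"
  using metric unfolding riemannian_metric_def img_def by blast

lemma metric_sym: "c \<in> A \<Longrightarrow> x \<in> fst c \<Longrightarrow> transpose (g c x) = g c x"
  using metric unfolding riemannian_metric_def by blast

lemma metric_pos: "c \<in> A \<Longrightarrow> x \<in> fst c \<Longrightarrow> v \<noteq> 0 \<Longrightarrow> 0 < v \<bullet> (g c x *v v)"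
  using metric unfolding riemannian_metric_def by blast

lemma metric_transform: "c \<in> A \<Longrightarrow> d \<in> A \<Longrightarrow> x \<in> fst c \<Longrightarrow> x \<in> fst d \<Longrightarrow>
    g c x = transpose (jac c d x) ** g d x ** jac c d x"
  using metric unfolding riemannian_metric_def by blast

lemma metric_det_pos: "c \<in> A \<Longrightarrow> x \<in> fst c \<Longrightarrow> 0 < det (g c x)"
  using metric_pos by (intro det_pos_definite) auto

lemma countable_atlas:
  obtains C :: "nat \<Rightarrow> ('a, 'n) chart" where "\<And>k. C k \<in> A" "(\<Union>k. fst (C k)) = UNIV"
proof -
  obtain U :: "nat \<Rightarrow> 'a set" where U: "\<And>k. \<exists>c\<in>A. U k = fst c" "(\<Union>k. U k) = UNIV"
  proof (rule Lindelof_sequence[OF UNIV_not_empty, of "\<lambda>U. \<exists>c\<in>A. U = fst c"])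
    show "\<exists>U. open U \<and> x \<in> U \<and> U \<subseteq> UNIV \<and> (\<exists>c\<in>A. U = fst c)" for x
      using chart_exists[of x] open_dom by blast
  qed (rule that)
  from U(1) obtain C where C: "\<And>k. C k \<in> A" "\<And>k. U k = fst (C k)" by metis
  show ?thesis
    by (rule that[of C]) (use C U(2) in simp_all)
qed

lemma borel_measurable_chartwise:
  assumes "\<And>c. c \<in> A \<Longrightarrow> f \<in> measurable (restrict_space borel (fst c)) N"
  shows "f \<in> measurable borel N"
proof -
  obtain C :: "nat \<Rightarrow> ('a, 'n) chart" where C: "\<And>k. C k \<in> A" "(\<Union>k. fst (C k)) = UNIV"
    using countable_atlas by blast
  show ?thesis
    by (rule measurable_piecewise_restrict[where C = "range (\<lambda>k. fst (C k))"])
      (use C(2) assms[OF C(1)] open_dom[OF C(1)] in auto)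
qed

text \<open>A total version of the inverse chart, constant off \<open>img c\<close>, so that it is
  Borel on the whole coordinate space and measures can be pushed forward along it.\<close>

definition parametrization :: "('a, 'n) chart \<Rightarrow> real^'n \<Rightarrow> 'a" where
  "parametrization c y = (if y \<in> img c then chart_inv c y else undefined)"

lemma borel_measurable_on_img:
  fixes f :: "real^'n \<Rightarrow> 'b::real_normed_vector"
  assumes "c \<in> A" "continuous_on (img c) f"
  shows "(\<lambda>y. indicator (img c) y *\<^sub>R f y) \<in> borel_measurable borel"
  by (rule borel_measurable_continuous_on_indicator) (use assms open_img in auto)

lemma measurable_parametrization:
  assumes "c \<in> A"
  shows "parametrization c \<in> measurable borel borel"
proof -
  have "img c \<in> sets borel" using open_img[OF assms] by simp
  then show ?thesis
    unfolding parametrization_def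
    using borel_measurable_continuous_on_restrict[OF continuous_on_chart_inv[OF assms]]
    by (subst measurable_If_restrict_space_iff) (auto simp: Collect_mem_eq)
qed

text \<open>The intersection with \<open>img c\<close> removes the points outside the image, whose
  default value may happen to lie in \<open>B\<close>.\<close>

lemma chart_image_eq:
  assumes "c \<in> A" "B \<subseteq> fst c"
  shows "snd c ` B = parametrization c -` B \<inter> img c"
proof safe
  fix x assume "x \<in> B"
  then show "snd c x \<in> parametrization c -` B" "snd c x \<in> img c"
    using assms chart_in[OF assms(1)] chart_inv_chart[OF assms(1)] by (auto simp: parametrization_def)
next
  fix y assume "y \<in> img c" "parametrization c y \<in> B"
  then show "y \<in> snd c ` B" using chart_chart_inv[OF assms(1)] by (metis image_eqI parametrization_def)
qed

lemma borel_chart_image: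
  assumes "c \<in> A" "B \<in> sets borel" "B \<subseteq> fst c"
  shows "snd c ` B \<in> sets borel"
  unfolding chart_image_eq[OF assms(1,3)]
  using measurable_sets[OF measurable_parametrization[OF assms(1)] assms(2)] open_img[OF assms(1)] by simp

section \<open>Volume in a chart and its independence of the chart\<close>

definition vdens :: "('a, 'n) chart \<Rightarrow> real^'n \<Rightarrow> real" where
  "vdens c y = sqrt (det (g c (chart_inv c y)))"

lemma vdens_pos: "c \<in> A \<Longrightarrow> y \<in> img c \<Longrightarrow> 0 < vdens c y"
  by (simp add: vdens_def metric_det_pos chart_inv_in)

lemma smooth_vdens: "c \<in> A \<Longrightarrow> smooth_on (img c) (vdens c)"
  unfolding vdens_def
  by (intro smooth_on_sqrt smooth_on_det metric_smooth open_img metric_det_pos chart_inv_in)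

lemma measurable_vdens:
  assumes "c \<in> A" "S \<in> sets borel" "S \<subseteq> img c"
  shows "(\<lambda>y. vdens c y * indicator S y) \<in> borel_measurable borel"
proof -
  have "(\<lambda>y. indicator (img c) y *\<^sub>R vdens c y) \<in> borel_measurable borel"
    using smooth_vdens assms by (intro borel_measurable_on_img smooth_on_imp_continuous_on)
  then have "(\<lambda>y. (indicator (img c) y *\<^sub>R vdens c y) * indicator S y) \<in> borel_measurable borel"
    using assms by measurable
  moreover have "(\<lambda>y. (indicator (img c) y *\<^sub>R vdens c y) * indicator S y) = (\<lambda>y. vdens c y * indicator S y)"
    using assms by (auto simp: indicator_def fun_eq_iff)
  ultimately show ?thesis by simp
qed

text \<open>The volume of one chart domain, extended by zero to the whole manifold. As an image of a
  density it comes with transfer rules for integrals.\<close>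

definition local_vol :: "('a, 'n) chart \<Rightarrow> 'a measure" where
  "local_vol c = distr (density lborel (\<lambda>y. ennreal (vdens c y * indicator (img c) y))) borel (parametrization c)"

lemma emeasure_local_vol:
  assumes c: "c \<in> A" and B: "B \<in> sets borel"
  shows "emeasure (local_vol c) B = (\<integral>\<^sup>+y\<in>snd c ` (B \<inter> fst c). ennreal (vdens c y) \<partial>lborel)"
proof -
  have [measurable]: "(\<lambda>y. vdens c y * indicator (img c) y) \<in> borel_measurable borel"
    using c open_img by (intro measurable_vdens) auto
  have [measurable]: "parametrization c -` B \<in> sets borel"
    using measurable_sets[OF measurable_parametrization[OF c] B] by simp
  have "emeasure (local_vol c) B = emeasure (density lborel (\<lambda>y. ennreal (vdens c y * indicator (img c) y))) (parametrization c -` B)"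
    unfolding local_vol_def using measurable_parametrization[OF c] B by (simp add: emeasure_distr)
  also have "\<dots> = (\<integral>\<^sup>+y. ennreal (vdens c y * indicator (img c) y) * indicator (parametrization c -` B) y \<partial>lborel)"
    by (rule emeasure_density) auto
  also have "\<dots> = (\<integral>\<^sup>+y\<in>snd c ` (B \<inter> fst c). ennreal (vdens c y) \<partial>lborel)"
    using c chart_inv_in[OF c] by (intro nn_integral_cong) (auto simp: chart_image_eq indicator_def parametrization_def)
  finally show ?thesis .
qed

text \<open>The change of variables contributes |det J|, and the transformation law of the metric
  gives sqrt(det g_c) = |det J| sqrt(det g_d), so the two factors match.\<close>

lemma local_vol_eq:
  assumes c: "c \<in> A" and d: "d \<in> A" and B: "B \<in> sets borel" "B \<subseteq> fst c" "B \<subseteq> fst d"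
  shows "emeasure (local_vol c) B = emeasure (local_vol d) B"
proof -
  let ?S = "snd c ` B" and ?T = "transition c d"
  have T: "?T (snd c x) = snd d x" if "x \<in> fst c" for x
    using that by (simp add: transition_def chart_inv_chart[OF c])
  have TS: "?T ` ?S = snd d ` B"
    unfolding image_image using T B by (intro image_cong) auto
  have der: "(?T has_derivative frechet_derivative ?T (at y)) (at y)" if "y \<in> ?S" for y
    using that B by (intro smooth_on_has_derivative[OF smooth_transition[OF c d]]) auto
  have "(\<integral>\<^sup>+y\<in>?T ` ?S. ennreal (vdens d y) \<partial>lborel) = (\<integral>\<^sup>+y\<in>?S. ennreal (vdens c y) \<partial>lborel)"
  proof (rule nn_integral_change_of_variables[OF _ _ der])
    show "?S \<in> sets borel" using borel_chart_image c B by blast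
    show "inj_on ?T ?S"
      using inj_chart[OF d] B T by (auto simp: inj_on_def) (metis subsetD)
    show "(\<lambda>y. vdens d y * indicator (?T ` ?S) y) \<in> borel_measurable borel"
      unfolding TS using B d by (intro measurable_vdens borel_chart_image) (auto simp: img_def)
    show "(\<lambda>y. vdens c y * indicator ?S y) \<in> borel_measurable borel"
      using B c by (intro measurable_vdens borel_chart_image) (auto simp: img_def)
    show "0 \<le> vdens d y" if "y \<in> ?T ` ?S" for y
      using that B d unfolding TS by (intro less_imp_le vdens_pos) (auto simp: img_def)
    show "vdens c y = \<bar>det (matrix (frechet_derivative ?T (at y)))\<bar> * vdens d (?T y)" if "y \<in> ?S" for y
    proof -
      from that obtain x where x: "x \<in> B" "y = snd c x" by auto
      have xc: "x \<in> fst c" and xd: "x \<in> fst d" using x B by auto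
      have J: "matrix (frechet_derivative ?T (at y)) = jac c d x" by (simp add: jac_def x)
      have "det (g c x) = det (jac c d x) * det (g d x) * det (jac c d x)"
        by (subst metric_transform[OF c d xc xd]) (simp add: det_mul det_transpose)
      also have "\<dots> = (det (jac c d x))\<^sup>2 * det (g d x)" by (simp add: power2_eq_square)
      finally have "sqrt (det (g c x)) = \<bar>det (jac c d x)\<bar> * sqrt (det (g d x))"
        by (simp add: real_sqrt_mult)
      moreover have "vdens c y = sqrt (det (g c x))"
        using xc by (simp add: vdens_def x(2) chart_inv_chart[OF c])
      moreover have "vdens d (?T y) = sqrt (det (g d x))"
        using xd by (simp add: vdens_def x(2) T[OF xc] chart_inv_chart[OF d])
      ultimately show ?thesis by (simp only: J)
    qed
  qed
  then show ?thesis
    using B unfolding TS by (simp add: emeasure_local_vol c d Int_absorb2)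
qed

lemma countable_partition:
  obtains C :: "nat \<Rightarrow> ('a, 'n) chart" and E :: "nat \<Rightarrow> 'a set"
  where "\<And>k. C k \<in> A" "\<And>k. E k \<in> sets borel" "\<And>k. E k \<subseteq> fst (C k)" "disjoint_family E" "(\<Union>k. E k) = UNIV"
proof -
  obtain C :: "nat \<Rightarrow> ('a, 'n) chart" where C: "\<And>k. C k \<in> A" "(\<Union>k. fst (C k)) = UNIV"
    using countable_atlas by blast
  let ?E = "disjointed (\<lambda>k. fst (C k))"
  show ?thesis
  proof (rule that[of C ?E])
    show "?E k \<in> sets borel" for k
      using open_dom[OF C(1)] by (auto simp: disjointed_def)
    show "?E k \<subseteq> fst (C k)" for k by (rule disjointed_subset)
  qed (use C in \<open>auto simp: disjoint_family_disjointed UN_disjointed_eq\<close>)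
qed

text \<open>The property under the definite description in \<open>vol\<close>, with the coordinate
  integral expressed by a measure so that pieces from different charts can be added.\<close>

definition is_vol :: "'a measure \<Rightarrow> bool" where
  "is_vol \<mu> \<longleftrightarrow> sets \<mu> = sets borel \<and>
     (\<forall>c\<in>A. \<forall>B\<in>sets borel. B \<subseteq> fst c \<longrightarrow> emeasure \<mu> B = emeasure (local_vol c) B)"

lemma emeasure_partition:
  fixes E :: "nat \<Rightarrow> 'b::topological_space set"
  assumes "sets \<mu> = sets borel" "\<And>k. E k \<in> sets borel" "disjoint_family E" "(\<Union>k. E k) = UNIV" "B \<in> sets borel"
  shows "emeasure \<mu> B = (\<Sum>k. emeasure \<mu> (B \<inter> E k))"
proof -
  have "(\<Sum>k. emeasure \<mu> (B \<inter> E k)) = emeasure \<mu> (\<Union>k. B \<inter> E k)"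
  proof (rule suminf_emeasure)
    show "disjoint_family (\<lambda>k. B \<inter> E k)"
      using assms(3) unfolding disjoint_family_on_def by blast
  qed (use assms in auto)
  also have "(\<Union>k. B \<inter> E k) = B" using assms(4) by auto
  finally show ?thesis ..
qed

lemma is_vol_unique:
  assumes "is_vol \<mu>" "is_vol \<nu>"
  shows "\<mu> = \<nu>"
proof -
  obtain C :: "nat \<Rightarrow> ('a, 'n) chart" and E where P: "\<And>k. C k \<in> A" "\<And>k. E k \<in> sets borel"
    "\<And>k. E k \<subseteq> fst (C k)" "disjoint_family E" "(\<Union>k. E k) = UNIV"
    using countable_partition by blast
  have sets: "sets \<mu> = sets borel" "sets \<nu> = sets borel" using assms by (simp_all add: is_vol_def)
  show ?thesis
  proof (rule measure_eqI)
    fix B assume "B \<in> sets \<mu>"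
    then have B: "B \<in> sets borel" using sets by simp
    have "emeasure \<mu> (B \<inter> E k) = emeasure \<nu> (B \<inter> E k)" for k
    proof -
      have "B \<inter> E k \<in> sets borel" "B \<inter> E k \<subseteq> fst (C k)" using B P(2,3)[of k] by auto
      then show ?thesis using assms P(1)[of k] by (simp add: is_vol_def)
    qed
    then show "emeasure \<mu> B = emeasure \<nu> B"
      by (simp add: emeasure_partition[OF _ P(2,4,5) B] sets)
  qed (simp add: sets)
qed

text \<open>Restrict the volume of the k-th chart to the k-th piece of a countable Borel partition
  and add up. For a set inside any chart \<open>c\<close> each summand may be computed in
  \<open>c\<close>, since local volumes agree on overlaps.\<close>

lemma is_vol_exists: "\<exists>\<mu>. is_vol \<mu>"
proof -
  obtain C :: "nat \<Rightarrow> ('a, 'n) chart" and E where P: "\<And>k. C k \<in> A" "\<And>k. E k \<in> sets borel"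
    "\<And>k. E k \<subseteq> fst (C k)" "disjoint_family E" "(\<Union>k. E k) = UNIV"
    using countable_partition by blast
  have sets_lv: "sets (local_vol c) = sets borel" for c by (simp add: local_vol_def)
  obtain \<mu> where sets_\<mu>: "sets \<mu> = sets borel" and
    m: "\<And>B. B \<in> sets borel \<Longrightarrow> emeasure \<mu> B = (\<Sum>k. emeasure (density (local_vol (C k)) (indicator (E k))) B)"
    using measure_series[of "\<lambda>k. density (local_vol (C k)) (indicator (E k))"] by (auto simp: sets_lv)
  have dens: "emeasure (density (local_vol (C k)) (indicator (E k))) B = emeasure (local_vol (C k)) (B \<inter> E k)"
    if "B \<in> sets borel" for k B
    using that P(2) by (subst emeasure_density)
      (auto simp: sets_lv indicator_inter_arith[symmetric] Int_commute measurable_cong_sets[OF sets_lv refl])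
  have "emeasure \<mu> B = emeasure (local_vol c) B" if "c \<in> A" "B \<in> sets borel" "B \<subseteq> fst c" for c B
  proof -
    have "emeasure (local_vol (C k)) (B \<inter> E k) = emeasure (local_vol c) (B \<inter> E k)" for k
      using that P(1,2,3)[of k] by (intro local_vol_eq) auto
    then show ?thesis
      using that emeasure_partition[OF sets_lv P(2,4,5)] by (simp add: m dens)
  qed
  then have "is_vol \<mu>" by (simp add: is_vol_def sets_\<mu>)
  then show ?thesis ..
qed

abbreviation "V \<equiv> vol A g"

lemma is_vol_vol: "is_vol V"
proof -
  have "vol A g = (THE \<mu>. is_vol \<mu>)"
  proof -
    have "emeasure (local_vol c) B = (\<integral>\<^sup>+y\<in>snd c ` B. ennreal (sqrt (det (g c (chart_inv c y)))) \<partial>lborel)"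
      if "c \<in> A" "B \<in> sets borel" "B \<subseteq> fst c" for c B
      using that by (simp add: emeasure_local_vol Int_absorb2 vdens_def)
    then have "is_vol = (\<lambda>\<mu>. sets \<mu> = sets borel \<and> (\<forall>c\<in>A. \<forall>B\<in>sets borel. B \<subseteq> fst c \<longrightarrow>
        emeasure \<mu> B = (\<integral>\<^sup>+y\<in>snd c ` B. ennreal (sqrt (det (g c (chart_inv c y)))) \<partial>lborel)))"
      by (auto simp: fun_eq_iff is_vol_def)
    then show ?thesis by (simp add: vol_def)
  qed
  then show ?thesis using is_vol_exists is_vol_unique by (metis theI)
qed

lemma sets_vol[measurable_cong, simp]: "sets V = sets borel"
  using is_vol_vol by (simp add: is_vol_def)

lemma space_vol[simp]: "space V = UNIV"
  using sets_eq_imp_space_eq[OF sets_vol] by simp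

lemma measurable_vol[simp]: "borel_measurable V = borel_measurable borel"
  by (rule measurable_cong_sets) simp_all

lemma emeasure_vol_chart:
  assumes "c \<in> A" "B \<in> sets borel" "B \<subseteq> fst c"
  shows "emeasure V B = (\<integral>\<^sup>+y\<in>snd c ` B. ennreal (vdens c y) \<partial>lborel)"
  using assms is_vol_vol by (simp add: is_vol_def emeasure_local_vol Int_absorb2)

lemma density_vol_chart:
  assumes c: "c \<in> A"
  shows "density V (indicator (fst c)) = local_vol c"
proof (rule measure_eqI)
  fix B assume "B \<in> sets (density V (indicator (fst c)))"
  then have B: "B \<in> sets borel" by simp
  have U: "fst c \<in> sets borel" using open_dom[OF c] by simp
  have "emeasure (density V (indicator (fst c))) B = emeasure V (B \<inter> fst c)"
    using B U by (subst emeasure_density) (auto simp: indicator_inter_arith[symmetric] Int_commute)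
  also have "\<dots> = emeasure (local_vol c) (B \<inter> fst c)"
    using is_vol_vol B U c by (simp add: is_vol_def)
  also have "\<dots> = emeasure (local_vol c) B"
    using B U c by (simp add: emeasure_local_vol)
  finally show "emeasure (density V (indicator (fst c))) B = emeasure (local_vol c) B" .
qed (simp add: local_vol_def)

text \<open>This is how integration by parts reaches the manifold: an integrand that lives in one
  chart is integrated in coordinates.\<close>

lemma vol_chart:
  fixes f :: "'a \<Rightarrow> 'b::{banach, second_countable_topology}"
  assumes c: "c \<in> A" and f[measurable]: "f \<in> borel_measurable borel" and supp: "\<And>x. x \<notin> fst c \<Longrightarrow> f x = 0"
  shows integral_vol_chart: "(\<integral>x. f x \<partial>V) = (\<integral>y. indicator (img c) y *\<^sub>R (vdens c y *\<^sub>R f (chart_inv c y)) \<partial>lborel)"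
    and integrable_vol_chart: "integrable V f \<longleftrightarrow>
      integrable lborel (\<lambda>y. indicator (img c) y *\<^sub>R (vdens c y *\<^sub>R f (chart_inv c y)))"
proof -
  have [measurable]: "fst c \<in> sets borel" using open_dom[OF c] by simp
  have [measurable]: "parametrization c \<in> measurable borel borel" by (rule measurable_parametrization[OF c])
  have [measurable]: "(\<lambda>y. vdens c y * indicator (img c) y) \<in> borel_measurable borel"
    using c open_img by (intro measurable_vdens) auto
  have nn: "0 \<le> vdens c y * indicator (img c) y" for y
    using vdens_pos[OF c] by (auto simp: indicator_def intro: less_imp_le)
  have f1: "f = (\<lambda>x. indicator (fst c) x *\<^sub>R f x)"
    using supp by (auto simp: indicator_def fun_eq_iff)
  have f2: "(vdens c y * indicator (img c) y) *\<^sub>R f (parametrization c y) =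
      indicator (img c) y *\<^sub>R (vdens c y *\<^sub>R f (chart_inv c y))" for y
    by (auto simp: indicator_def parametrization_def)
  have dens: "density V (indicator (fst c)) = density V (\<lambda>x. ennreal (indicator (fst c) x))"
    by (simp add: ennreal_indicator)
  have "(\<integral>x. f x \<partial>V) = (\<integral>x. f x \<partial>density V (indicator (fst c)))"
    unfolding dens by (subst integral_density) (auto simp: f1[symmetric])
  also have "\<dots> = (\<integral>y. f (parametrization c y) \<partial>density lborel (\<lambda>y. ennreal (vdens c y * indicator (img c) y)))"
    unfolding density_vol_chart[OF c] local_vol_def by (rule integral_distr) auto
  also have "\<dots> = (\<integral>y. (vdens c y * indicator (img c) y) *\<^sub>R f (parametrization c y) \<partial>lborel)"
    by (rule integral_density) (auto simp: nn)
  finally show "(\<integral>x. f x \<partial>V) = (\<integral>y. indicator (img c) y *\<^sub>R (vdens c y *\<^sub>R f (chart_inv c y)) \<partial>lborel)"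
    by (simp only: f2)
  have "integrable V f \<longleftrightarrow> integrable (density V (indicator (fst c))) f"
    unfolding dens by (subst integrable_density) (auto simp: f1[symmetric])
  also have "\<dots> \<longleftrightarrow> integrable (density lborel (\<lambda>y. ennreal (vdens c y * indicator (img c) y))) (\<lambda>y. f (parametrization c y))"
    unfolding density_vol_chart[OF c] local_vol_def by (rule integrable_distr_eq) auto
  also have "\<dots> \<longleftrightarrow> integrable lborel (\<lambda>y. (vdens c y * indicator (img c) y) *\<^sub>R f (parametrization c y))"
    by (rule integrable_density) (auto simp: nn)
  finally show "integrable V f \<longleftrightarrow> integrable lborel (\<lambda>y. indicator (img c) y *\<^sub>R (vdens c y *\<^sub>R f (chart_inv c y)))"
    by (simp only: f2)
qed

text \<open>\<open>B k m\<close> is the part of the k-th chart where the coordinates and the volume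
  density are both bounded by m, so its volume is finite. The Radon-Nikodym theorem needs
  this.\<close>

lemma sigma_finite_vol: "sigma_finite_measure V"
proof
  obtain C :: "nat \<Rightarrow> ('a, 'n) chart" where C: "\<And>k. C k \<in> A" "(\<Union>k. fst (C k)) = UNIV"
    using countable_atlas by blast
  define S where "S k m = {y \<in> img (C k). norm y \<le> real m \<and> vdens (C k) y \<le> real m}" for k m :: nat
  define B where "B k m = {x \<in> fst (C k). snd (C k) x \<in> S k m}" for k m
  have S_im: "snd (C k) ` B k m = S k m" for k m
    using C(1) chart_chart_inv chart_inv_in by (fastforce simp: S_def B_def image_iff)
  have S_borel: "S k m \<in> sets borel" for k m
  proof -
    have "S k m = img (C k) \<inter> {y. norm y \<le> real m \<and> vdens (C k) y * indicator (img (C k)) y \<le> real m}"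
      by (auto simp: S_def)
    moreover have [measurable]: "(\<lambda>y. vdens (C k) y * indicator (img (C k)) y) \<in> borel_measurable borel"
      using C(1) open_img by (intro measurable_vdens) auto
    ultimately show ?thesis using open_img[OF C(1)] by simp
  qed
  have B_borel: "B k m \<in> sets borel" for k m
  proof -
    have "snd (C k) \<in> borel_measurable (restrict_space borel (fst (C k)))"
      by (intro borel_measurable_continuous_on_restrict continuous_on_chart C(1))
    then have "snd (C k) -` S k m \<inter> space (restrict_space borel (fst (C k))) \<in> sets (restrict_space borel (fst (C k)))"
      using S_borel by (rule measurable_sets)
    moreover have "snd (C k) -` S k m \<inter> space (restrict_space borel (fst (C k))) = B k m"
      by (auto simp: B_def space_restrict_space)
    ultimately show ?thesis
      using open_dom[OF C(1)[of k]] by (auto simp: sets_restrict_space)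
  qed
  have fin: "emeasure V (B k m) \<noteq> \<infinity>" for k m
  proof -
    have "emeasure V (B k m) = (\<integral>\<^sup>+y\<in>S k m. ennreal (vdens (C k) y) \<partial>lborel)"
      using emeasure_vol_chart[OF C(1) B_borel, of k m k] S_im[of k m] by (auto simp: B_def)
    also have "\<dots> \<le> (\<integral>\<^sup>+y. ennreal (real m) * indicator (cball (0 :: real^'n) (real m)) y \<partial>lborel)"
      by (intro nn_integral_mono) (auto simp: S_def indicator_def intro: ennreal_leI)
    also have "\<dots> = ennreal (real m) * emeasure lborel (cball (0 :: real^'n) (real m))"
      by (simp add: nn_integral_cmult_indicator)
    also have "\<dots> < \<infinity>"
      using emeasure_bounded_finite[OF bounded_cball, of "0 :: real^'n" "real m"]
      by (simp add: ennreal_mult_less_top)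
    finally show ?thesis by simp
  qed
  have cover: "(\<Union>(k, m). B k m) = UNIV"
  proof safe
    fix x
    obtain k where k: "x \<in> fst (C k)" using C(2) by auto
    obtain m :: nat where "max (norm (snd (C k) x)) (vdens (C k) (snd (C k) x)) \<le> real m"
      using real_arch_simple by blast
    then have "x \<in> B k m" using k chart_in[OF C(1)] by (auto simp: B_def S_def)
    then show "x \<in> (\<Union>(k, m). B k m)" by auto
  qed auto
  show "\<exists>F. countable F \<and> F \<subseteq> sets V \<and> \<Union> F = space V \<and> (\<forall>a\<in>F. emeasure V a \<noteq> \<infinity>)"
    by (rule exI[of _ "range (\<lambda>(k, m). B k m)"]) (use B_borel fin cover in auto)
qed

end

section \<open>Hermitian forms of positive definite matrices\<close>

definition pos_def :: "real^'n^'n \<Rightarrow> bool" where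
  "pos_def G \<longleftrightarrow> transpose G = G \<and> (\<forall>v. v \<noteq> 0 \<longrightarrow> 0 < v \<bullet> (G *v v))"

text \<open>At a point, \<open>form_inner\<close> is this form for the inverse metric matrix;
  separating it leaves pure linear algebra.\<close>

definition herm :: "real^'n^'n \<Rightarrow> complex^'n \<Rightarrow> complex^'n \<Rightarrow> complex" where
  "herm G a b = (\<Sum>i\<in>UNIV. \<Sum>j\<in>UNIV. of_real (G $ i $ j) * cnj (a $ i) * b $ j)"

lemma pos_def_det: "pos_def G \<Longrightarrow> 0 < det G"
  unfolding pos_def_def by (rule det_pos_definite) auto

lemma matrix_inv_unique:
  fixes G :: "real^'n^'n"
  assumes "G ** K = mat 1"
  shows "matrix_inv G = K"
proof -
  have "invertible G" using assms by (meson invertible_right_inverse)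
  from matrix_inv_inverse[OF this] have "matrix_inv G ** (G ** K) = K"
    by (simp add: matrix_mul_assoc)
  then show ?thesis using assms by simp
qed

lemma pos_def_matrix_inv:
  assumes "pos_def G"
  shows "pos_def (matrix_inv G)"
proof -
  have sym: "transpose G = G" and pos: "\<And>v. v \<noteq> 0 \<Longrightarrow> 0 < v \<bullet> (G *v v)"
    using assms by (auto simp: pos_def_def)
  have inv: "G ** matrix_inv G = mat 1" "matrix_inv G ** G = mat 1"
    using matrix_inv_inverse[of G] pos_def_det[OF assms] by (auto simp: invertible_det_nz)
  have "G ** transpose (matrix_inv G) = transpose (matrix_inv G ** G)"
    by (simp add: matrix_transpose_mul sym)
  then have "transpose (matrix_inv G) = matrix_inv G"
    using matrix_inv_unique[of G "transpose (matrix_inv G)"] by (simp add: inv transpose_mat)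
  moreover have "0 < v \<bullet> (matrix_inv G *v v)" if "v \<noteq> 0" for v
  proof -
    \<comment> \<open>For w with G w = v, the quadratic form of the inverse at v equals that of
      \<open>G\<close> at w.\<close>
    let ?w = "matrix_inv G *v v"
    have w: "G *v ?w = v" by (simp add: matrix_vector_mul_assoc inv)
    then have "?w \<noteq> 0" using that by (metis matrix_vector_mult_0_right)
    from pos[OF this] show ?thesis by (simp add: w inner_commute)
  qed
  ultimately show ?thesis by (simp add: pos_def_def)
qed

lemma herm_add_left: "herm G (a + b) c = herm G a c + herm G b c"
  and herm_add_right: "herm G c (a + b) = herm G c a + herm G c b"
  by (simp_all add: herm_def algebra_simps sum.distrib)

lemma herm_scale_left: "herm G (t *s a) b = cnj t * herm G a b"
  and herm_scale_right: "herm G a (t *s b) = t * herm G a b"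
  by (simp_all add: herm_def sum_distrib_left algebra_simps)

lemma herm_commute:
  assumes "transpose G = G"
  shows "herm G a b = cnj (herm G b a)"
proof -
  have "G $ i $ j = G $ j $ i" for i j
    using arg_cong[OF assms, of "\<lambda>M. M $ j $ i"] by (simp add: transpose_def)
  then show ?thesis
    unfolding herm_def by (subst sum.swap) (simp add: algebra_simps)
qed

text \<open>Since Re (cnj x y) = Re x Re y + Im x Im y, no mixed terms occur, and positivity over
  the reals yields positivity over the complex numbers.\<close>

lemma Re_herm_self:
  "Re (herm G a a) = (\<chi> i. Re (a $ i)) \<bullet> (G *v (\<chi> i. Re (a $ i))) + (\<chi> i. Im (a $ i)) \<bullet> (G *v (\<chi> i. Im (a $ i)))"
  by (simp add: herm_def inner_vec_def matrix_vector_mult_def sum_distrib_left sum.distrib[symmetric] algebra_simps)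

lemma Re_herm_pos:
  assumes "pos_def G" "a \<noteq> 0"
  shows "0 < Re (herm G a a)"
proof -
  let ?q = "\<lambda>v. v \<bullet> (G *v v)"
  have q: "0 \<le> ?q v" for v
    using assms(1) by (cases "v = 0") (auto simp: pos_def_def less_imp_le)
  have "(\<chi> i. Re (a $ i)) \<noteq> 0 \<or> (\<chi> i. Im (a $ i)) \<noteq> 0"
    using assms(2) by (auto simp: vec_eq_iff complex_eq_iff)
  then have "0 < ?q (\<chi> i. Re (a $ i)) \<or> 0 < ?q (\<chi> i. Im (a $ i))"
    using assms(1) by (auto simp: pos_def_def)
  then show ?thesis
    unfolding Re_herm_self using q by (meson add_nonneg_pos add_pos_nonneg)
qed

lemma Re_herm_nonneg: "pos_def G \<Longrightarrow> 0 \<le> Re (herm G a a)"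
  using Re_herm_pos[of G a] by (cases "a = 0") (auto simp: herm_def)

lemma herm_self: "pos_def G \<Longrightarrow> herm G a a = of_real (Re (herm G a a))"
  using herm_commute[of G a a] by (auto simp: pos_def_def complex_eq_iff)

lemma herm_Cauchy_Schwarz:
  assumes G: "pos_def G"
  shows "cmod (herm G a b) \<le> sqrt (Re (herm G a a)) * sqrt (Re (herm G b b))"
proof (cases "b = 0")
  case True
  then show ?thesis by (simp add: herm_def)
next
  case False
  define s where "s = Re (herm G b b)"
  \<comment> \<open>\<open>t\<close> is the coefficient of the projection of \<open>a\<close> onto
    \<open>b\<close>; the inequality expresses that a - t b has nonnegative square.\<close>
  define t where "t = herm G b a / of_real s"
  have s: "0 < s" unfolding s_def by (rule Re_herm_pos[OF G False])
  have ab: "herm G a b = cnj (herm G b a)" using G by (intro herm_commute) (simp add: pos_def_def)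
  define w where "w = (- t) *s b"
  have "herm G (a + w) (a + w) = herm G a a + herm G a w + herm G w a + herm G w w"
    by (simp add: herm_add_left herm_add_right)
  also have "\<dots> = herm G a a - t * herm G a b - cnj t * herm G b a + cnj t * t * herm G b b"
    unfolding w_def herm_scale_left herm_scale_right by simp
  also have "\<dots> = herm G a a - herm G b a * cnj (herm G b a) / of_real s"
    using s herm_self[OF G, of b] unfolding ab t_def s_def[symmetric] by (simp add: field_simps)
  also have "herm G b a * cnj (herm G b a) = of_real ((cmod (herm G b a))\<^sup>2)"
    by (rule complex_norm_square[symmetric])
  finally have "0 \<le> Re (herm G a a) - (cmod (herm G b a))\<^sup>2 / s"
    using Re_herm_nonneg[OF G, of "a + w"] s by (simp add: Re_divide power2_eq_square)
  then have "(cmod (herm G b a))\<^sup>2 \<le> Re (herm G a a) * s"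
    using s by (simp add: field_simps)
  then have "cmod (herm G b a) \<le> sqrt (Re (herm G a a) * s)"
    by (rule real_le_rsqrt)
  then show ?thesis by (simp add: ab s_def real_sqrt_mult)
qed

definition hnorm :: "real^'n^'n \<Rightarrow> complex^'n \<Rightarrow> real" where
  "hnorm G a = sqrt (Re (herm G a a))"

lemma hnorm_nonneg: "pos_def G \<Longrightarrow> 0 \<le> hnorm G a"
  by (simp add: hnorm_def Re_herm_nonneg)

lemma hnorm_power2: "pos_def G \<Longrightarrow> herm G a a = of_real ((hnorm G a)\<^sup>2)"
  using herm_self by (simp add: hnorm_def Re_herm_nonneg)

lemma hnorm_eq_0: "pos_def G \<Longrightarrow> hnorm G a = 0 \<longleftrightarrow> a = 0"
  using Re_herm_pos[of G a] by (cases "a = 0") (auto simp: hnorm_def, simp add: herm_def)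

lemma hnorm_triangle:
  assumes G: "pos_def G"
  shows "hnorm G (a + b) \<le> hnorm G a + hnorm G b"
proof -
  have "Re (herm G (a + b) (a + b)) = Re (herm G a a) + Re (herm G b b) + (Re (herm G a b) + Re (herm G b a))"
    by (simp add: herm_add_left herm_add_right)
  also have "\<dots> \<le> (hnorm G a)\<^sup>2 + (hnorm G b)\<^sup>2 + (hnorm G a * hnorm G b + hnorm G b * hnorm G a)"
    using herm_Cauchy_Schwarz[OF G, of a b] herm_Cauchy_Schwarz[OF G, of b a]
      complex_Re_le_cmod[of "herm G a b"] complex_Re_le_cmod[of "herm G b a"]
    by (simp add: hnorm_def Re_herm_nonneg[OF G] mult.commute[of "sqrt (Re (herm G b b))"])
  also have "\<dots> = (hnorm G a + hnorm G b)\<^sup>2"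
    by (simp add: power2_eq_square algebra_simps)
  finally show ?thesis
    unfolding hnorm_def[of G "a + b"] using hnorm_nonneg[OF G] by (intro real_le_lsqrt) auto
qed

lemma hnorm_scale: "hnorm G (t *s a) = cmod t * hnorm G a"
proof -
  have "herm G (t *s a) (t *s a) = of_real ((cmod t)\<^sup>2) * herm G a a"
    unfolding complex_norm_square by (simp add: herm_scale_left herm_scale_right algebra_simps)
  then show ?thesis by (simp add: hnorm_def real_sqrt_mult)
qed

text \<open>The component \<open>a\<^sub>i\<close> is the product of \<open>a\<close> with the \<open>i\<close>-th row of \<open>G\<close> under the inverse matrix.\<close>

lemma component_le_hnorm:
  assumes G: "pos_def G"
  shows "cmod (a $ i) \<le> hnorm (matrix_inv G) (\<chi> j. of_real (G $ i $ j)) * hnorm (matrix_inv G) a"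
proof -
  have inv: "G ** matrix_inv G = mat 1"
    using matrix_inv_inverse[of G] pos_def_det[OF G] by (auto simp: invertible_det_nz)
  have "herm (matrix_inv G) (\<chi> j. of_real (G $ i $ j)) a =
      (\<Sum>l\<in>UNIV. \<Sum>k\<in>UNIV. of_real (G $ i $ k * matrix_inv G $ k $ l) * a $ l)"
    unfolding herm_def by (subst sum.swap) (simp add: algebra_simps)
  also have "\<dots> = (\<Sum>l\<in>UNIV. of_real ((G ** matrix_inv G) $ i $ l) * a $ l)"
    by (simp add: matrix_matrix_mult_def sum_distrib_right)
  also have "\<dots> = a $ i"
    unfolding inv by (simp add: mat_def if_distrib[of "\<lambda>x. of_real x * _"] cong: if_cong)
  finally show ?thesis
    using herm_Cauchy_Schwarz[OF pos_def_matrix_inv[OF G]] by (metis hnorm_def)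
qed

lemma herm_mult_left: "herm (K ** Q) a b = herm Q (\<chi> k. \<Sum>i\<in>UNIV. of_real (K $ i $ k) * a $ i) b"
proof -
  have "herm (K ** Q) a b = (\<Sum>i\<in>UNIV. \<Sum>j\<in>UNIV. \<Sum>k\<in>UNIV. of_real (K $ i $ k * Q $ k $ j) * cnj (a $ i) * b $ j)"
    by (simp add: herm_def matrix_matrix_mult_def sum_distrib_right)
  also have "\<dots> = (\<Sum>i\<in>UNIV. \<Sum>k\<in>UNIV. \<Sum>j\<in>UNIV. of_real (K $ i $ k * Q $ k $ j) * cnj (a $ i) * b $ j)"
    by (intro sum.cong sum.swap refl)
  also have "\<dots> = (\<Sum>k\<in>UNIV. \<Sum>i\<in>UNIV. \<Sum>j\<in>UNIV. of_real (K $ i $ k * Q $ k $ j) * cnj (a $ i) * b $ j)"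
    by (rule sum.swap)
  also have "\<dots> = (\<Sum>k\<in>UNIV. \<Sum>j\<in>UNIV. \<Sum>i\<in>UNIV. of_real (K $ i $ k * Q $ k $ j) * cnj (a $ i) * b $ j)"
    by (intro sum.cong sum.swap refl)
  also have "\<dots> = herm Q (\<chi> k. \<Sum>i\<in>UNIV. of_real (K $ i $ k) * a $ i) b"
    by (simp add: herm_def sum_distrib_left sum_distrib_right algebra_simps)
  finally show ?thesis .
qed

lemma herm_mult_right: "herm (Q ** transpose K) a b = herm Q a (\<chi> k. \<Sum>j\<in>UNIV. of_real (K $ j $ k) * b $ j)"
proof -
  have "herm (Q ** transpose K) a b = (\<Sum>i\<in>UNIV. \<Sum>j\<in>UNIV. \<Sum>k\<in>UNIV. of_real (Q $ i $ k * K $ j $ k) * cnj (a $ i) * b $ j)"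
    by (simp add: herm_def matrix_matrix_mult_def sum_distrib_right transpose_def)
  also have "\<dots> = (\<Sum>i\<in>UNIV. \<Sum>k\<in>UNIV. \<Sum>j\<in>UNIV. of_real (Q $ i $ k * K $ j $ k) * cnj (a $ i) * b $ j)"
    by (intro sum.cong sum.swap refl)
  also have "\<dots> = herm Q a (\<chi> k. \<Sum>j\<in>UNIV. of_real (K $ j $ k) * b $ j)"
    by (simp add: herm_def sum_distrib_left sum_distrib_right algebra_simps)
  finally show ?thesis .
qed

text \<open>Covectors transform by the transpose of J, while the inverse of G is J^(-1) H^(-1)
  J^(-T), so the Jacobians cancel. Pointwise products of forms become chart independent.\<close>

lemma herm_transform:
  fixes J :: "real^'n^'n"
  assumes G: "G = transpose J ** H ** J" "det G \<noteq> 0" "det H \<noteq> 0"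
    and a: "\<And>i. a $ i = (\<Sum>j\<in>UNIV. of_real (J $ j $ i) * a' $ j)"
    and b: "\<And>i. b $ i = (\<Sum>j\<in>UNIV. of_real (J $ j $ i) * b' $ j)"
  shows "herm (matrix_inv G) a b = herm (matrix_inv H) a' b'"
proof -
  \<comment> \<open>Taking determinants, det G = (det J)^2 det H, and the left side is
    nonzero.\<close>
  have "det J \<noteq> 0" using G by (auto simp: det_mul)
  then have J: "J ** matrix_inv J = mat 1" "matrix_inv J ** J = mat 1"
    using matrix_inv_inverse[of J] by (auto simp: invertible_det_nz)
  have H: "H ** matrix_inv H = mat 1"
    using matrix_inv_inverse[of H] G by (auto simp: invertible_det_nz)
  let ?K = "matrix_inv J"
  have "G ** (?K ** matrix_inv H ** transpose ?K) =
      transpose J ** (H ** ((J ** ?K) ** matrix_inv H)) ** transpose ?K"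
    unfolding G(1) by (simp only: matrix_mul_assoc)
  also have "\<dots> = transpose J ** transpose ?K"
    by (simp add: J H)
  also have "\<dots> = mat 1"
    by (simp only: matrix_transpose_mul[symmetric] J transpose_mat)
  finally have inv: "matrix_inv G = ?K ** matrix_inv H ** transpose ?K"
    by (rule matrix_inv_unique)
  \<comment> \<open>Applying the transposed inverse of \<open>J\<close> undoes the covector law and
    recovers the components in the other chart.\<close>
  have pull: "(\<chi> k. \<Sum>i\<in>UNIV. of_real (?K $ i $ k) * c $ i) = c'"
    if "\<And>i. c $ i = (\<Sum>j\<in>UNIV. of_real (J $ j $ i) * c' $ j)" for c c' :: "complex^'n"
  proof -
    have "(\<Sum>i\<in>UNIV. of_real (?K $ i $ k) * c $ i) = c' $ k" for k
    proof -
      have "(\<Sum>i\<in>UNIV. of_real (?K $ i $ k) * c $ i) =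
          (\<Sum>i\<in>UNIV. \<Sum>j\<in>UNIV. of_real (J $ j $ i * ?K $ i $ k) * c' $ j)"
        by (simp add: that sum_distrib_left algebra_simps)
      also have "\<dots> = (\<Sum>j\<in>UNIV. of_real ((J ** ?K) $ j $ k) * c' $ j)"
        by (subst sum.swap) (simp add: matrix_matrix_mult_def sum_distrib_right)
      also have "\<dots> = c' $ k"
        unfolding J by (simp add: mat_def if_distrib[of "\<lambda>x. of_real x * _"] cong: if_cong)
      finally show ?thesis .
    qed
    then show ?thesis by (simp add: vec_eq_iff)
  qed
  show ?thesis
    by (subst inv, subst herm_mult_right, subst herm_mult_left) (simp only: pull[OF a] pull[OF b])
qed

section \<open>Forms\<close>

context riemannian
begin

definition ginv :: "('a, 'n) chart \<Rightarrow> 'a \<Rightarrow> real^'n^'n" where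
  "ginv c x = matrix_inv (g c x)"

abbreviation "fip \<equiv> form_inner A g"
abbreviation "fnm \<equiv> form_norm A g"

lemma pos_def_metric: "c \<in> A \<Longrightarrow> x \<in> fst c \<Longrightarrow> pos_def (g c x)"
  by (simp add: pos_def_def metric_sym metric_pos)

lemma pos_def_ginv: "c \<in> A \<Longrightarrow> x \<in> fst c \<Longrightarrow> pos_def (ginv c x)"
  by (simp add: ginv_def pos_def_matrix_inv pos_def_metric)

lemma chart_at: "chart_at A x \<in> A" "x \<in> fst (chart_at A x)"
proof -
  have "chart_at A x \<in> A \<and> x \<in> fst (chart_at A x)"
    unfolding chart_at_def by (rule someI_ex) (use chart_exists in blast)
  then show "chart_at A x \<in> A" "x \<in> fst (chart_at A x)" by simp_all
qed

lemma fip_herm: "fip \<alpha> \<beta> x = herm (ginv (chart_at A x) x) (\<alpha> (chart_at A x) x) (\<beta> (chart_at A x) x)"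
  by (simp add: form_inner_def herm_def ginv_def Let_def)

lemma fnm_hnorm: "fnm \<alpha> x = hnorm (ginv (chart_at A x) x) (\<alpha> (chart_at A x) x)"
  by (simp add: form_norm_def hnorm_def fip_herm)

lemma pos_def_at: "pos_def (ginv (chart_at A x) x)"
  by (rule pos_def_ginv[OF chart_at])

section \<open>Pointwise algebra of forms\<close>

definition fadd :: "('a, 'n) form \<Rightarrow> ('a, 'n) form \<Rightarrow> ('a, 'n) form" where
  "fadd \<alpha> \<beta> c x = \<alpha> c x + \<beta> c x"

definition fscale :: "('a \<Rightarrow> complex) \<Rightarrow> ('a, 'n) form \<Rightarrow> ('a, 'n) form" where
  "fscale u \<alpha> c x = u x *s \<alpha> c x"

abbreviation "fsub \<alpha> \<beta> \<equiv> fadd \<alpha> (fscale (\<lambda>_. - 1) \<beta>)"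

lemma fip_simps:
  "fip (fadd \<alpha> \<beta>) \<gamma> x = fip \<alpha> \<gamma> x + fip \<beta> \<gamma> x"
  "fip \<gamma> (fadd \<alpha> \<beta>) x = fip \<gamma> \<alpha> x + fip \<gamma> \<beta> x"
  "fip (fscale u \<alpha>) \<gamma> x = cnj (u x) * fip \<alpha> \<gamma> x"
  "fip \<gamma> (fscale u \<alpha>) x = u x * fip \<gamma> \<alpha> x"
  by (simp_all add: fip_herm fadd_def fscale_def herm_add_left herm_add_right herm_scale_left herm_scale_right)

lemma fnm_nonneg[simp]: "0 \<le> fnm \<alpha> x"
  by (simp add: fnm_hnorm hnorm_nonneg pos_def_at)

lemma fip_self: "fip \<alpha> \<alpha> x = of_real ((fnm \<alpha> x)\<^sup>2)"
  by (simp add: fip_herm fnm_hnorm hnorm_power2 pos_def_at)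

lemma fip_le: "cmod (fip \<alpha> \<beta> x) \<le> fnm \<alpha> x * fnm \<beta> x"
  using herm_Cauchy_Schwarz[OF pos_def_at] by (simp add: fip_herm fnm_hnorm hnorm_def)

lemma fnm_triangle: "fnm (fadd \<alpha> \<beta>) x \<le> fnm \<alpha> x + fnm \<beta> x"
  by (simp add: fnm_hnorm fadd_def hnorm_triangle pos_def_at)

lemma fnm_scale: "fnm (fscale u \<alpha>) x = cmod (u x) * fnm \<alpha> x"
  by (simp add: fnm_hnorm fscale_def hnorm_scale)

lemma fnm_sub_commute: "fnm (fsub \<alpha> \<beta>) x = fnm (fsub \<beta> \<alpha>) x"
proof -
  have "fsub \<alpha> \<beta> = fscale (\<lambda>_. - 1) (fsub \<beta> \<alpha>)"
    by (simp add: fadd_def fscale_def fun_eq_iff vec_eq_iff)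
  then show ?thesis by (simp add: fnm_scale)
qed

text \<open>\<open>form_inner\<close> evaluates in a chosen chart that varies with x in an
  uncontrolled way. Measurability and smoothness are statements in a fixed chart, and the covector
  law permits the switch.\<close>

lemma fip_chart:
  assumes "c \<in> A" "x \<in> fst c" "is_form A \<alpha>" "is_form A \<beta>"
  shows "fip \<alpha> \<beta> x = herm (ginv c x) (\<alpha> c x) (\<beta> c x)"
  unfolding fip_herm ginv_def
proof (rule herm_transform[of _ "jac (chart_at A x) c x" "g c x"])
  show "g (chart_at A x) x = transpose (jac (chart_at A x) c x) ** g c x ** jac (chart_at A x) c x"
    by (intro metric_transform chart_at assms)
  show "det (g (chart_at A x) x) \<noteq> 0" "det (g c x) \<noteq> 0"
    using metric_det_pos chart_at assms by (metis less_irrefl)+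
qed (use assms chart_at[of x] in \<open>simp_all add: is_form_def\<close>)

lemma fnm_chart: "c \<in> A \<Longrightarrow> x \<in> fst c \<Longrightarrow> is_form A \<alpha> \<Longrightarrow> fnm \<alpha> x = hnorm (ginv c x) (\<alpha> c x)"
  by (simp add: form_norm_def hnorm_def fip_chart)

lemma is_form_fadd: "is_form A \<alpha> \<Longrightarrow> is_form A \<beta> \<Longrightarrow> is_form A (fadd \<alpha> \<beta>)"
  unfolding is_form_def fadd_def by (simp add: algebra_simps sum.distrib)

lemma is_form_fscale: "is_form A \<alpha> \<Longrightarrow> is_form A (fscale u \<alpha>)"
  unfolding is_form_def fscale_def by (simp add: sum_distrib_left mult.left_commute)

lemma smooth_chart_imp_continuous:
  assumes c: "c \<in> A" and f: "smooth_on (img c) (\<lambda>y. f (chart_inv c y))"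
  shows "continuous_on (fst c) f"
proof -
  have "continuous_on (fst c) (\<lambda>x. f (chart_inv c (snd c x)))"
    by (rule continuous_on_compose2[OF smooth_on_imp_continuous_on[OF f] continuous_on_chart[OF c]])
      (use chart_in[OF c] in auto)
  then show ?thesis
    by (rule continuous_on_cong[THEN iffD1, rotated 2]) (simp_all add: chart_inv_chart[OF c])
qed

lemma smooth_ginv: "c \<in> A \<Longrightarrow> smooth_on (img c) (\<lambda>y. ginv c (chart_inv c y) $ i $ j)"
  unfolding ginv_def
  by (rule smooth_on_matrix_inv[OF open_img metric_smooth]) (use metric_det_pos chart_inv_in in \<open>auto simp: less_imp_neq[symmetric]\<close>)

section \<open>Measurability of forms and their products\<close>

lemma measurable_ginv: "c \<in> A \<Longrightarrow> (\<lambda>x. ginv c x $ i $ j) \<in> borel_measurable (restrict_space borel (fst c))"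
  by (intro borel_measurable_continuous_on_restrict smooth_chart_imp_continuous smooth_ginv)

lemma is_formD: "is_form A \<alpha> \<Longrightarrow> c \<in> A \<Longrightarrow> d \<in> A \<Longrightarrow> x \<in> fst c \<Longrightarrow> x \<in> fst d \<Longrightarrow>
    (\<Sum>j\<in>UNIV. of_real (jac c d x $ j $ i) * \<alpha> d x $ j) = \<alpha> c x $ i"
  unfolding is_form_def by (rule sym) blast

lemma measurable_cnj: "f \<in> borel_measurable M \<Longrightarrow> (\<lambda>x. cnj (f x)) \<in> borel_measurable M"
  by (rule measurable_compose[where g = cnj])
    (auto intro!: borel_measurable_continuous_onI continuous_intros)

lemma measurable_vec_nth: "f \<in> borel_measurable M \<Longrightarrow> (\<lambda>x. f x $ i :: complex) \<in> borel_measurable M"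
  by (rule measurable_compose[where g = "\<lambda>v. v $ i"])
    (auto intro!: borel_measurable_continuous_onI continuous_intros)

lemma measurable_vecI:
  fixes f :: "'b \<Rightarrow> complex^'m"
  assumes "\<And>i. (\<lambda>x. f x $ i) \<in> borel_measurable M"
  shows "f \<in> borel_measurable M"
proof (rule borel_measurable_euclidean_space[THEN iffD2], rule ballI)
  fix b :: "complex^'m" assume "b \<in> Basis"
  then obtain i u where "b = axis i u" by (auto simp: Basis_vec_def)
  then show "(\<lambda>x. f x \<bullet> b) \<in> borel_measurable M"
    using assms[of i] by (simp add: inner_axis)
qed

lemma borel_formD: "borel_form A \<alpha> \<Longrightarrow> is_form A \<alpha>"
  "borel_form A \<alpha> \<Longrightarrow> c \<in> A \<Longrightarrow> (\<lambda>x. \<alpha> c x $ i) \<in> borel_measurable (restrict_space borel (fst c))"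
  unfolding borel_form_def using measurable_vec_nth by auto

lemma borel_formI:
  assumes "is_form A \<alpha>" "\<And>c i. c \<in> A \<Longrightarrow> (\<lambda>x. \<alpha> c x $ i) \<in> borel_measurable (restrict_space borel (fst c))"
  shows "borel_form A \<alpha>"
  unfolding borel_form_def using assms measurable_vecI by blast

lemma measurable_fip:
  assumes \<alpha>: "borel_form A \<alpha>" and \<beta>: "borel_form A \<beta>"
  shows "fip \<alpha> \<beta> \<in> borel_measurable borel"
proof (rule borel_measurable_chartwise)
  fix c assume c: "c \<in> A"
  let ?M = "restrict_space borel (fst c)"
  have "(\<lambda>x. herm (ginv c x) (\<alpha> c x) (\<beta> c x)) \<in> borel_measurable ?M"
    unfolding herm_def
    by (intro borel_measurable_sum borel_measurable_times measurable_cnj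
        measurable_compose[OF _ borel_measurable_of_real]
        measurable_ginv[OF c] borel_formD(2)[OF \<alpha> c] borel_formD(2)[OF \<beta> c])
  then show "fip \<alpha> \<beta> \<in> borel_measurable ?M"
    by (rule measurable_cong[THEN iffD1, rotated])
      (simp add: space_restrict_space fip_chart[OF c _ borel_formD(1)[OF \<alpha>] borel_formD(1)[OF \<beta>]])
qed

lemma measurable_fnm: "borel_form A \<alpha> \<Longrightarrow> fnm \<alpha> \<in> borel_measurable borel"
  unfolding form_norm_def[abs_def] using measurable_fip[of \<alpha> \<alpha>] by measurable

lemma borel_form_fadd: "borel_form A \<alpha> \<Longrightarrow> borel_form A \<beta> \<Longrightarrow> borel_form A (fadd \<alpha> \<beta>)"
  by (rule borel_formI) (simp_all add: borel_formD is_form_fadd fadd_def borel_measurable_add)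

lemma borel_form_fscale: "u \<in> borel_measurable borel \<Longrightarrow> borel_form A \<alpha> \<Longrightarrow> borel_form A (fscale u \<alpha>)"
  by (rule borel_formI)
    (simp_all add: borel_formD is_form_fscale fscale_def borel_measurable_times measurable_restrict_space1)

text \<open>The transformation law is linear with coefficients that do not involve the form, so
  componentwise limits inherit it.\<close>

lemma borel_form_limit:
  assumes "\<And>n. borel_form A (\<alpha> n)"
    and lim: "\<And>c x i. c \<in> A \<Longrightarrow> x \<in> fst c \<Longrightarrow> (\<lambda>n. \<alpha> n c x $ i) \<longlonglongrightarrow> \<beta> c x $ i"
  shows "borel_form A \<beta>"
proof (rule borel_formI)
  show "is_form A \<beta>"
    unfolding is_form_def
  proof (intro ballI allI)
    fix c d x i assume cd: "c \<in> A" "d \<in> A" "x \<in> fst c \<inter> fst d"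
    have "(\<lambda>n. \<Sum>j\<in>UNIV. of_real (jac c d x $ j $ i) * \<alpha> n d x $ j) \<longlonglongrightarrow>
        (\<Sum>j\<in>UNIV. of_real (jac c d x $ j $ i) * \<beta> d x $ j)"
      using cd by (intro tendsto_sum tendsto_mult tendsto_const lim) auto
    moreover have "(\<Sum>j\<in>UNIV. of_real (jac c d x $ j $ i) * \<alpha> n d x $ j) = \<alpha> n c x $ i" for n
      using cd borel_formD(1)[OF assms(1)] by (auto intro: is_formD)
    ultimately have "(\<lambda>n. \<alpha> n c x $ i) \<longlonglongrightarrow> (\<Sum>j\<in>UNIV. of_real (jac c d x $ j $ i) * \<beta> d x $ j)"
      by simp
    then show "\<beta> c x $ i = (\<Sum>j\<in>UNIV. of_real (jac c d x $ j $ i) * \<beta> d x $ j)"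
      using LIMSEQ_unique[OF lim] cd by blast
  qed
  show "(\<lambda>x. \<beta> c x $ i) \<in> borel_measurable (restrict_space borel (fst c))" if "c \<in> A" for c i
    by (rule borel_measurable_LIMSEQ_metric[OF borel_formD(2)[OF assms(1) that]])
      (use lim that in \<open>simp add: space_restrict_space\<close>)
qed

section \<open>Smooth functions and test forms\<close>

lemma smooth_funI: "(\<And>c. c \<in> A \<Longrightarrow> smooth_on (img c) (\<lambda>y. f (chart_inv c y))) \<Longrightarrow> smooth_fun A f"
  by (simp add: smooth_fun_def img_def comp_def)

lemma smooth_funD: "smooth_fun A f \<Longrightarrow> c \<in> A \<Longrightarrow> smooth_on (img c) (\<lambda>y. f (chart_inv c y))"
  by (simp add: smooth_fun_def img_def comp_def)

lemma smooth_fun_continuous: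
  assumes "smooth_fun A f"
  shows "continuous_on UNIV f"
proof (rule continuous_at_imp_continuous_on, rule ballI)
  fix x :: 'a
  have "continuous_on (fst (chart_at A x)) f"
    by (intro smooth_chart_imp_continuous smooth_funD assms chart_at)
  then show "isCont f x"
    using open_dom[OF chart_at(1)] chart_at(2) by (simp add: continuous_on_eq_continuous_at)
qed

lemma smooth_fun_measurable: "smooth_fun A f \<Longrightarrow> f \<in> borel_measurable borel"
  by (intro borel_measurable_continuous_onI smooth_fun_continuous)

lemma smooth_fun_add: "smooth_fun A f \<Longrightarrow> smooth_fun A h \<Longrightarrow> smooth_fun A (\<lambda>x. f x + h x)"
  and smooth_fun_diff: "smooth_fun A f \<Longrightarrow> smooth_fun A h \<Longrightarrow> smooth_fun A (\<lambda>x. f x - h x)"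
  and smooth_fun_mult: "smooth_fun A f \<Longrightarrow> smooth_fun A h \<Longrightarrow> smooth_fun A (\<lambda>x. f x * h x)"
  and smooth_fun_const: "smooth_fun A (\<lambda>x. k)"
  by (auto intro!: smooth_funI smooth_on_add smooth_on_diff smooth_on_mult smooth_on_const open_img dest: smooth_funD)

lemma compact_closure_subset:
  fixes X Y :: "'a set"
  assumes "compact (closure Y)" "X \<subseteq> Y"
  shows "compact (closure X)"
proof -
  have "closure X = closure Y \<inter> closure X" using closure_mono[OF assms(2)] by auto
  then show ?thesis using compact_Int_closed[OF assms(1) closed_closure, of X] by simp
qed

lemma test_formD:
  assumes "\<alpha> \<in> test_forms A"
  shows "is_form A \<alpha>" "compact (form_support A \<alpha>)"
    "c \<in> A \<Longrightarrow> smooth_on (img c) (\<lambda>y. \<alpha> c (chart_inv c y) $ i)"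
  using assms by (simp_all add: test_forms_def img_def)

lemma test_formI:
  assumes "is_form A \<alpha>" "compact (form_support A \<alpha>)"
    "\<And>c i. c \<in> A \<Longrightarrow> smooth_on (img c) (\<lambda>y. \<alpha> c (chart_inv c y) $ i)"
  shows "\<alpha> \<in> test_forms A"
  using assms by (simp add: test_forms_def img_def)

lemma test_form_borel: "\<alpha> \<in> test_forms A \<Longrightarrow> borel_form A \<alpha>"
  by (intro borel_formI borel_measurable_continuous_on_restrict smooth_chart_imp_continuous test_formD)

lemma test_form_fadd:
  assumes \<alpha>: "\<alpha> \<in> test_forms A" and \<beta>: "\<beta> \<in> test_forms A"
  shows "fadd \<alpha> \<beta> \<in> test_forms A"
proof (rule test_formI)
  have "compact (form_support A \<alpha> \<union> form_support A \<beta>)"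
    using test_formD(2) \<alpha> \<beta> by (intro compact_Un)
  then have "compact (closure ({x. \<exists>c\<in>A. x \<in> fst c \<and> \<alpha> c x \<noteq> 0} \<union> {x. \<exists>c\<in>A. x \<in> fst c \<and> \<beta> c x \<noteq> 0}))"
    by (simp add: form_support_def closure_Un)
  then show "compact (form_support A (fadd \<alpha> \<beta>))"
    unfolding form_support_def by (rule compact_closure_subset) (auto simp: fadd_def)
  show "is_form A (fadd \<alpha> \<beta>)"
    by (intro is_form_fadd test_formD(1) \<alpha> \<beta>)
  show "smooth_on (img c) (\<lambda>y. fadd \<alpha> \<beta> c (chart_inv c y) $ i)" if "c \<in> A" for c i
    unfolding fadd_def vector_add_component
    by (intro smooth_on_add open_img that test_formD(3) \<alpha> \<beta>)
qed

lemma test_form_fscale: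
  assumes \<alpha>: "\<alpha> \<in> test_forms A" and u: "smooth_fun A u"
  shows "fscale u \<alpha> \<in> test_forms A"
proof (rule test_formI)
  show "compact (form_support A (fscale u \<alpha>))"
    using test_formD(2)[OF \<alpha>] unfolding form_support_def
    by (rule compact_closure_subset) (auto simp: fscale_def)
  show "is_form A (fscale u \<alpha>)"
    by (intro is_form_fscale test_formD(1) \<alpha>)
  show "smooth_on (img c) (\<lambda>y. fscale u \<alpha> c (chart_inv c y) $ i)" if "c \<in> A" for c i
    unfolding fscale_def vector_smult_component
    by (intro smooth_on_mult open_img that smooth_funD[OF u] test_formD(3) \<alpha>)
qed

section \<open>The exterior derivative of a function\<close>

lemma ext_d_chart:
  assumes "c \<in> A" "y \<in> img c"
  shows "ext_d \<psi> c (chart_inv c y) $ i = frechet_derivative (\<lambda>y. \<psi> (chart_inv c y)) (at y) (axis i 1)"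
  using chart_chart_inv[OF assms] by (simp add: ext_d_def comp_def)

lemma smooth_ext_d:
  assumes "c \<in> A" "smooth_fun A \<psi>"
  shows "smooth_on (img c) (\<lambda>y. ext_d \<psi> c (chart_inv c y) $ i)"
  by (rule smooth_on_cong[OF open_img _ smooth_on_derivative[OF smooth_funD[OF assms(2,1)], of "axis i 1"]])
    (use assms in \<open>simp_all add: ext_d_chart\<close>)

text \<open>On the overlap, the function read in \<open>c\<close> is the function read in
  \<open>d\<close> after the transition map, so the covector law is the chain rule.\<close>

lemma is_form_ext_d:
  assumes \<psi>: "smooth_fun A \<psi>"
  shows "is_form A (ext_d \<psi>)"
  unfolding is_form_def
proof (intro ballI allI)
  fix c d x i assume c: "c \<in> A" and d: "d \<in> A" and x: "x \<in> fst c \<inter> fst d"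
  let ?T = "transition c d" and ?y = "snd c x" and ?U = "snd c ` (fst c \<inter> fst d)"
  let ?DT = "frechet_derivative ?T (at ?y)"
  let ?f = "\<psi> \<circ> chart_inv d"
  let ?Df = "frechet_derivative ?f (at (snd d x))"
  have U: "open ?U" by (intro open_chart_image c open_Int open_dom d) auto
  have y: "?y \<in> ?U" using x by auto
  have T: "?T ?y = snd d x" using x by (simp add: transition_def chart_inv_chart[OF c])
  have DT: "(?T has_derivative ?DT) (at ?y)"
    using y by (rule smooth_on_has_derivative[OF smooth_transition[OF c d]])
  have Df: "(?f has_derivative ?Df) (at (?T ?y))"
    unfolding T comp_def using x chart_in[OF d] by (intro smooth_on_has_derivative[OF smooth_funD[OF \<psi> d]]) auto
  have "(?f \<circ> ?T has_derivative ?Df \<circ> ?DT) (at ?y)"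
    by (rule diff_chain_at[OF DT Df])
  then have "(\<psi> \<circ> chart_inv c has_derivative ?Df \<circ> ?DT) (at ?y)"
    by (rule has_derivative_transform_within_open[OF _ U y])
      (auto simp: transition_def chart_inv_chart[OF c] chart_inv_chart[OF d])
  then have "frechet_derivative (\<psi> \<circ> chart_inv c) (at ?y) = ?Df \<circ> ?DT"
    by (rule frechet_derivative_at[symmetric])
  then have "ext_d \<psi> c x $ i = ?Df (?DT (axis i 1))" by (simp add: ext_d_def)
  also have "?DT (axis i 1) = (\<Sum>j\<in>UNIV. (?DT (axis i 1) $ j) *\<^sub>R axis j 1)"
    using basis_expansion[of "?DT (axis i 1)"] by (simp add: scalar_mult_eq_scaleR)
  also have "?Df \<dots> = (\<Sum>j\<in>UNIV. (?DT (axis i 1) $ j) *\<^sub>R ?Df (axis j 1))"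
  proof -
    have lin: "linear ?Df" using Df has_derivative_linear by blast
    show ?thesis by (simp add: linear_sum[OF lin] linear_scale[OF lin])
  qed
  also have "\<dots> = (\<Sum>j\<in>UNIV. of_real (jac c d x $ j $ i) * ext_d \<psi> d x $ j)"
    by (simp add: jac_def matrix_def ext_d_def scaleR_conv_of_real)
  finally show "ext_d \<psi> c x $ i = (\<Sum>j\<in>UNIV. of_real (jac c d x $ j $ i) * ext_d \<psi> d x $ j)" .
qed

lemma ext_d_zero:
  assumes c: "c \<in> A" and x: "x \<in> fst c" "x \<notin> closure {x. \<psi> x \<noteq> 0}"
  shows "ext_d \<psi> c x = 0"
proof -
  let ?U = "snd c ` (fst c - closure {x. \<psi> x \<noteq> 0})"
  have U: "open ?U" by (intro open_chart_image c open_Diff open_dom) auto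
  have y: "snd c x \<in> ?U" using x by auto
  have "(\<psi> \<circ> chart_inv c has_derivative (\<lambda>h. 0)) (at (snd c x))"
  proof (rule has_derivative_transform_within_open[OF has_derivative_const U y])
    fix y assume "y \<in> ?U"
    then obtain z where z: "z \<in> fst c" "z \<notin> closure {x. \<psi> x \<noteq> 0}" "y = snd c z" by auto
    then have "\<psi> z = 0" using closure_subset[of "{x. \<psi> x \<noteq> 0}"] by blast
    then show "0 = (\<psi> \<circ> chart_inv c) y" using z by (simp add: chart_inv_chart[OF c])
  qed
  from frechet_derivative_at[OF this, symmetric] show ?thesis
    by (simp add: ext_d_def vec_eq_iff)
qed

lemma test_form_ext_d:
  assumes "\<psi> \<in> test_functions A"
  shows "ext_d \<psi> \<in> test_forms A"
proof -
  have \<psi>: "smooth_fun A \<psi>" "compact (closure {x. \<psi> x \<noteq> 0})"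
    using assms by (simp_all add: test_functions_def)
  show ?thesis
  proof (rule test_formI)
    have "compact (closure (closure {x. \<psi> x \<noteq> 0}))" using \<psi> by simp
    then show "compact (form_support A (ext_d \<psi>))"
      unfolding form_support_def by (rule compact_closure_subset) (use ext_d_zero in blast)
  qed (use \<psi> in \<open>auto intro: is_form_ext_d smooth_ext_d\<close>)
qed

lemma smooth_fip:
  assumes "\<alpha> \<in> test_forms A" "\<beta> \<in> test_forms A"
  shows "smooth_fun A (fip \<alpha> \<beta>)"
proof (rule smooth_funI)
  fix c assume c: "c \<in> A"
  have "smooth_on (img c) (\<lambda>y. herm (ginv c (chart_inv c y)) (\<alpha> c (chart_inv c y)) (\<beta> c (chart_inv c y)))"
    unfolding herm_def
    by (intro smooth_on_sum smooth_on_mult open_img c test_formD(3)[OF assms(2)]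
        smooth_on_bounded_linear[OF bounded_linear_cnj] smooth_on_bounded_linear[OF bounded_linear_of_real]
        test_formD(3)[OF assms(1)] smooth_ginv)
  then show "smooth_on (img c) (\<lambda>y. fip \<alpha> \<beta> (chart_inv c y))"
    by (rule smooth_on_cong[OF open_img[OF c], rotated])
      (simp add: fip_chart[OF c chart_inv_in[OF c] test_formD(1)[OF assms(1)] test_formD(1)[OF assms(2)]])
qed

end

section \<open>Test functions and the codifferential\<close>

context riemannian
begin

definition extend :: "('a, 'n) chart \<Rightarrow> (real^'n \<Rightarrow> complex) \<Rightarrow> 'a \<Rightarrow> complex" where
  "extend c u x = (if x \<in> fst c then u (snd c x) else 0)"

lemma test_functionD:
  assumes "\<psi> \<in> test_functions A"
  shows "smooth_fun A \<psi>" "compact (closure {x. \<psi> x \<noteq> 0})"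
  using assms by (simp_all add: test_functions_def)

lemma test_functionI:
  assumes "smooth_fun A \<psi>" "compact K" "\<And>x. x \<notin> K \<Longrightarrow> \<psi> x = 0"
  shows "\<psi> \<in> test_functions A"
proof -
  have "compact (closure K)" using assms(2) by (simp add: closure_closed compact_imp_closed)
  then have "compact (closure {x. \<psi> x \<noteq> 0})"
    by (rule compact_closure_subset) (use assms in auto)
  then show ?thesis using assms by (simp add: test_functions_def)
qed

lemma compact_chart_inv:
  assumes "c \<in> A" "compact K" "K \<subseteq> img c"
  shows "compact (chart_inv c ` K)"
  using assms continuous_on_subset[OF continuous_on_chart_inv[OF assms(1)]]
  by (intro compact_continuous_image) auto

lemma compact_chart_image:
  assumes "c \<in> A" "compact K" "K \<subseteq> fst c"
  shows "compact (snd c ` K)" "snd c ` K \<subseteq> img c"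
  using assms continuous_on_subset[OF continuous_on_chart[OF assms(1)]]
  by (auto intro!: compact_continuous_image simp: img_def)

text \<open>In another chart the extension is \<open>u\<close> after a transition map on the
  overlap, and 0 off the image of \<open>K\<close>. Compact sets are closed in a Hausdorff space, so
  both regions are open, and together they cover the chart.\<close>

lemma extend_test_function:
  assumes c: "c \<in> A" and u: "smooth_on (img c) u" and K: "compact K" "K \<subseteq> img c"
    and zero: "\<And>y. y \<in> img c - K \<Longrightarrow> u y = 0"
  shows "extend c u \<in> test_functions A"
proof (rule test_functionI)
  let ?K = "chart_inv c ` K"
  show K': "compact ?K" by (rule compact_chart_inv[OF c K])
  show ext0: "extend c u x = 0" if "x \<notin> ?K" for x
  proof (cases "x \<in> fst c")
    case True
    have "snd c x \<notin> K"
      using that chart_inv_chart[OF c True] by (metis image_eqI)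
    then show ?thesis
      using zero chart_in[OF c True] by (simp add: extend_def)
  qed (simp add: extend_def)
  show "smooth_fun A (extend c u)"
  proof (rule smooth_funI)
    fix d assume d: "d \<in> A"
    let ?W = "snd d ` (fst d \<inter> fst c)" and ?Z = "snd d ` (fst d - ?K)"
    have W: "open ?W" and Z: "open ?Z"
      using K' open_dom[OF c] open_dom[OF d]
      by (auto intro!: open_chart_image[OF d] open_Diff compact_imp_closed)
    have "smooth_on ?W (\<lambda>y. u (transition d c y))"
    proof (rule smooth_on_compose[OF W open_img[OF c] smooth_transition[OF d c] u])
      show "transition d c ` ?W \<subseteq> img c"
        using chart_in[OF c] by (auto simp: transition_def chart_inv_chart[OF d])
    qed
    then have 1: "smooth_on ?W (\<lambda>y. extend c u (chart_inv d y))"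
      by (rule smooth_on_cong[OF W, rotated]) (auto simp: extend_def transition_def chart_inv_chart[OF d])
    have 2: "smooth_on ?Z (\<lambda>y. extend c u (chart_inv d y))"
    proof (rule smooth_on_cong[OF Z _ smooth_on_const[of _ 0]])
      fix y assume "y \<in> ?Z"
      then obtain x where "x \<in> fst d" "x \<notin> ?K" "y = snd d x" by auto
      then show "0 = extend c u (chart_inv d y)" by (simp add: ext0 chart_inv_chart[OF d])
    qed
    have "?K \<subseteq> fst c" using K chart_inv_in[OF c] by auto
    then have "?W \<union> ?Z = img d" unfolding img_def by blast
    then show "smooth_on (img d) (\<lambda>y. extend c u (chart_inv d y))"
      using smooth_on_Un[OF W Z 1 2] by simp
  qed
qed

text \<open>Besides a compact support it provides an open \<open>U\<close> on which the bump is
  exactly 1. A factor 1 - b then vanishes on all of \<open>U\<close>, which drives both the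
  induction over finite covers and the limits over countable ones.\<close>

lemma bump_exists:
  assumes c: "c \<in> A" and x: "x \<in> fst c" and S: "open S" "x \<in> S"
  obtains b :: "'a \<Rightarrow> real" and U K where "(\<lambda>x. of_real (b x)) \<in> test_functions A"
    "\<And>x. 0 \<le> b x \<and> b x \<le> 1" "open U" "x \<in> U" "\<And>z. z \<in> U \<Longrightarrow> b z = 1"
    "compact K" "K \<subseteq> S" "K \<subseteq> fst c" "\<And>z. z \<notin> K \<Longrightarrow> b z = 0" "U \<subseteq> fst c"
proof -
  let ?y = "snd c x" and ?W = "snd c ` (fst c \<inter> S)"
  have "open ?W" by (intro open_chart_image c open_Int open_dom S) auto
  moreover have "?y \<in> ?W" using x S by auto
  ultimately obtain e where e: "e > 0" "cball ?y e \<subseteq> ?W"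
    by (meson open_contains_cball)
  \<comment> \<open>The bump of radius \<open>r\<close> reaches out to 2r, which has to stay inside
    \<open>?W\<close>.\<close>
  define r where "r = e / 2"
  have r: "r > 0" "cball ?y (2 * r) \<subseteq> ?W" using e by (simp_all add: r_def)
  obtain b :: "real^'n \<Rightarrow> real" where b: "smooth_on UNIV b" "\<And>y. 0 \<le> b y \<and> b y \<le> 1"
    "\<And>y. y \<in> ball ?y r \<Longrightarrow> b y = 1" "\<And>y. y \<notin> cball ?y (2 * r) \<Longrightarrow> b y = 0"
    using smooth_bump[OF r(1)] by blast
  define b' where "b' z = (if z \<in> fst c then b (snd c z) else 0)" for z
  define K where "K = chart_inv c ` cball ?y (2 * r)"
  define U where "U = fst c \<inter> snd c -` ball ?y r"
  have W: "?W \<subseteq> img c" by (auto simp: img_def)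
  have ext: "(\<lambda>z. of_real (b' z)) = extend c (\<lambda>y. of_real (b y))"
    by (auto simp: b'_def extend_def)
  have K_sub: "K \<subseteq> fst c \<inter> S"
    using r(2) chart_inv_chart[OF c] by (fastforce simp: K_def)
  show ?thesis
  proof
    show "(\<lambda>z. of_real (b' z)) \<in> test_functions A"
      unfolding ext
    proof (rule extend_test_function[OF c])
      show "smooth_on (img c) (\<lambda>y. of_real (b y))"
        by (rule smooth_on_bounded_linear[OF bounded_linear_of_real open_img[OF c] smooth_on_subset[OF b(1) subset_UNIV]])
      show "compact (cball ?y (2 * r))" by simp
      show "cball ?y (2 * r) \<subseteq> img c" using r(2) W by blast
    qed (use b in auto)
    show "0 \<le> b' z \<and> b' z \<le> 1" for z using b by (simp add: b'_def)
    show "open U" unfolding U_def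
      by (rule continuous_open_preimage[OF continuous_on_chart[OF c] open_dom[OF c]]) simp
    show "x \<in> U" using x r by (simp add: U_def)
    show "b' z = 1" if "z \<in> U" for z using that b(3) by (simp add: U_def b'_def)
    show "compact K" unfolding K_def using r(2) W by (intro compact_chart_inv c) auto
    show "K \<subseteq> S" "K \<subseteq> fst c" using K_sub by auto
    show "b' z = 0" if "z \<notin> K" for z
    proof (cases "z \<in> fst c")
      case True
      then have "snd c z \<notin> cball ?y (2 * r)"
        using that chart_inv_chart[OF c True] unfolding K_def by (metis image_eqI)
      then show ?thesis using b(4) by (simp add: b'_def)
    qed (simp add: b'_def)
    show "U \<subseteq> fst c" by (simp add: U_def)
  qed
qed

lemma test_function_bounded:
  assumes "\<psi> \<in> test_functions A"
  obtains C where "0 \<le> C" "\<And>x. cmod (\<psi> x) \<le> C"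
proof -
  note \<psi> = test_functionD[OF assms]
  have "bounded (\<psi> ` closure {x. \<psi> x \<noteq> 0})"
    using smooth_fun_continuous[OF \<psi>(1)] \<psi>(2)
    by (intro compact_imp_bounded compact_continuous_image) (auto intro: continuous_on_subset)
  then obtain C where C: "\<And>x. x \<in> closure {x. \<psi> x \<noteq> 0} \<Longrightarrow> cmod (\<psi> x) \<le> C"
    by (auto simp: bounded_iff)
  show ?thesis
  proof (rule that[of "max C 0"])
    show "cmod (\<psi> x) \<le> max C 0" for x
    proof (cases "\<psi> x = 0")
      case False
      then have "x \<in> closure {x. \<psi> x \<noteq> 0}" using closure_subset[of "{x. \<psi> x \<noteq> 0}"] by blast
      from C[OF this] show ?thesis by simp
    qed simp
  qed simp
qed

lemma zero_off_support: "x \<notin> closure {x. f x \<noteq> 0} \<Longrightarrow> f x = 0"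
  by (rule ccontr, erule notE, rule subsetD[OF closure_subset]) simp

lemma test_function_mult_left:
  assumes "\<psi> \<in> test_functions A" "smooth_fun A u"
  shows "(\<lambda>x. \<psi> x * u x) \<in> test_functions A"
  by (rule test_functionI[OF smooth_fun_mult[OF test_functionD(1)[OF assms(1)] assms(2)] test_functionD(2)[OF assms(1)]])
    (drule zero_off_support, simp)

lemma test_function_zero: "(\<lambda>x. 0) \<in> test_functions A"
  by (rule test_functionI[where K = "{}"]) (auto intro: smooth_fun_const)

lemma test_function_add:
  assumes \<psi>: "\<psi> \<in> test_functions A" and \<phi>: "\<phi> \<in> test_functions A"
  shows "(\<lambda>x. \<psi> x + \<phi> x) \<in> test_functions A"
proof (rule test_functionI)
  show "smooth_fun A (\<lambda>x. \<psi> x + \<phi> x)"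
    by (intro smooth_fun_add test_functionD(1) \<psi> \<phi>)
  show "compact (closure {x. \<psi> x \<noteq> 0} \<union> closure {x. \<phi> x \<noteq> 0})"
    by (intro compact_Un test_functionD(2) \<psi> \<phi>)
next
  fix x assume "x \<notin> closure {x. \<psi> x \<noteq> 0} \<union> closure {x. \<phi> x \<noteq> 0}"
  then have "\<psi> x = 0" "\<phi> x = 0" by (auto dest: zero_off_support)
  then show "\<psi> x + \<phi> x = 0" by simp
qed

section \<open>Existence and uniqueness of the codifferential\<close>

lemma fip_zero_right: "\<beta> (chart_at A x) x = 0 \<Longrightarrow> fip \<gamma> \<beta> x = 0"
  by (simp add: fip_herm herm_def)

text \<open>Stronger than the property in \<open>codiff\<close>: integrability is recorded because
  Bochner integrals of nonintegrable functions default to 0 and would not add up, and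
  \<open>h\<close> is a test function so that it is bounded.\<close>

definition has_codiff :: "('a, 'n) form \<Rightarrow> ('a \<Rightarrow> complex) \<Rightarrow> bool" where
  "has_codiff \<alpha> h \<longleftrightarrow> h \<in> test_functions A \<and>
     (\<forall>\<psi>\<in>test_functions A. integrable V (fip (ext_d \<psi>) \<alpha>) \<and> integrable V (\<lambda>x. cnj (\<psi> x) * h x) \<and>
        (\<integral>x. fip (ext_d \<psi>) \<alpha> x \<partial>V) = (\<integral>x. cnj (\<psi> x) * h x \<partial>V))"

lemma has_codiff_add:
  assumes \<alpha>: "has_codiff \<alpha> h" and \<beta>: "has_codiff \<beta> k"
  shows "has_codiff (fadd \<alpha> \<beta>) (\<lambda>x. h x + k x)"
  unfolding has_codiff_def
proof (intro conjI ballI)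
  show "(\<lambda>x. h x + k x) \<in> test_functions A"
    using \<alpha> \<beta> by (simp add: has_codiff_def test_function_add)
  fix \<psi> assume "\<psi> \<in> test_functions A"
  then have 1: "integrable V (fip (ext_d \<psi>) \<alpha>)" "integrable V (\<lambda>x. cnj (\<psi> x) * h x)"
      "(\<integral>x. fip (ext_d \<psi>) \<alpha> x \<partial>V) = (\<integral>x. cnj (\<psi> x) * h x \<partial>V)"
    and 2: "integrable V (fip (ext_d \<psi>) \<beta>)" "integrable V (\<lambda>x. cnj (\<psi> x) * k x)"
      "(\<integral>x. fip (ext_d \<psi>) \<beta> x \<partial>V) = (\<integral>x. cnj (\<psi> x) * k x \<partial>V)"
    using \<alpha> \<beta> by (simp_all add: has_codiff_def)
  have eq: "fip (ext_d \<psi>) (fadd \<alpha> \<beta>) = (\<lambda>x. fip (ext_d \<psi>) \<alpha> x + fip (ext_d \<psi>) \<beta> x)"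
    by (rule ext) (rule fip_simps)
  show "integrable V (fip (ext_d \<psi>) (fadd \<alpha> \<beta>))"
    unfolding eq by (rule Bochner_Integration.integrable_add[OF 1(1) 2(1)])
  show "integrable V (\<lambda>x. cnj (\<psi> x) * (h x + k x))"
    unfolding distrib_left by (rule Bochner_Integration.integrable_add[OF 1(2) 2(2)])
  show "(\<integral>x. fip (ext_d \<psi>) (fadd \<alpha> \<beta>) x \<partial>V) = (\<integral>x. cnj (\<psi> x) * (h x + k x) \<partial>V)"
    unfolding eq distrib_left
    by (simp add: Bochner_Integration.integral_add 1 2)
qed

lemma frechet_derivative_cnj:
  assumes "(p has_derivative frechet_derivative p (at y)) (at y)"
  shows "frechet_derivative (\<lambda>y. cnj (p y)) (at y) e = cnj (frechet_derivative p (at y) e)"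
  using frechet_derivative_at[OF bounded_linear.has_derivative[OF bounded_linear_cnj assms]] by metis

text \<open>Integrating by parts in coordinates gives -(1/v) sum_i d_i (v sum_j g^ij \<alpha>_j),
  where v is the volume density; \<open>F i\<close> is the i-th differentiated term and
  \<open>h0\<close> the whole expression. The second support condition concerns
  \<open>chart_at A x\<close>, the chart in which \<open>form_inner\<close> is evaluated.\<close>

lemma has_codiff_local:
  assumes c: "c \<in> A" and \<alpha>: "\<alpha> \<in> test_forms A" and K: "compact K" "K \<subseteq> fst c"
    and supp: "\<And>x. x \<in> fst c - K \<Longrightarrow> \<alpha> c x = 0"
    and supp': "\<And>x. x \<notin> K \<Longrightarrow> \<alpha> (chart_at A x) x = 0"
  shows "\<exists>h. has_codiff \<alpha> h"
proof -
  let ?I = "img c" and ?L = "snd c ` K"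
  define F where "F i y = (\<Sum>j\<in>UNIV. of_real (vdens c y) * (of_real (ginv c (chart_inv c y) $ i $ j) * \<alpha> c (chart_inv c y) $ j))" for i y
  define D where "D y = (\<Sum>i\<in>UNIV. frechet_derivative (F i) (at y) (axis i 1))" for y
  define h0 where "h0 y = - (of_real (inverse (vdens c y)) * D y)" for y
  have I: "open ?I" by (rule open_img[OF c])
  have L: "compact ?L" "?L \<subseteq> ?I"
    using compact_chart_image[OF c K] .
  have off: "chart_inv c y \<in> fst c - K" if "y \<in> ?I - ?L" for y
    using that chart_inv_in[OF c] chart_chart_inv[OF c] by (metis DiffD1 DiffD2 DiffI image_eqI)
  have F: "smooth_on ?I (F i)" for i
    unfolding F_def
    by (intro smooth_on_sum smooth_on_mult I smooth_on_bounded_linear[OF bounded_linear_of_real]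
        smooth_vdens smooth_ginv test_formD(3)[OF \<alpha>] c)
  have F0: "F i y = 0" if "y \<in> ?I - ?L" for i y
    using supp[OF off[OF that]] by (simp add: F_def)
  have openIL: "open (?I - ?L)" using I L by (simp add: open_Diff compact_imp_closed)
  have D0: "D y = 0" if y: "y \<in> ?I - ?L" for y
  proof -
    have "frechet_derivative (F i) (at y) = (\<lambda>h. 0)" for i
    proof -
      have "(F i has_derivative (\<lambda>h. 0)) (at y)"
        by (rule has_derivative_transform_within_open[OF has_derivative_const openIL y]) (simp add: F0)
      then show ?thesis by (rule frechet_derivative_at[symmetric])
    qed
    then show ?thesis by (simp add: D_def)
  qed
  have h0: "smooth_on ?I h0"
  proof -
    have "smooth_on ?I (\<lambda>y. (- 1) * (of_real (inverse (vdens c y)) * D y))"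
      unfolding D_def
      by (intro smooth_on_mult smooth_on_const smooth_on_bounded_linear[OF bounded_linear_of_real]
          smooth_on_inverse smooth_vdens smooth_on_sum smooth_on_derivative F I c less_imp_neq[THEN not_sym] vdens_pos)
    moreover have "h0 = (\<lambda>y. (- 1) * (of_real (inverse (vdens c y)) * D y))"
      by (simp add: h0_def fun_eq_iff)
    ultimately show ?thesis by simp
  qed
  have h: "extend c h0 \<in> test_functions A"
    by (rule extend_test_function[OF c h0 L]) (simp add: h0_def D0)
  have h_borel: "extend c h0 \<in> borel_measurable borel"
    by (rule smooth_fun_measurable[OF test_functionD(1)[OF h]])
  have "integrable V (fip (ext_d \<psi>) \<alpha>) \<and> integrable V (\<lambda>x. cnj (\<psi> x) * extend c h0 x) \<and>
        (\<integral>x. fip (ext_d \<psi>) \<alpha> x \<partial>V) = (\<integral>x. cnj (\<psi> x) * extend c h0 x \<partial>V)"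
    if \<psi>: "\<psi> \<in> test_functions A" for \<psi>
  proof -
    note s\<psi> = test_functionD(1)[OF \<psi>]
    define p where "p y = \<psi> (chart_inv c y)" for y
    define q where "q y = cnj (p y)" for y
    have p: "smooth_on ?I p" unfolding p_def by (rule smooth_funD[OF s\<psi> c])
    have q: "smooth_on ?I q" unfolding q_def by (rule smooth_on_bounded_linear[OF bounded_linear_cnj I p])
    have dq: "frechet_derivative q (at y) e = cnj (frechet_derivative p (at y) e)" if "y \<in> ?I" for y e
      unfolding q_def by (rule frechet_derivative_cnj[OF smooth_on_has_derivative[OF p that]])
    have b1: "fip (ext_d \<psi>) \<alpha> \<in> borel_measurable borel"
      by (intro measurable_fip test_form_borel test_form_ext_d \<psi> \<alpha>)
    have b2: "(\<lambda>x. cnj (\<psi> x) * extend c h0 x) \<in> borel_measurable borel"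
      by (intro borel_measurable_times measurable_cnj smooth_fun_measurable s\<psi> h_borel)
    have s1: "fip (ext_d \<psi>) \<alpha> x = 0" if "x \<notin> fst c" for x
      using that K(2) by (intro fip_zero_right supp') auto
    have s2: "cnj (\<psi> x) * extend c h0 x = 0" if "x \<notin> fst c" for x
      using that by (simp add: extend_def)
    \<comment> \<open>The two sides of integration by parts for the i-th component:
      \<open>?G\<close> comes from the pairing with the differential of \<psi>, and
      \<open>?H\<close> from the integral of \<psi> against the extension of
      \<open>h0\<close>.\<close>
    let ?G = "\<lambda>i y. indicator ?I y *\<^sub>R (frechet_derivative q (at y) (axis i 1) * F i y)"
    let ?H = "\<lambda>i y. indicator ?I y *\<^sub>R (q y * frechet_derivative (F i) (at y) (axis i 1))"
    have e1: "indicator ?I y *\<^sub>R (vdens c y *\<^sub>R fip (ext_d \<psi>) \<alpha> (chart_inv c y)) = (\<Sum>i\<in>UNIV. ?G i y)" for y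
    proof (cases "y \<in> ?I")
      case True
      have "fip (ext_d \<psi>) \<alpha> (chart_inv c y) =
          herm (ginv c (chart_inv c y)) (ext_d \<psi> c (chart_inv c y)) (\<alpha> c (chart_inv c y))"
        by (intro fip_chart c chart_inv_in True is_form_ext_d s\<psi> test_formD(1)[OF \<alpha>])
      then show ?thesis
        using True
        by (simp add: herm_def ext_d_chart[OF c True] p_def[symmetric] dq F_def scaleR_conv_of_real
            sum_distrib_left algebra_simps)
    qed simp
    have e2: "indicator ?I y *\<^sub>R (vdens c y *\<^sub>R (cnj (\<psi> (chart_inv c y)) * extend c h0 (chart_inv c y))) =
        - (\<Sum>i\<in>UNIV. ?H i y)" for y
    proof (cases "y \<in> ?I")
      case True
      then have "extend c h0 (chart_inv c y) = h0 y"
        by (simp add: extend_def chart_inv_in[OF c] chart_chart_inv[OF c])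
      moreover have "vdens c y *\<^sub>R (q y * h0 y) = - (q y * D y)"
        using vdens_pos[OF c True] by (simp add: h0_def scaleR_conv_of_real)
      moreover have "(\<Sum>i\<in>UNIV. ?H i y) = q y * D y"
        using True by (simp add: D_def sum_distrib_left)
      ultimately show ?thesis
        using True by (simp add: q_def p_def)
    qed simp
    have parts: "(\<integral>y. ?G i y \<partial>lborel) = - (\<integral>y. ?H i y \<partial>lborel)"
      "integrable lborel (?G i)" "integrable lborel (?H i)" for i
      by (rule integration_by_parts[OF I q F L F0]; assumption)+
    have i1: "integrable V (fip (ext_d \<psi>) \<alpha>)"
      by (rule integrable_vol_chart[OF c b1 s1, THEN iffD2], assumption)
        (simp only: e1 Bochner_Integration.integrable_sum[OF parts(2)])
    have i2: "integrable V (\<lambda>x. cnj (\<psi> x) * extend c h0 x)"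
      by (rule integrable_vol_chart[OF c b2 s2, THEN iffD2], assumption)
        (simp only: e2 Bochner_Integration.integrable_minus[OF Bochner_Integration.integrable_sum[OF parts(3)]])
    have "(\<integral>x. fip (ext_d \<psi>) \<alpha> x \<partial>V) = (\<Sum>i\<in>UNIV. \<integral>y. ?G i y \<partial>lborel)"
      by (rule trans[OF integral_vol_chart[OF c b1 s1]], assumption)
        (simp only: e1 Bochner_Integration.integral_sum[OF parts(2)])
    also have "\<dots> = - (\<Sum>i\<in>UNIV. \<integral>y. ?H i y \<partial>lborel)"
      unfolding parts(1) by (simp add: sum_negf)
    also have "(\<Sum>i\<in>UNIV. \<integral>y. ?H i y \<partial>lborel) = (\<integral>y. (\<Sum>i\<in>UNIV. ?H i y) \<partial>lborel)"
      by (intro Bochner_Integration.integral_sum[symmetric] parts(3))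
    also have "- \<dots> = (\<integral>x. cnj (\<psi> x) * extend c h0 x \<partial>V)"
      by (rule trans[OF _ integral_vol_chart[OF c b2 s2, symmetric]], simp only: e2) simp_all
    finally show ?thesis using i1 i2 by blast
  qed
  then show ?thesis using h unfolding has_codiff_def by blast
qed

text \<open>Induction over a finite cover by sets on which a bump \<open>b\<close> is 1: split \<open>\<alpha> = b \<alpha> + (1 - b) \<alpha>\<close>.\<close>

lemma has_codiff_exists:
  assumes \<alpha>: "\<alpha> \<in> test_forms A"
  shows "\<exists>h. has_codiff \<alpha> h"
proof -
  define good where "good b U \<longleftrightarrow> (\<lambda>x. complex_of_real (b x)) \<in> test_functions A \<and> (\<forall>z\<in>U. b z = 1) \<and>
      (\<exists>c\<in>A. \<exists>K. compact K \<and> K \<subseteq> fst c \<and> (\<forall>z. z \<notin> K \<longrightarrow> b z = 0))" for b :: "'a \<Rightarrow> real" and U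
  have "\<exists>U b. open U \<and> x \<in> U \<and> good b U" for x
  proof -
    obtain b U K where "(\<lambda>x. complex_of_real (b x)) \<in> test_functions A" "open U" "x \<in> U" "\<And>z. z \<in> U \<Longrightarrow> b z = 1"
      "compact K" "K \<subseteq> fst (chart_at A x)" "\<And>z. z \<notin> K \<Longrightarrow> b z = 0"
      using bump_exists[OF chart_at open_UNIV UNIV_I] by metis
    then show ?thesis unfolding good_def using chart_at(1) by blast
  qed
  then obtain U b where Ub: "\<And>x. open (U x)" "\<And>x. x \<in> U x" "\<And>x. good (b x) (U x)"
    by metis
  have claim: "\<exists>h. has_codiff \<beta> h"
    if "finite X" "\<beta> \<in> test_forms A" "\<And>d x. d \<in> A \<Longrightarrow> x \<in> fst d \<Longrightarrow> \<beta> d x \<noteq> 0 \<Longrightarrow> x \<in> (\<Union>p\<in>X. U p)" for X \<beta>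
    using that
  proof (induction X arbitrary: \<beta> rule: finite_induct)
    case (empty \<beta>)
    then have "\<beta> (chart_at A x) x = 0" for x
      using chart_at[of x] by blast
    then have "fip \<gamma> \<beta> = (\<lambda>x. 0)" for \<gamma>
      by (intro ext fip_zero_right)
    then have "has_codiff \<beta> (\<lambda>x. 0)"
      by (simp add: has_codiff_def test_function_zero)
    then show ?case by (rule exI[of "has_codiff \<beta>"])
  next
    case (insert p X \<beta>)
    let ?b = "\<lambda>x. complex_of_real (b p x)"
    from Ub(3)[of p] obtain c K where b: "?b \<in> test_functions A" "\<And>z. z \<in> U p \<Longrightarrow> b p z = 1"
      and c: "c \<in> A" and K: "compact K" "K \<subseteq> fst c" "\<And>z. z \<notin> K \<Longrightarrow> b p z = 0"
      unfolding good_def by blast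
    note sb = test_functionD(1)[OF b(1)]
    have "\<exists>h. has_codiff (fscale ?b \<beta>) h"
      by (rule has_codiff_local[OF c test_form_fscale[OF insert.prems(1) sb] K(1,2)])
        (simp_all add: fscale_def K(3))
    moreover have "\<exists>h. has_codiff (fscale (\<lambda>x. 1 - ?b x) \<beta>) h"
    proof (rule insert.IH)
      show "fscale (\<lambda>x. 1 - ?b x) \<beta> \<in> test_forms A"
        by (intro test_form_fscale insert.prems smooth_fun_diff smooth_fun_const sb)
      show "x \<in> (\<Union>p\<in>X. U p)" if "d \<in> A" "x \<in> fst d" "fscale (\<lambda>x. 1 - ?b x) \<beta> d x \<noteq> 0" for d x
      proof -
        have "\<beta> d x \<noteq> 0" "x \<notin> U p"
          using that(3) b(2) by (auto simp: fscale_def)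
        then show ?thesis using insert.prems(2)[OF that(1,2)] by auto
      qed
    qed
    moreover have "fadd (fscale ?b \<beta>) (fscale (\<lambda>x. 1 - ?b x) \<beta>) = \<beta>"
      by (simp add: fadd_def fscale_def fun_eq_iff vec_eq_iff algebra_simps)
    ultimately show ?case using has_codiff_add by metis
  qed
  have "compact (form_support A \<alpha>)" by (rule test_formD(2)[OF \<alpha>])
  then obtain X where X: "finite X" "form_support A \<alpha> \<subseteq> (\<Union>p\<in>X. U p)"
  proof (rule compactE_image[where C = "UNIV" and f = U])
    show "open (U p)" for p by (rule Ub(1))
    show "form_support A \<alpha> \<subseteq> (\<Union>p\<in>UNIV. U p)" using Ub(2) by auto
  qed auto
  show ?thesis
  proof (rule claim[OF X(1) \<alpha>])
    fix d x assume "d \<in> A" "x \<in> fst d" "\<alpha> d x \<noteq> 0"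
    then have "x \<in> form_support A \<alpha>"
      unfolding form_support_def by (intro closure_subset[THEN subsetD]) blast
    then show "x \<in> (\<Union>p\<in>X. U p)" using X(2) by blast
  qed
qed

lemma integrable_chart_support:
  fixes f :: "'a \<Rightarrow> 'b::{banach, second_countable_topology}"
  assumes f: "continuous_on UNIV f" and c: "c \<in> A" and K: "compact K" "K \<subseteq> fst c"
    and supp: "\<And>x. x \<notin> K \<Longrightarrow> f x = 0"
  shows "integrable V f"
proof -
  let ?L = "snd c ` K"
  have L: "compact ?L" "?L \<subseteq> img c"
    using compact_chart_image[OF c K] .
  have cont: "continuous_on (img c) (\<lambda>y. vdens c y *\<^sub>R f (chart_inv c y))"
    by (intro continuous_on_scaleR smooth_on_imp_continuous_on smooth_vdens c
        continuous_on_compose2[OF f continuous_on_chart_inv[OF c]]) auto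
  have "chart_inv c y \<notin> K" if "y \<in> img c - ?L" for y
    using that chart_chart_inv[OF c] by (metis DiffD1 DiffD2 image_eqI)
  then have "(\<lambda>y. indicator (img c) y *\<^sub>R (vdens c y *\<^sub>R f (chart_inv c y))) =
      (\<lambda>y. indicator ?L y *\<^sub>R (vdens c y *\<^sub>R f (chart_inv c y)))"
    using L(2) supp by (auto simp: fun_eq_iff indicator_def)
  moreover have "integrable lborel (\<lambda>y. indicator ?L y *\<^sub>R (vdens c y *\<^sub>R f (chart_inv c y)))"
    by (rule borel_integrable_compact[OF L(1) continuous_on_subset[OF cont L(2)]])
  moreover have "f x = 0" if "x \<notin> fst c" for x
    using that K supp by auto
  ultimately show ?thesis
    using integrable_vol_chart[OF c borel_measurable_continuous_onI[OF f]] by simp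
qed

text \<open>Test with b (h - k), where b is a bump at a point at which h and k differ: the integral
  of b |h - k|^2 would be 0, although this function is continuous, nonnegative and positive at that
  point.\<close>

lemma smooth_fun_eqI:
  assumes h: "smooth_fun A h" and k: "smooth_fun A k"
    and eq: "\<And>\<psi>. \<psi> \<in> test_functions A \<Longrightarrow> (\<integral>x. cnj (\<psi> x) * h x \<partial>V) = (\<integral>x. cnj (\<psi> x) * k x \<partial>V)"
  shows "h = k"
proof (rule ext, rule ccontr)
  fix x assume "h x \<noteq> k x"
  let ?c = "chart_at A x"
  note c = chart_at(1)[of x]
  define u where "u z = h z - k z" for z
  have u: "smooth_fun A u" unfolding u_def by (intro smooth_fun_diff h k)
  obtain b K where b: "(\<lambda>x. complex_of_real (b x)) \<in> test_functions A" "\<And>x. 0 \<le> b x \<and> b x \<le> (1::real)" "b x = 1"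
    and K: "compact K" "K \<subseteq> fst ?c" "\<And>z. z \<notin> K \<Longrightarrow> b z = 0"
    using bump_exists[OF chart_at open_UNIV UNIV_I] by metis
  define \<psi> where "\<psi> z = of_real (b z) * u z" for z
  define w where "w z = b z * (cmod (u z))\<^sup>2" for z
  let ?f = "\<lambda>y. indicator (img ?c) y *\<^sub>R (vdens ?c y *\<^sub>R w (chart_inv ?c y))"
  have test: "\<psi> \<in> test_functions A"
    unfolding \<psi>_def by (rule test_function_mult_left[OF b(1) u])
  have int: "integrable V (\<lambda>z. cnj (\<psi> z) * v z)" if "smooth_fun A v" for v
  proof (rule integrable_chart_support[OF _ c K(1,2)])
    show "continuous_on UNIV (\<lambda>z. cnj (\<psi> z) * v z)"
      by (intro continuous_on_mult continuous_on_cnj smooth_fun_continuous[OF that]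
          smooth_fun_continuous[OF test_functionD(1)[OF test]])
  qed (simp add: \<psi>_def K(3))
  have cw: "cnj (\<psi> z) * h z - cnj (\<psi> z) * k z = of_real (w z)" for z
  proof -
    have "cnj (\<psi> z) * h z - cnj (\<psi> z) * k z = cnj (\<psi> z) * u z"
      by (simp add: u_def right_diff_distrib)
    also have "\<dots> = of_real (b z) * (u z * cnj (u z))"
      by (simp add: \<psi>_def)
    finally show ?thesis by (simp add: w_def complex_norm_square[symmetric])
  qed
  have "(\<integral>z. of_real (w z) \<partial>V) = complex_of_real 0"
    using eq[OF test] unfolding cw[symmetric] by (simp add: Bochner_Integration.integral_diff int h k)
  then have int0: "(\<integral>z. w z \<partial>V) = 0"
    by simp
  have cb: "continuous_on UNIV b"
    using continuous_on_Re[OF smooth_fun_continuous[OF test_functionD(1)[OF b(1)]]] by simp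
  have cont: "continuous_on UNIV w"
    unfolding w_def by (intro continuous_intros cb smooth_fun_continuous u)
  have meas: "w \<in> borel_measurable borel" by (rule borel_measurable_continuous_onI[OF cont])
  have supp: "w z = 0" if "z \<notin> fst ?c" for z
    using that K by (auto simp: w_def)
  have int_f: "integrable lborel ?f"
    by (rule integrable_vol_chart[OF c meas supp, THEN iffD1], assumption,
        rule integrable_chart_support[OF cont c K(1,2)]) (simp add: w_def K(3))
  have nonneg: "0 \<le> ?f y" for y
  proof (cases "y \<in> img ?c")
    case True
    have "0 \<le> vdens ?c y * w (chart_inv ?c y)"
      unfolding w_def using vdens_pos[OF c True] b(2) by (intro mult_nonneg_nonneg) auto
    then show ?thesis by simp
  qed simp
  have "(\<integral>y. ?f y \<partial>lborel) = 0"
    using int0 integral_vol_chart[OF c meas supp] by simp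
  then have ae: "AE y in lborel. ?f y = 0"
    using integral_nonneg_eq_0_iff_AE[OF int_f] nonneg by auto
  let ?q = "\<lambda>y. vdens ?c y * w (chart_inv ?c y)"
  have "continuous_on (img ?c) ?q"
    by (intro continuous_on_mult smooth_on_imp_continuous_on smooth_vdens c
        continuous_on_compose2[OF cont continuous_on_chart_inv[OF c]]) auto
  then have "open (img ?c \<inter> ?q -` {0<..})"
    by (rule continuous_open_preimage[OF _ open_img[OF c]]) simp
  moreover have "snd ?c x \<in> img ?c \<inter> ?q -` {0<..}"
    using \<open>h x \<noteq> k x\<close> b(3) chart_at(2)[of x] vdens_pos[OF c chart_in[OF c chart_at(2)]]
    by (simp add: chart_in[OF c] chart_inv_chart[OF c] w_def u_def)
  ultimately obtain r where r: "r > 0" "ball (snd ?c x) r \<subseteq> img ?c \<inter> ?q -` {0<..}"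
    by (meson open_contains_ball)
  \<comment> \<open>The integrand is positive on a whole ball, which would thus be a Lebesgue null
    set.\<close>
  from ae have "AE y in lborel. y \<notin> ball (snd ?c x) r"
  proof eventually_elim
    case (elim y)
    show ?case
    proof
      assume "y \<in> ball (snd ?c x) r"
      then have "y \<in> img ?c" "0 < ?q y" using r(2) by auto
      with elim show False by auto
    qed
  qed
  then have "ball (snd ?c x) r \<in> null_sets lborel"
    by (subst (asm) AE_iff_null_sets[symmetric]) auto
  then have "measure lborel (ball (snd ?c x) r) = 0"
    by (simp add: null_sets_def measure_def)
  then show False using content_ball_pos[OF r(1)] by (metis less_irrefl)
qed

lemma codiff_eqI:
  assumes "has_codiff \<alpha> h"
  shows "codiff A g \<alpha> = h"
  unfolding codiff_def
proof (rule the_equality)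
  show "smooth_fun A h \<and> (\<forall>\<psi>\<in>test_functions A. (\<integral>x. fip (ext_d \<psi>) \<alpha> x \<partial>V) = (\<integral>x. cnj (\<psi> x) * h x \<partial>V))"
    using assms by (simp add: has_codiff_def test_functionD)
  show "k = h" if "smooth_fun A k \<and> (\<forall>\<psi>\<in>test_functions A. (\<integral>x. fip (ext_d \<psi>) \<alpha> x \<partial>V) = (\<integral>x. cnj (\<psi> x) * k x \<partial>V))" for k
    using that assms by (intro smooth_fun_eqI) (simp_all add: has_codiff_def test_functionD)
qed

lemma codiff_test_function:
  assumes "\<alpha> \<in> test_forms A"
  shows "codiff A g \<alpha> \<in> test_functions A"
proof -
  obtain h where "has_codiff \<alpha> h" using has_codiff_exists[OF assms] ..
  then show ?thesis by (simp add: codiff_eqI) (simp add: has_codiff_def)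
qed

section \<open>The distributional differential as a functional\<close>

lemma integrable_dist_d:
  assumes f: "integrable V f" and \<alpha>: "\<alpha> \<in> test_forms A"
  shows "integrable V (\<lambda>x. cnj (f x) * codiff A g \<alpha> x)"
proof -
  obtain C where C: "\<And>x. cmod (codiff A g \<alpha> x) \<le> C" "0 \<le> C"
    using test_function_bounded[OF codiff_test_function[OF \<alpha>]] by metis
  have meas: "codiff A g \<alpha> \<in> borel_measurable borel" "f \<in> borel_measurable borel"
    using smooth_fun_measurable test_functionD codiff_test_function[OF \<alpha>] borel_measurable_integrable[OF f] by auto
  show ?thesis
  proof (rule Bochner_Integration.integrable_bound)
    show "integrable V (\<lambda>x. C * cmod (f x))" using f by simp
    show "(\<lambda>x. cnj (f x) * codiff A g \<alpha> x) \<in> borel_measurable V"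
      using meas by (simp add: borel_measurable_times measurable_cnj)
    show "AE x in V. cmod (cnj (f x) * codiff A g \<alpha> x) \<le> norm (C * cmod (f x))"
      using C by (intro AE_I2) (simp add: norm_mult mult.commute[of C] mult_left_mono)
  qed
qed

lemma dist_d_add:
  assumes "integrable V f" "integrable V h" "\<alpha> \<in> test_forms A"
  shows "dist_d A g (\<lambda>x. f x + h x) \<alpha> = dist_d A g f \<alpha> + dist_d A g h \<alpha>"
  unfolding dist_d_def complex_cnj_add distrib_right
  by (intro Bochner_Integration.integral_add integrable_dist_d assms)

lemma dist_d_diff:
  assumes "integrable V f" "integrable V h" "\<alpha> \<in> test_forms A"
  shows "dist_d A g (\<lambda>x. f x - h x) \<alpha> = dist_d A g f \<alpha> - dist_d A g h \<alpha>"
  unfolding dist_d_def complex_cnj_diff left_diff_distrib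
  by (intro Bochner_Integration.integral_diff integrable_dist_d assms)

lemma dist_d_scale: "dist_d A g (\<lambda>x. a * f x) \<alpha> = cnj a * dist_d A g f \<alpha>"
  by (simp add: dist_d_def mult.assoc)

text \<open>\<open>C\<close> bounds the codifferential of \<alpha> and does not depend on f. So for
  each test form the pairing is continuous in the L1 norm of f, which lets the weak derivative pass
  to limits.\<close>

lemma dist_d_bound:
  fixes \<alpha> :: "('a, 'n) form"
  assumes \<alpha>: "\<alpha> \<in> test_forms A"
  obtains C where "0 \<le> C" "\<And>f :: 'a \<Rightarrow> complex. integrable V f \<Longrightarrow> cmod (dist_d A g f \<alpha>) \<le> C * (\<integral>x. cmod (f x) \<partial>V)"
proof -
  obtain C where C: "\<And>x. cmod (codiff A g \<alpha> x) \<le> C" "0 \<le> C"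
    using test_function_bounded[OF codiff_test_function[OF \<alpha>]] by metis
  show ?thesis
  proof (rule that[OF C(2)])
    fix f :: "'a \<Rightarrow> complex" assume f: "integrable V f"
    have "cmod (dist_d A g f \<alpha>) \<le> (\<integral>x. cmod (cnj (f x) * codiff A g \<alpha> x) \<partial>V)"
      unfolding dist_d_def by (rule integral_norm_bound)
    also have "\<dots> \<le> (\<integral>x. C * cmod (f x) \<partial>V)"
      using f C(1) by (intro integral_mono integrable_norm integrable_dist_d \<alpha>)
        (auto simp: norm_mult mult.commute[of C] mult_left_mono)
    finally show "cmod (dist_d A g f \<alpha>) \<le> C * (\<integral>x. cmod (f x) \<partial>V)" by simp
  qed
qed

end

section \<open>Density of test forms\<close>

lemma less_ennreal_halves:
  assumes "x \<le> a + b" "a < ennreal (r / 2)" "b < ennreal (r / 2)" "0 < r"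
  shows "x < ennreal r"
proof -
  have "x < ennreal (r / 2) + ennreal (r / 2)"
    using assms(1) add_strict_mono[OF assms(2,3)] by (rule order.strict_trans1)
  then show ?thesis using assms(4) by (simp add: ennreal_plus[symmetric] del: ennreal_plus)
qed

context riemannian
begin

text \<open>Differentials of coordinate functions, multiplied by a bump before differentiating so
  that they become global test forms; where the bump is 1 they are the coordinate frame.\<close>

lemma local_frame:
  obtains c \<omega> U where "c \<in> A" "open U" "x \<in> U" "U \<subseteq> fst c" "\<And>i. \<omega> i \<in> test_forms A"
    "\<And>i z. z \<in> U \<Longrightarrow> \<omega> i c z = axis i 1"
proof -
  let ?c = "chart_at A x"
  note c = chart_at(1)[of x]
  obtain b U K where b: "(\<lambda>x. complex_of_real (b x)) \<in> test_functions A"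
    "open U" "x \<in> U" "\<And>z. z \<in> U \<Longrightarrow> b z = 1" "U \<subseteq> fst ?c"
    and K: "compact K" "K \<subseteq> fst ?c" "\<And>z. z \<notin> K \<Longrightarrow> b z = 0"
    by (rule bump_exists[OF chart_at[of x] open_UNIV UNIV_I]) blast
  define u where "u i = extend ?c (\<lambda>y. of_real (b (chart_inv ?c y)) * of_real (y $ i))" for i
  have u: "u i \<in> test_functions A" for i
    unfolding u_def
  proof (rule extend_test_function[OF c])
    show "smooth_on (img ?c) (\<lambda>y. complex_of_real (b (chart_inv ?c y)) * of_real (y $ i))"
      by (intro smooth_on_mult open_img c smooth_funD[OF test_functionD(1)[OF b(1)]]
          smooth_on_bounded_linear[OF bounded_linear_of_real] smooth_on_linear bounded_linear_vec_nth)
    show "compact (snd ?c ` K)" "snd ?c ` K \<subseteq> img ?c"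
      using compact_chart_image[OF c K(1,2)] .
    show "complex_of_real (b (chart_inv ?c y)) * of_real (y $ i) = 0" if "y \<in> img ?c - snd ?c ` K" for y
    proof -
      have "chart_inv ?c y \<notin> K"
        using that chart_chart_inv[OF c] by (metis DiffD1 DiffD2 image_eqI)
      then show ?thesis by (simp add: K(3))
    qed
  qed
  show ?thesis
  proof (rule that[OF c b(2,3,5)])
    show "ext_d (u i) \<in> test_forms A" for i by (rule test_form_ext_d[OF u])
    show "ext_d (u i) ?c z = axis i 1" if z: "z \<in> U" for i z
    proof -
      have W: "open (snd ?c ` U)" "snd ?c z \<in> snd ?c ` U"
        using z by (auto intro!: open_chart_image c b)
      have "((\<lambda>y :: real^'n. complex_of_real (y $ i)) has_derivative (\<lambda>h. of_real (h $ i))) (at (snd ?c z))"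
        by (intro bounded_linear_imp_has_derivative bounded_linear_compose[OF bounded_linear_of_real bounded_linear_vec_nth])
      then have "(u i \<circ> chart_inv ?c has_derivative (\<lambda>h. of_real (h $ i))) (at (snd ?c z))"
      proof (rule has_derivative_transform_within_open[OF _ W])
        fix y assume "y \<in> snd ?c ` U"
        then obtain w where w: "w \<in> U" "y = snd ?c w" by auto
        then have "w \<in> fst ?c" using b(5) by auto
        then show "complex_of_real (y $ i) = (u i \<circ> chart_inv ?c) y"
          using w b(4) by (simp add: u_def extend_def chart_inv_chart[OF c])
      qed
      from frechet_derivative_at[OF this, symmetric] show ?thesis
        by (simp add: ext_d_def vec_eq_iff axis_def)
    qed
  qed
qed

text \<open>The usual metric for convergence in measure. The cut at 1 keeps it finite, on a finite
  measure, for forms that are not integrable.\<close>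

definition dist_form :: "'a measure \<Rightarrow> ('a, 'n) form \<Rightarrow> ('a, 'n) form \<Rightarrow> ennreal" where
  "dist_form \<mu> \<alpha> \<beta> = (\<integral>\<^sup>+x. ennreal (min 1 (fnm (fsub \<alpha> \<beta>) x)) \<partial>\<mu>)"

definition approx :: "'a measure \<Rightarrow> ('a, 'n) form \<Rightarrow> bool" where
  "approx \<mu> \<gamma> \<longleftrightarrow> borel_form A \<gamma> \<and> (\<forall>e>0. \<exists>\<alpha>\<in>test_forms A. dist_form \<mu> \<gamma> \<alpha> < ennreal e)"

lemma borel_form_fsub: "borel_form A \<alpha> \<Longrightarrow> borel_form A \<beta> \<Longrightarrow> borel_form A (fsub \<alpha> \<beta>)"
  by (intro borel_form_fadd borel_form_fscale) auto

lemma fnm_fsub_triangle: "fnm (fsub \<alpha> \<gamma>) x \<le> fnm (fsub \<alpha> \<beta>) x + fnm (fsub \<beta> \<gamma>) x"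
proof -
  have "fsub \<alpha> \<gamma> = fadd (fsub \<alpha> \<beta>) (fsub \<beta> \<gamma>)"
    by (simp add: fadd_def fscale_def fun_eq_iff vec_eq_iff)
  then show ?thesis using fnm_triangle by metis
qed

context
  fixes \<mu> :: "'a measure"
  assumes sets_mu[measurable_cong, simp]: "sets \<mu> = sets borel" and fin_mu: "finite_measure \<mu>"
begin

lemma measurable_mu[simp]: "borel_measurable \<mu> = borel_measurable borel"
  by (rule measurable_cong_sets) simp_all

lemma measurable_fnm_fsub: "borel_form A \<alpha> \<Longrightarrow> borel_form A \<beta> \<Longrightarrow> fnm (fsub \<alpha> \<beta>) \<in> borel_measurable borel"
  by (intro measurable_fnm borel_form_fsub)

lemma dist_form_triangle:
  assumes "borel_form A \<alpha>" "borel_form A \<beta>" "borel_form A \<gamma>"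
  shows "dist_form \<mu> \<alpha> \<gamma> \<le> dist_form \<mu> \<alpha> \<beta> + dist_form \<mu> \<beta> \<gamma>"
proof -
  have [measurable]: "fnm (fsub \<alpha> \<beta>) \<in> borel_measurable borel" "fnm (fsub \<beta> \<gamma>) \<in> borel_measurable borel"
    by (intro measurable_fnm_fsub assms)+
  have "ennreal (min 1 (fnm (fsub \<alpha> \<gamma>) x)) \<le> ennreal (min 1 (fnm (fsub \<alpha> \<beta>) x)) + ennreal (min 1 (fnm (fsub \<beta> \<gamma>) x))" for x
  proof -
    have "min 1 (fnm (fsub \<alpha> \<gamma>) x) \<le> min 1 (fnm (fsub \<alpha> \<beta>) x) + min 1 (fnm (fsub \<beta> \<gamma>) x)"
      using fnm_fsub_triangle[of \<alpha> \<gamma> x \<beta>] fnm_nonneg[of "fsub \<alpha> \<beta>" x] fnm_nonneg[of "fsub \<beta> \<gamma>" x]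
      by linarith
    from ennreal_leI[OF this] show ?thesis by (simp add: ennreal_plus)
  qed
  then have "dist_form \<mu> \<alpha> \<gamma> \<le> (\<integral>\<^sup>+x. ennreal (min 1 (fnm (fsub \<alpha> \<beta>) x)) + ennreal (min 1 (fnm (fsub \<beta> \<gamma>) x)) \<partial>\<mu>)"
    unfolding dist_form_def by (rule nn_integral_mono)
  also have "\<dots> = dist_form \<mu> \<alpha> \<beta> + dist_form \<mu> \<beta> \<gamma>"
    unfolding dist_form_def by (rule nn_integral_add) measurable
  finally show ?thesis .
qed

section \<open>Closure properties of the approximable forms\<close>

lemma approx_test:
  assumes "\<alpha> \<in> test_forms A"
  shows "approx \<mu> \<alpha>"
proof -
  have "fnm (fsub \<alpha> \<alpha>) x = 0" for x
    by (simp add: fnm_hnorm fadd_def fscale_def hnorm_eq_0 pos_def_at)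
  then have "dist_form \<mu> \<alpha> \<alpha> = 0" by (simp add: dist_form_def)
  then show ?thesis
    unfolding approx_def using assms test_form_borel by (intro conjI allI impI bexI[of _ \<alpha>]) auto
qed

lemma approx_near:
  assumes \<gamma>: "borel_form A \<gamma>" and near: "\<And>e. e > 0 \<Longrightarrow> \<exists>\<beta>. approx \<mu> \<beta> \<and> dist_form \<mu> \<gamma> \<beta> < ennreal e"
  shows "approx \<mu> \<gamma>"
  unfolding approx_def
proof (intro conjI allI impI \<gamma>)
  fix e :: real assume "e > 0"
  then obtain \<beta> where \<beta>: "approx \<mu> \<beta>" "dist_form \<mu> \<gamma> \<beta> < ennreal (e / 2)"
    using near[of "e / 2"] by auto
  then obtain \<alpha> where \<alpha>: "\<alpha> \<in> test_forms A" "dist_form \<mu> \<beta> \<alpha> < ennreal (e / 2)"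
    using \<open>e > 0\<close> unfolding approx_def by (meson half_gt_zero)
  have "dist_form \<mu> \<gamma> \<alpha> \<le> dist_form \<mu> \<gamma> \<beta> + dist_form \<mu> \<beta> \<alpha>"
    using \<beta> by (intro dist_form_triangle[OF \<gamma> _ test_form_borel[OF \<alpha>(1)]]) (simp add: approx_def)
  then have "dist_form \<mu> \<gamma> \<alpha> < ennreal e"
    using \<beta>(2) \<alpha>(2) \<open>e > 0\<close> by (rule less_ennreal_halves)
  then show "\<exists>\<alpha>\<in>test_forms A. dist_form \<mu> \<gamma> \<alpha> < ennreal e" using \<alpha> by blast
qed

lemma approx_add:
  assumes "approx \<mu> \<alpha>" "approx \<mu> \<beta>"
  shows "approx \<mu> (fadd \<alpha> \<beta>)"
proof (rule approx_near)
  have b: "borel_form A \<alpha>" "borel_form A \<beta>" using assms by (simp_all add: approx_def)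
  then show "borel_form A (fadd \<alpha> \<beta>)" by (rule borel_form_fadd)
  fix e :: real assume "e > 0"
  then obtain \<alpha>' \<beta>' where t: "\<alpha>' \<in> test_forms A" "\<beta>' \<in> test_forms A"
    and d: "dist_form \<mu> \<alpha> \<alpha>' < ennreal (e / 2)" "dist_form \<mu> \<beta> \<beta>' < ennreal (e / 2)"
    using assms unfolding approx_def by (meson half_gt_zero)
  have shift: "dist_form \<mu> (fadd \<gamma> \<delta>) (fadd \<gamma>' \<delta>) = dist_form \<mu> \<gamma> \<gamma>'" for \<gamma> \<gamma>' \<delta>
  proof -
    have "fsub (fadd \<gamma> \<delta>) (fadd \<gamma>' \<delta>) = fsub \<gamma> \<gamma>'"
      by (simp add: fadd_def fscale_def fun_eq_iff vec_eq_iff)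
    then show ?thesis by (simp add: dist_form_def)
  qed
  have shift': "dist_form \<mu> (fadd \<delta> \<gamma>) (fadd \<delta> \<gamma>') = dist_form \<mu> \<gamma> \<gamma>'" for \<gamma> \<gamma>' \<delta>
  proof -
    have "fsub (fadd \<delta> \<gamma>) (fadd \<delta> \<gamma>') = fsub \<gamma> \<gamma>'"
      by (simp add: fadd_def fscale_def fun_eq_iff vec_eq_iff)
    then show ?thesis by (simp add: dist_form_def)
  qed
  have "dist_form \<mu> (fadd \<alpha> \<beta>) (fadd \<alpha>' \<beta>') \<le> dist_form \<mu> (fadd \<alpha> \<beta>) (fadd \<alpha>' \<beta>) + dist_form \<mu> (fadd \<alpha>' \<beta>) (fadd \<alpha>' \<beta>')"
    by (intro dist_form_triangle borel_form_fadd b test_form_borel t)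
  then have "dist_form \<mu> (fadd \<alpha> \<beta>) (fadd \<alpha>' \<beta>') < ennreal e"
    unfolding shift shift' using d \<open>e > 0\<close> by (rule less_ennreal_halves)
  then show "\<exists>\<beta>''. approx \<mu> \<beta>'' \<and> dist_form \<mu> (fadd \<alpha> \<beta>) \<beta>'' < ennreal e"
    using approx_test[OF test_form_fadd[OF t]] by blast
qed

lemma approx_scale:
  assumes "approx \<mu> \<alpha>"
  shows "approx \<mu> (fscale (\<lambda>_. k) \<alpha>)"
proof (rule approx_near)
  have b: "borel_form A \<alpha>" using assms by (simp add: approx_def)
  then show "borel_form A (fscale (\<lambda>_. k) \<alpha>)" by (intro borel_form_fscale) auto
  fix e :: real assume "e > 0"
  \<comment> \<open>The maximum with 1 makes min 1 (|k| t) <= C min 1 t true for all t >= 0, also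
    when |k| < 1, and keeps the divisor in e/C positive.\<close>
  define C where "C = max 1 (cmod k)"
  have C: "1 \<le> C" "cmod k \<le> C" by (auto simp: C_def)
  then obtain \<beta> where \<beta>: "\<beta> \<in> test_forms A" "dist_form \<mu> \<alpha> \<beta> < ennreal (e / C)"
    using \<open>e > 0\<close> assms unfolding approx_def by (meson divide_pos_pos less_le_trans zero_less_one)
  have [measurable]: "fnm (fsub \<alpha> \<beta>) \<in> borel_measurable borel"
    by (intro measurable_fnm_fsub b test_form_borel \<beta>)
  have "fsub (fscale (\<lambda>_. k) \<alpha>) (fscale (\<lambda>_. k) \<beta>) = fscale (\<lambda>_. k) (fsub \<alpha> \<beta>)"
    by (simp add: fadd_def fscale_def fun_eq_iff vec_eq_iff algebra_simps)
  then have f: "fnm (fsub (fscale (\<lambda>_. k) \<alpha>) (fscale (\<lambda>_. k) \<beta>)) x = cmod k * fnm (fsub \<alpha> \<beta>) x" for x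
    by (simp add: fnm_scale)
  have "min 1 (cmod k * t) \<le> C * min 1 t" if "0 \<le> t" for t
    using C that mult_right_mono[OF C(2) that] by (cases "t \<le> 1") (auto simp: min_def)
  then have "ennreal (min 1 (cmod k * fnm (fsub \<alpha> \<beta>) x)) \<le> ennreal C * ennreal (min 1 (fnm (fsub \<alpha> \<beta>) x))" for x
    using C by (subst ennreal_mult[symmetric]) (auto intro!: ennreal_leI)
  then have "dist_form \<mu> (fscale (\<lambda>_. k) \<alpha>) (fscale (\<lambda>_. k) \<beta>) \<le> (\<integral>\<^sup>+x. ennreal C * ennreal (min 1 (fnm (fsub \<alpha> \<beta>) x)) \<partial>\<mu>)"
    unfolding dist_form_def f by (rule nn_integral_mono)
  also have "\<dots> = ennreal C * dist_form \<mu> \<alpha> \<beta>"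
    unfolding dist_form_def by (rule nn_integral_cmult) measurable
  also have "\<dots> < ennreal C * ennreal (e / C)"
    using \<beta>(2) C by (intro ennreal_mult_strict_left_mono) auto
  also have "\<dots> = ennreal e"
    using C \<open>e > 0\<close> by (simp add: ennreal_mult[symmetric])
  finally show "\<exists>\<beta>. approx \<mu> \<beta> \<and> dist_form \<mu> (fscale (\<lambda>_. k) \<alpha>) \<beta> < ennreal e"
    using approx_test[OF test_form_fscale[OF \<beta>(1) smooth_fun_const]] by blast
qed

text \<open>The truncated distances are bounded by 1, which is integrable for a finite measure, so
  pointwise convergence yields convergence in \<open>dist_form\<close>.\<close>

lemma approx_limit:
  assumes \<gamma>: "borel_form A \<gamma>" and a: "\<And>k. approx \<mu> (\<alpha> k)"
    and lim: "\<And>x. (\<lambda>k. fnm (fsub \<gamma> (\<alpha> k)) x) \<longlonglongrightarrow> 0"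
  shows "approx \<mu> \<gamma>"
proof (rule approx_near[OF \<gamma>])
  fix e :: real assume "e > 0"
  have [measurable]: "fnm (fsub \<gamma> (\<alpha> k)) \<in> borel_measurable borel" for k
    using a by (intro measurable_fnm_fsub \<gamma>) (simp add: approx_def)
  have "(\<lambda>k. dist_form \<mu> \<gamma> (\<alpha> k)) \<longlonglongrightarrow> (\<integral>\<^sup>+x. 0 \<partial>\<mu>)"
    unfolding dist_form_def
  proof (rule nn_integral_dominated_convergence[where w = "\<lambda>_. 1"])
    show "(\<integral>\<^sup>+x. 1 \<partial>\<mu>) < \<infinity>"
      using finite_measure.emeasure_finite[OF fin_mu] by (simp add: less_top[symmetric])
    show "AE x in \<mu>. (\<lambda>k. ennreal (min 1 (fnm (fsub \<gamma> (\<alpha> k)) x))) \<longlonglongrightarrow> 0"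
    proof (rule AE_I2)
      fix x
      have "(\<lambda>k. ennreal (min 1 (fnm (fsub \<gamma> (\<alpha> k)) x))) \<longlonglongrightarrow> ennreal (min 1 0)"
        by (intro tendsto_ennrealI tendsto_min tendsto_const lim)
      then show "(\<lambda>k. ennreal (min 1 (fnm (fsub \<gamma> (\<alpha> k)) x))) \<longlonglongrightarrow> 0" by simp
    qed
  qed (auto intro!: AE_I2 simp: ennreal_le_1)
  then have "\<forall>\<^sub>F k in sequentially. dist_form \<mu> \<gamma> (\<alpha> k) < ennreal e"
    using \<open>e > 0\<close> by (intro order_tendstoD) auto
  then show "\<exists>\<beta>. approx \<mu> \<beta> \<and> dist_form \<mu> \<gamma> \<beta> < ennreal e"
    using a by (auto simp: eventually_sequentially)
qed

lemma approx_fscale_limit: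
  assumes \<omega>: "\<omega> \<in> test_forms A" and a: "\<And>k. approx \<mu> (fscale (u k) \<omega>)"
    and v: "v \<in> borel_measurable borel" and lim: "\<And>x. (\<lambda>k. u k x) \<longlonglongrightarrow> v x"
  shows "approx \<mu> (fscale v \<omega>)"
proof (rule approx_limit[OF _ a])
  show "borel_form A (fscale v \<omega>)" by (intro borel_form_fscale v test_form_borel \<omega>)
  fix x
  have "fsub (fscale v \<omega>) (fscale (u k) \<omega>) = fscale (\<lambda>x. v x - u k x) \<omega>" for k
    by (simp add: fadd_def fscale_def fun_eq_iff vec_eq_iff algebra_simps)
  then have eq: "fnm (fsub (fscale v \<omega>) (fscale (u k) \<omega>)) x = cmod (v x - u k x) * fnm \<omega> x" for k
    by (simp add: fnm_scale)
  have "(\<lambda>k. cmod (v x - u k x) * fnm \<omega> x) \<longlonglongrightarrow> cmod (v x - v x) * fnm \<omega> x"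
    by (intro tendsto_intros lim)
  then show "(\<lambda>k. fnm (fsub (fscale v \<omega>) (fscale (u k) \<omega>)) x) \<longlonglongrightarrow> 0"
    by (simp add: eq)
qed

lemma open_approx:
  assumes \<omega>: "\<omega> \<in> test_forms A" and S: "open S"
  shows "approx \<mu> (fscale (indicator S) \<omega>)"
proof (cases "S = {}")
  case True
  then have "fscale (indicator S) \<omega> = fscale (\<lambda>_. 0) \<omega>"
    by (simp add: fscale_def fun_eq_iff)
  then show ?thesis by (simp add: approx_test test_form_fscale[OF \<omega> smooth_fun_const])
next
  case False
  define good where "good b U \<longleftrightarrow> (\<lambda>x. complex_of_real (b x)) \<in> test_functions A \<and> open U \<and> U \<subseteq> S \<and>
      (\<forall>z\<in>U. b z = 1) \<and> (\<forall>z. z \<notin> S \<longrightarrow> b z = 0)" for b :: "'a \<Rightarrow> real" and U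
  have ex: "\<exists>U b. x \<in> U \<and> good b U" if "x \<in> S" for x
  proof -
    obtain b U K where *: "(\<lambda>x. complex_of_real (b x)) \<in> test_functions A" "open U" "x \<in> U" "\<And>z. z \<in> U \<Longrightarrow> b z = 1"
      "K \<subseteq> S" "\<And>z. z \<notin> K \<Longrightarrow> b z = 0"
      using bump_exists[OF chart_at S \<open>x \<in> S\<close>] by metis
    have "U \<subseteq> K" using *(4,6) by fastforce
    then have "good b U" unfolding good_def using * by blast
    then show ?thesis using *(3) by blast
  qed
  obtain U :: "nat \<Rightarrow> 'a set" where U: "\<And>k. \<exists>b. good b (U k)" "(\<Union>k. U k) = S"
  proof (rule Lindelof_sequence[OF False, of "\<lambda>U. \<exists>b. good b U"])
    show "\<exists>U. open U \<and> x \<in> U \<and> U \<subseteq> S \<and> (\<exists>b. good b U)" if "x \<in> S" for x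
      using ex[OF that] unfolding good_def by blast
  next
    fix U :: "nat \<Rightarrow> 'a set" assume U: "\<And>k. \<exists>b. good b (U k)" "(\<Union>k. U k) = S"
    show thesis by (rule that[of U]) (fact U)+
  qed
  then obtain b where b: "\<And>k. good (b k) (U k)" by metis
  \<comment> \<open>\<open>\<phi> m\<close> stays 0 outside \<open>S\<close>, where every bump is 0,
    and equals 1 on \<open>U k\<close> as soon as m > k, where one factor of the product vanishes.
    Hence it converges pointwise to the indicator of \<open>S\<close>.\<close>
  define \<phi> where "\<phi> m x = 1 - (\<Prod>j<m. 1 - complex_of_real (b j x))" for m :: nat and x
  have prod: "smooth_fun A (\<lambda>x. \<Prod>j<m. 1 - complex_of_real (b j x))" for m :: nat
  proof (induction m)
    case (Suc m)
    have "smooth_fun A (\<lambda>x. 1 - complex_of_real (b m x))"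
      using b[of m] unfolding good_def by (intro smooth_fun_diff smooth_fun_const) (auto dest: test_functionD)
    from smooth_fun_mult[OF Suc this] show ?case by simp
  qed (simp add: smooth_fun_const)
  show ?thesis
  proof (rule approx_fscale_limit[OF \<omega>, where u = \<phi>])
    have "smooth_fun A (\<phi> m)" for m
      unfolding \<phi>_def by (intro smooth_fun_diff smooth_fun_const prod)
    then show "approx \<mu> (fscale (\<phi> m) \<omega>)" for m by (intro approx_test test_form_fscale \<omega>)
    show "indicator S \<in> borel_measurable borel"
      by (rule borel_measurable_indicator) (simp add: S)
    show "(\<lambda>m. \<phi> m x) \<longlonglongrightarrow> indicator S x" for x
    proof (cases "x \<in> S")
      case True
      then obtain k where "x \<in> U k" using U(2) by blast
      then have "b k x = 1" using b[of k] unfolding good_def by blast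
      then have "\<phi> m x = 1" if "k < m" for m
        using that by (auto simp: \<phi>_def intro!: prod_zero bexI[of _ k])
      then have "\<forall>\<^sub>F m in sequentially. \<phi> m x = indicator S x"
        using True by (intro eventually_mono[OF eventually_gt_at_top[of k]]) simp
      then show ?thesis by (rule tendsto_eventually)
    next
      case False
      then have "b k x = 0" for k using b[of k] unfolding good_def by blast
      then show ?thesis using False by (simp add: \<phi>_def)
    qed
  qed
qed

text \<open>A Dynkin argument: the open sets are stable under intersection and generate the Borel
  sets; complements and countable disjoint unions are covered because approximability is linear and
  closed under pointwise limits.\<close>

lemma borel_set_approx:
  assumes \<omega>: "\<omega> \<in> test_forms A" and B: "B \<in> sets borel"
  shows "approx \<mu> (fscale (indicator B) \<omega>)"
proof -
  have "Int_stable {S :: 'a set. open S}" by (auto simp: Int_stable_def)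
  moreover have "{S :: 'a set. open S} \<subseteq> Pow UNIV" by simp
  moreover have "B \<in> sigma_sets UNIV {S. open S}" using B by (simp add: sets_borel)
  ultimately show ?thesis
  proof (induction rule: sigma_sets_induct_disjoint)
    case (basic B)
    then show ?case by (auto intro: open_approx \<omega>)
  next
    case empty
    show ?case by (rule open_approx[OF \<omega>]) simp
  next
    case (compl B)
    have "fscale (indicator (UNIV - B)) \<omega> = fadd \<omega> (fscale (\<lambda>_. - 1) (fscale (indicator B) \<omega>))"
      by (auto simp: fadd_def fscale_def fun_eq_iff vec_eq_iff indicator_def)
    then show ?case using approx_add[OF approx_test[OF \<omega>] approx_scale[OF compl(2)]] by simp
  next
    case (union F)
    have F: "F k \<in> sets borel" for k using union(2) by (auto simp: sets_borel)
    have part: "approx \<mu> (fscale (indicator (\<Union>i<m. F i)) \<omega>)" for m :: nat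
    proof (induction m)
      case 0
      show ?case using approx_test[OF test_form_fscale[OF \<omega> smooth_fun_const[of 0]]] by simp
    next
      case (Suc m)
      have "F i \<inter> F m = {}" if "i < m" for i
        using that by (intro disjoint_family_onD[OF union(1)]) auto
      then have "disjnt (\<Union>i<m. F i) (F m)" by (auto simp: disjnt_def)
      then have "fscale (indicator (\<Union>i<Suc m. F i)) \<omega> = fadd (fscale (indicator (\<Union>i<m. F i)) \<omega>) (fscale (indicator (F m)) \<omega>)"
        by (auto simp: fadd_def fscale_def fun_eq_iff vec_eq_iff indicator_def lessThan_Suc disjnt_iff)
      then show ?case using approx_add[OF Suc union(3)] by simp
    qed
    show ?case
    proof (rule approx_fscale_limit[OF \<omega> part])
      show "indicator (\<Union>i. F i) \<in> borel_measurable borel" using F by measurable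
      show "(\<lambda>m. indicator (\<Union>i<m. F i) x) \<longlonglongrightarrow> (indicator (\<Union>i. F i) x :: complex)" for x
      proof (cases "x \<in> (\<Union>i. F i)")
        case True
        then obtain k where "x \<in> F k" by auto
        then have "\<forall>\<^sub>F m in sequentially. indicator (\<Union>i<m. F i) x = (indicator (\<Union>i. F i) x :: complex)"
          by (intro eventually_mono[OF eventually_gt_at_top[of k]]) (auto simp: indicator_def)
        then show ?thesis by (rule tendsto_eventually)
      qed auto
    qed
  qed
qed

text \<open>Borel functions are pointwise limits of simple functions, which are finite combinations
  of indicators.\<close>

lemma borel_fscale_approx:
  assumes \<omega>: "\<omega> \<in> test_forms A" and u: "u \<in> borel_measurable borel"
  shows "approx \<mu> (fscale u \<omega>)"
proof -
  obtain s where s: "\<And>k. simple_function borel (s k)" "\<And>x. (\<lambda>k. s k x) \<longlonglongrightarrow> u x"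
    using borel_measurable_implies_sequence_metric[OF u, of 0] by auto
  show ?thesis
  proof (rule approx_fscale_limit[OF \<omega> _ u s(2)])
    fix k
    define B where "B y = s k -` {y}" for y
    have fin: "finite (range (s k))" using simple_functionD(1)[OF s(1)[of k]] by simp
    have meas: "B y \<in> sets borel" for y using simple_functionD(2)[OF s(1)[of k], of "{y}"] by (simp add: B_def)
    have sum: "approx \<mu> (fscale (\<lambda>x. \<Sum>y\<in>Y. y * indicator (B y) x) \<omega>)" if "finite Y" for Y :: "complex set"
      using that
    proof (induction Y)
      case empty
      show ?case using approx_test[OF test_form_fscale[OF \<omega> smooth_fun_const[of 0]]] by simp
    next
      case (insert y Y)
      have "fscale (\<lambda>x. \<Sum>y\<in>insert y Y. y * indicator (B y) x) \<omega> =
          fadd (fscale (\<lambda>_. y) (fscale (indicator (B y)) \<omega>)) (fscale (\<lambda>x. \<Sum>y\<in>Y. y * indicator (B y) x) \<omega>)"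
        unfolding sum.insert[OF insert(1,2)]
        by (simp add: fadd_def fscale_def fun_eq_iff vec_eq_iff distrib_right mult.assoc del: sum_mult_indicator)
      then show ?case
        using approx_add[OF approx_scale[OF borel_set_approx[OF \<omega> meas]] insert(3)] by simp
    qed
    have "s k x = (\<Sum>y\<in>range (s k). y * indicator (B y) x)" for x
    proof -
      have "(\<Sum>y\<in>range (s k). y * indicator (B y) x) = (\<Sum>y\<in>range (s k). if y = s k x then y else 0)"
        by (intro sum.cong) (auto simp: B_def indicator_def)
      also have "\<dots> = s k x" using fin by simp
      finally show ?thesis ..
    qed
    then have "s k = (\<lambda>x. \<Sum>y\<in>range (s k). y * indicator (B y) x)" by (rule ext)
    then show "approx \<mu> (fscale (s k) \<omega>)" using sum[OF fin] by metis
  qed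
qed

lemma approx_sum:
  assumes "finite I" "\<And>i. i \<in> I \<Longrightarrow> approx \<mu> (\<alpha> i)"
  shows "approx \<mu> (\<lambda>c x. \<Sum>i\<in>I. \<alpha> i c x)"
  using assms
proof (induction I)
  case empty
  have "(\<lambda>c x. 0) \<in> test_forms A"
    by (rule test_formI) (simp_all add: is_form_def form_support_def smooth_on_const)
  then show ?case by (simp add: approx_test)
next
  case (insert i I)
  have "(\<lambda>c x. \<Sum>i\<in>insert i I. \<alpha> i c x) = fadd (\<alpha> i) (\<lambda>c x. \<Sum>i\<in>I. \<alpha> i c x)"
    using insert(1,2) by (simp add: fadd_def fun_eq_iff)
  then show ?case using insert approx_add by simp
qed

text \<open>Cut \<gamma> along a countable Borel partition whose pieces carry local frames. On each
  piece it is a combination of test forms with Borel coefficients, and at every point the partial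
  sums eventually equal \<gamma>.\<close>

lemma borel_form_approx:
  assumes \<gamma>: "borel_form A \<gamma>"
  shows "approx \<mu> \<gamma>"
proof -
  define good where "good U c \<omega> \<longleftrightarrow> c \<in> A \<and> open U \<and> U \<subseteq> fst c \<and> (\<forall>i. \<omega> i \<in> test_forms A) \<and>
      (\<forall>i. \<forall>z\<in>U. \<omega> i c z = axis i 1)" for U c and \<omega> :: "'n \<Rightarrow> ('a, 'n) form"
  obtain U :: "nat \<Rightarrow> 'a set" where U: "\<And>k. \<exists>c \<omega>. good (U k) c \<omega>" "(\<Union>k. U k) = UNIV"
  proof (rule Lindelof_sequence[OF UNIV_not_empty, of "\<lambda>U. \<exists>c \<omega>. good U c \<omega>"])
    show "\<exists>U. open U \<and> x \<in> U \<and> U \<subseteq> UNIV \<and> (\<exists>c \<omega>. good U c \<omega>)" for x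
    proof -
      obtain c \<omega> U where "x \<in> U" "good U c \<omega>" unfolding good_def using local_frame[of x] by metis
      then show ?thesis unfolding good_def by blast
    qed
  next
    fix U :: "nat \<Rightarrow> 'a set" assume U: "\<And>k. \<exists>c \<omega>. good (U k) c \<omega>" "(\<Union>k. U k) = UNIV"
    show thesis by (rule that[of U]) (fact U)+
  qed
  then obtain C \<omega> where *: "\<And>k. good (U k) (C k) (\<omega> k)" by metis
  have C: "C k \<in> A" "open (U k)" "U k \<subseteq> fst (C k)" "\<omega> k i \<in> test_forms A"
    "z \<in> U k \<Longrightarrow> \<omega> k i (C k) z = axis i 1" for k i z
    using *[of k] unfolding good_def by blast+
  define E where "E = disjointed U"
  have E: "E k \<in> sets borel" "E k \<subseteq> U k" "(\<Union>k. E k) = UNIV" "disjoint_family E" for k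
  proof -
    show "E k \<in> sets borel" using C(2) by (auto simp: E_def disjointed_def)
    show "E k \<subseteq> U k" unfolding E_def by (rule disjointed_subset)
    show "(\<Union>k. E k) = UNIV" using U(2) by (simp add: E_def UN_disjointed_eq)
    show "disjoint_family E" unfolding E_def by (rule disjoint_family_disjointed)
  qed
  \<comment> \<open>Cutting the coefficients off at \<open>E k\<close> makes them Borel on the whole
    manifold, although \<open>\<gamma> (C k)\<close> is meaningful only on its chart domain.\<close>
  define u where "u k i x = indicator (E k) x * \<gamma> (C k) x $ i" for k i x
  have u: "u k i \<in> borel_measurable borel" for k i
  proof -
    have "(\<lambda>x. indicator (fst (C k)) x *\<^sub>R \<gamma> (C k) x $ i) \<in> borel_measurable borel"
      using borel_formD(2)[OF \<gamma> C(1)] open_dom[OF C(1)]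
      by (subst borel_measurable_restrict_space_iff[symmetric]) auto
    then have "(\<lambda>x. indicator (E k) x * (indicator (fst (C k)) x *\<^sub>R \<gamma> (C k) x $ i)) \<in> borel_measurable borel"
      using E(1) by measurable
    moreover have "(\<lambda>x. indicator (E k) x * (indicator (fst (C k)) x *\<^sub>R \<gamma> (C k) x $ i)) = u k i"
      using E(2)[of k] C(3)[of k] by (auto simp: u_def indicator_def fun_eq_iff)
    ultimately show ?thesis by simp
  qed
  define \<beta> where "\<beta> m c x = (\<Sum>k<m. \<Sum>i\<in>UNIV. fscale (u k i) (\<omega> k i) c x)" for m :: nat and c x
  have \<beta>: "approx \<mu> (\<beta> m)" for m
    unfolding \<beta>_def by (intro approx_sum borel_fscale_approx C u) auto
  show ?thesis
  proof (rule approx_limit[OF \<gamma> \<beta>])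
    fix x
    obtain k where k: "x \<in> E k" using E(3) by blast
    have xU: "x \<in> U k" and xC: "x \<in> fst (C k)" using k E(2)[of k] C(3)[of k] by auto
    have uz: "u j i x = 0" if "j \<noteq> k" for i j
    proof -
      have "x \<notin> E j" using E(4) k that unfolding disjoint_family_on_def by blast
      then show ?thesis by (simp add: u_def)
    qed
    have "fnm (fsub \<gamma> (\<beta> m)) x = 0" if "k < m" for m
    proof -
      have "\<beta> m (C k) x = (\<Sum>j<m. if j = k then \<Sum>i\<in>UNIV. fscale (u k i) (\<omega> k i) (C k) x else 0)"
        unfolding \<beta>_def by (intro sum.cong) (auto simp: fscale_def uz)
      also have "\<dots> = (\<Sum>i\<in>UNIV. (\<gamma> (C k) x $ i) *s axis i 1)"
        using that k by (simp add: fscale_def C(5)[OF xU] u_def)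
      also have "\<dots> = \<gamma> (C k) x" by (rule basis_expansion)
      finally have "fsub \<gamma> (\<beta> m) (C k) x = 0" by (simp add: fadd_def fscale_def)
      moreover have "is_form A (fsub \<gamma> (\<beta> m))"
        using \<beta>[of m] by (intro is_form_fadd is_form_fscale borel_formD \<gamma>) (simp add: approx_def)
      ultimately show ?thesis
        using fnm_chart[OF C(1) xC] hnorm_eq_0[OF pos_def_ginv[OF C(1) xC]] by simp
    qed
    then have "\<forall>\<^sub>F m in sequentially. fnm (fsub \<gamma> (\<beta> m)) x = 0"
      by (rule eventually_mono[OF eventually_gt_at_top[of k]])
    then show "(\<lambda>m. fnm (fsub \<gamma> (\<beta> m)) x) \<longlonglongrightarrow> 0" by (rule tendsto_eventually)
  qed
qed

text \<open>Errors 2^(-k) are summable, so the truncated distances have a finite sum almost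
  everywhere and tend to 0 there; this upgrades convergence in measure.\<close>

lemma test_forms_dense:
  assumes \<gamma>: "borel_form A \<gamma>"
  obtains \<alpha> :: "nat \<Rightarrow> ('a, 'n) form" where "\<And>k. \<alpha> k \<in> test_forms A"
    "AE x in \<mu>. (\<lambda>k. fnm (fsub \<gamma> (\<alpha> k)) x) \<longlonglongrightarrow> 0"
proof -
  have "\<exists>\<alpha>\<in>test_forms A. dist_form \<mu> \<gamma> \<alpha> < ennreal ((1/2) ^ k)" for k :: nat
    using borel_form_approx[OF \<gamma>] unfolding approx_def by simp
  then obtain \<alpha> where \<alpha>: "\<And>k. \<alpha> k \<in> test_forms A" "\<And>k. dist_form \<mu> \<gamma> (\<alpha> k) < ennreal ((1/2) ^ k)"
    by metis
  have [measurable]: "fnm (fsub \<gamma> (\<alpha> k)) \<in> borel_measurable borel" for k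
    by (intro measurable_fnm_fsub \<gamma> test_form_borel \<alpha>)
  have "(\<integral>\<^sup>+x. (\<Sum>k. ennreal (min 1 (fnm (fsub \<gamma> (\<alpha> k)) x))) \<partial>\<mu>) = (\<Sum>k. dist_form \<mu> \<gamma> (\<alpha> k))"
    unfolding dist_form_def by (rule nn_integral_suminf) measurable
  also have "\<dots> \<le> (\<Sum>k. ennreal ((1/2) ^ k))"
    using \<alpha>(2) by (intro suminf_le) (auto intro: less_imp_le)
  also have "\<dots> = ennreal (\<Sum>k. (1/2) ^ k)"
    by (intro suminf_ennreal2) (auto intro: summable_geometric)
  also have "\<dots> < \<infinity>" by simp
  finally have "AE x in \<mu>. (\<Sum>k. ennreal (min 1 (fnm (fsub \<gamma> (\<alpha> k)) x))) \<noteq> \<infinity>"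
    by (intro nn_integral_PInf_AE) auto
  then have "AE x in \<mu>. (\<lambda>k. fnm (fsub \<gamma> (\<alpha> k)) x) \<longlonglongrightarrow> 0"
  proof eventually_elim
    case (elim x)
    then have "summable (\<lambda>k. min 1 (fnm (fsub \<gamma> (\<alpha> k)) x))"
      by (intro summable_suminf_not_top) auto
    then have lim: "(\<lambda>k. min 1 (fnm (fsub \<gamma> (\<alpha> k)) x)) \<longlonglongrightarrow> 0"
      by (rule summable_LIMSEQ_zero)
    then have "\<forall>\<^sub>F k in sequentially. min 1 (fnm (fsub \<gamma> (\<alpha> k)) x) < 1"
      by (rule order_tendstoD) simp
    then have "\<forall>\<^sub>F k in sequentially. min 1 (fnm (fsub \<gamma> (\<alpha> k)) x) = fnm (fsub \<gamma> (\<alpha> k)) x"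
      by (auto elim!: eventually_mono simp: min_def split: if_splits)
    then show ?case using lim by (rule Lim_transform_eventually[rotated])
  qed
  then show ?thesis using \<alpha>(1) that by blast
qed

text \<open>Normalise by \<open>\<alpha> \<mapsto> 2 \<alpha> / (1 + |\<alpha>|\<^sup>2)\<close>: smooth, of norm at most 1, and the identity where \<open>|\<alpha>| = 1\<close>.\<close>

lemma unit_test_forms_dense:
  assumes \<gamma>: "borel_form A \<gamma>" and unit: "\<And>x. fnm \<gamma> x = 0 \<or> fnm \<gamma> x = 1"
  obtains \<alpha> :: "nat \<Rightarrow> ('a, 'n) form" where "\<And>k. \<alpha> k \<in> test_forms A" "\<And>k x. fnm (\<alpha> k) x \<le> 1"
    "AE x in \<mu>. (\<lambda>k. fnm (fsub \<gamma> (\<alpha> k)) x) \<longlonglongrightarrow> 0"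
proof -
  obtain \<alpha> :: "nat \<Rightarrow> ('a, 'n) form" where \<alpha>: "\<And>k. \<alpha> k \<in> test_forms A"
    and lim: "AE x in \<mu>. (\<lambda>k. fnm (fsub \<gamma> (\<alpha> k)) x) \<longlonglongrightarrow> 0"
    using test_forms_dense[OF \<gamma>] by blast
  define s where "s k x = 2 / (1 + (fnm (\<alpha> k) x)\<^sup>2)" for k x
  define \<beta> where "\<beta> k = fscale (\<lambda>x. of_real (s k x)) (\<alpha> k)" for k
  have pos: "0 < 1 + t\<^sup>2" for t :: real using zero_le_power2[of t] by linarith
  have s: "0 \<le> s k x" "s k x \<le> 2" for k x
    using pos[of "fnm (\<alpha> k) x"] by (auto simp: s_def divide_le_eq)
  have smooth: "smooth_fun A (\<lambda>x. of_real (s k x))" for k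
  proof (rule smooth_funI)
    fix c assume c: "c \<in> A"
    \<comment> \<open>The norm itself need not be smooth at zeros of the form, but its square
      is.\<close>
    have "smooth_on (img c) (\<lambda>y. Re (fip (\<alpha> k) (\<alpha> k) (chart_inv c y)))"
      by (intro smooth_on_bounded_linear[OF bounded_linear_Re] open_img c smooth_funD[OF smooth_fip] \<alpha>)
    then have q: "smooth_on (img c) (\<lambda>y. (fnm (\<alpha> k) (chart_inv c y))\<^sup>2)"
      by (simp add: fip_self)
    have "smooth_on (img c) (\<lambda>y. complex_of_real (2 * inverse (1 + (fnm (\<alpha> k) (chart_inv c y))\<^sup>2)))"
      by (intro smooth_on_bounded_linear[OF bounded_linear_of_real] smooth_on_mult smooth_on_const
          smooth_on_inverse smooth_on_add q open_img c less_imp_neq[THEN not_sym] pos)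
    then show "smooth_on (img c) (\<lambda>y. complex_of_real (s k (chart_inv c y)))"
      by (simp add: s_def divide_inverse)
  qed
  show ?thesis
  proof (rule that[of \<beta>])
    show "\<beta> k \<in> test_forms A" for k unfolding \<beta>_def by (rule test_form_fscale[OF \<alpha> smooth])
    show "fnm (\<beta> k) x \<le> 1" for k x
    proof -
      have "2 * fnm (\<alpha> k) x \<le> 1 + (fnm (\<alpha> k) x)\<^sup>2"
        using zero_le_power2[of "fnm (\<alpha> k) x - 1"] by (simp add: power2_eq_square algebra_simps)
      then have "s k x * fnm (\<alpha> k) x \<le> 1"
        using pos[of "fnm (\<alpha> k) x"] by (simp add: s_def divide_le_eq)
      moreover have "fnm (\<beta> k) x = s k x * fnm (\<alpha> k) x"
        using s by (simp add: \<beta>_def fnm_scale)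
      ultimately show ?thesis by simp
    qed
    from lim show "AE x in \<mu>. (\<lambda>k. fnm (fsub \<gamma> (\<beta> k)) x) \<longlonglongrightarrow> 0"
    proof eventually_elim
      case (elim x)
      let ?g = "fnm \<gamma> x"
      have "\<bar>fnm (\<alpha> k) x - ?g\<bar> \<le> fnm (fsub \<gamma> (\<alpha> k)) x" for k
      proof -
        have 1: "\<gamma> = fadd (fsub \<gamma> (\<alpha> k)) (\<alpha> k)" and 2: "\<alpha> k = fadd (fsub (\<alpha> k) \<gamma>) \<gamma>"
          by (simp_all add: fadd_def fscale_def fun_eq_iff vec_eq_iff)
        have "?g \<le> fnm (fsub \<gamma> (\<alpha> k)) x + fnm (\<alpha> k) x"
          using fnm_triangle[of "fsub \<gamma> (\<alpha> k)" "\<alpha> k" x] unfolding 1[symmetric] .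
        moreover have "fnm (\<alpha> k) x \<le> fnm (fsub (\<alpha> k) \<gamma>) x + ?g"
          using fnm_triangle[of "fsub (\<alpha> k) \<gamma>" \<gamma> x] unfolding 2[symmetric] .
        ultimately show ?thesis using fnm_sub_commute[of "\<alpha> k" \<gamma> x] by linarith
      qed
      then have "(\<lambda>k. fnm (\<alpha> k) x - ?g) \<longlonglongrightarrow> 0"
        by (intro Lim_null_comparison[OF _ elim]) auto
      then have a: "(\<lambda>k. fnm (\<alpha> k) x) \<longlonglongrightarrow> ?g" by (simp add: LIM_zero_iff)
      have "(\<lambda>k. \<bar>1 - 2 / (1 + (fnm (\<alpha> k) x)\<^sup>2)\<bar> * ?g) \<longlonglongrightarrow> \<bar>1 - 2 / (1 + ?g\<^sup>2)\<bar> * ?g"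
        by (intro tendsto_intros a) (use pos[of ?g] in simp)
      \<comment> \<open>The limit |1 - 2/(1 + g^2)| g is 0 because g is either 0 or 1.\<close>
      then have b: "(\<lambda>k. \<bar>1 - s k x\<bar> * ?g) \<longlonglongrightarrow> 0"
        using unit[of x] by (auto simp: s_def)
      have "(\<lambda>k. 2 * fnm (fsub \<gamma> (\<alpha> k)) x + \<bar>1 - s k x\<bar> * ?g) \<longlonglongrightarrow> 2 * 0 + 0"
        by (intro tendsto_intros elim b)
      then have bound: "(\<lambda>k. 2 * fnm (fsub \<gamma> (\<alpha> k)) x + \<bar>1 - s k x\<bar> * ?g) \<longlonglongrightarrow> 0" by simp
      have "fnm (fsub \<gamma> (\<beta> k)) x \<le> 2 * fnm (fsub \<gamma> (\<alpha> k)) x + \<bar>1 - s k x\<bar> * ?g" for k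
      proof -
        \<comment> \<open>Writing \<gamma> - s \<alpha> = s (\<gamma> - \<alpha>) + (1 - s) \<gamma>
          separates the approximation error from the normalisation error; the factor 2 in the bound
          comes from s <= 2.\<close>
        have "fsub \<gamma> (\<beta> k) = fadd (fscale (\<lambda>x. of_real (s k x)) (fsub \<gamma> (\<alpha> k))) (fscale (\<lambda>x. of_real (1 - s k x)) \<gamma>)"
          by (simp add: \<beta>_def fadd_def fscale_def fun_eq_iff vec_eq_iff algebra_simps)
        then have "fnm (fsub \<gamma> (\<beta> k)) x \<le> s k x * fnm (fsub \<gamma> (\<alpha> k)) x + \<bar>1 - s k x\<bar> * ?g"
          using fnm_triangle[of "fscale (\<lambda>x. of_real (s k x)) (fsub \<gamma> (\<alpha> k))" "fscale (\<lambda>x. of_real (1 - s k x)) \<gamma>" x] s[of k x]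
          by (simp add: fnm_scale del: of_real_diff)
        also have "\<dots> \<le> 2 * fnm (fsub \<gamma> (\<alpha> k)) x + \<bar>1 - s k x\<bar> * ?g"
          using s by (intro add_right_mono mult_right_mono) auto
        finally show ?thesis .
      qed
      then show ?case by (intro Lim_null_comparison[OF _ bound]) auto
    qed
  qed
qed

end

end

section \<open>Variation and weak derivatives\<close>

context riemannian
begin

lemma integrable_pairing:
  assumes M: "sets M = sets borel" and \<beta>: "borel_form A \<beta>" "integrable M (fnm \<beta>)" and \<alpha>: "borel_form A \<alpha>"
    and le: "AE x in M. fnm \<alpha> x \<le> C"
  shows "integrable M (fip \<beta> \<alpha>)"
proof (rule Bochner_Integration.integrable_bound)
  show "integrable M (\<lambda>x. C * fnm \<beta> x)" using \<beta>(2) by simp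
  show "fip \<beta> \<alpha> \<in> borel_measurable M"
    using measurable_fip[OF \<beta>(1) \<alpha>] measurable_cong_sets[OF M refl] by blast
  from le show "AE x in M. norm (fip \<beta> \<alpha> x) \<le> norm (C * fnm \<beta> x)"
  proof eventually_elim
    case (elim x)
    have "cmod (fip \<beta> \<alpha> x) \<le> fnm \<beta> x * C"
      using fip_le[of \<beta> \<alpha> x] mult_left_mono[OF elim fnm_nonneg] by (rule order_trans)
    also have "\<dots> \<le> norm (C * fnm \<beta> x)" by (simp add: mult.commute)
    finally show ?case .
  qed
qed

text \<open>The error is at most |\<beta>| |\<gamma> - \<alpha> k|, so convergence matters only
  where \<beta> is nonzero; that is what convergence almost everywhere for the measure with density
  |\<beta>| provides. The pairings are dominated by |\<beta>|.\<close>

lemma pairing_limit: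
  assumes M: "sets M = sets borel" and \<beta>: "borel_form A \<beta>" "integrable M (fnm \<beta>)" and \<gamma>: "borel_form A \<gamma>"
    and \<alpha>: "\<And>k. borel_form A (\<alpha> k)" "\<And>k x. fnm (\<alpha> k) x \<le> 1"
    and lim: "AE x in M. 0 < fnm \<beta> x \<longrightarrow> (\<lambda>k. fnm (fsub \<gamma> (\<alpha> k)) x) \<longlonglongrightarrow> 0"
  shows "(\<lambda>k. \<integral>x. fip \<beta> (\<alpha> k) x \<partial>M) \<longlonglongrightarrow> (\<integral>x. fip \<beta> \<gamma> x \<partial>M)"
proof (rule integral_dominated_convergence[where w = "fnm \<beta>"])
  note bm = measurable_cong_sets[OF M refl]
  show "fip \<beta> \<gamma> \<in> borel_measurable M" "fip \<beta> (\<alpha> k) \<in> borel_measurable M" for k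
    using measurable_fip[OF \<beta>(1)] \<gamma> \<alpha>(1) bm by blast+
  show "integrable M (fnm \<beta>)" by (rule \<beta>(2))
  show "AE x in M. norm (fip \<beta> (\<alpha> k) x) \<le> fnm \<beta> x" for k
  proof (rule AE_I2)
    fix x
    show "norm (fip \<beta> (\<alpha> k) x) \<le> fnm \<beta> x"
      using fip_le[of \<beta> "\<alpha> k" x] mult_left_mono[OF \<alpha>(2)[of k x] fnm_nonneg[of \<beta> x]] by simp
  qed
  from lim show "AE x in M. (\<lambda>k. fip \<beta> (\<alpha> k) x) \<longlonglongrightarrow> fip \<beta> \<gamma> x"
  proof eventually_elim
    case (elim x)
    have null: "(\<lambda>k. fnm \<beta> x * fnm (fsub \<gamma> (\<alpha> k)) x) \<longlonglongrightarrow> 0"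
    proof (cases "fnm \<beta> x = 0")
      case False
      then have "0 < fnm \<beta> x" using fnm_nonneg[of \<beta> x] by linarith
      with elim have "(\<lambda>k. fnm (fsub \<gamma> (\<alpha> k)) x) \<longlonglongrightarrow> 0" by simp
      from tendsto_mult_left[OF this, of "fnm \<beta> x"] show ?thesis by simp
    qed simp
    have "cmod (fip \<beta> (\<alpha> k) x - fip \<beta> \<gamma> x) \<le> fnm \<beta> x * fnm (fsub \<gamma> (\<alpha> k)) x" for k
    proof -
      have "fip \<beta> \<gamma> x - fip \<beta> (\<alpha> k) x = fip \<beta> (fsub \<gamma> (\<alpha> k)) x"
        by (simp add: fip_simps)
      then show ?thesis
        using fip_le[of \<beta> "fsub \<gamma> (\<alpha> k)" x] by (simp add: norm_minus_commute[of "fip \<beta> (\<alpha> k) x"])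
    qed
    then have "(\<lambda>k. fip \<beta> (\<alpha> k) x - fip \<beta> \<gamma> x) \<longlonglongrightarrow> 0"
      by (intro Lim_null_comparison[OF _ null] always_eventually allI)
    then show ?case by (rule LIM_zero_cancel)
  qed
qed

text \<open>The squared norm is itself a test function, hence bounded; the square root enters only
  at the end.\<close>

lemma fnm_test_bounded:
  assumes "\<alpha> \<in> test_forms A"
  obtains C where "0 \<le> C" "\<And>x. fnm \<alpha> x \<le> C"
proof -
  have "fip \<alpha> \<alpha> \<in> test_functions A"
  proof (rule test_functionI[OF smooth_fip[OF assms assms] test_formD(2)[OF assms]])
    fix x assume "x \<notin> form_support A \<alpha>"
    then have "x \<notin> {x. \<exists>c\<in>A. x \<in> fst c \<and> \<alpha> c x \<noteq> 0}"
      unfolding form_support_def by (rule contra_subsetD[OF closure_subset])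
    then have "\<alpha> (chart_at A x) x = 0"
      using chart_at[of x] by blast
    then show "fip \<alpha> \<alpha> x = 0" by (rule fip_zero_right)
  qed
  then obtain C where C: "0 \<le> C" "\<And>x. cmod (fip \<alpha> \<alpha> x) \<le> C"
    using test_function_bounded by blast
  have "fnm \<alpha> x \<le> sqrt C" for x
    using C(2)[of x] by (intro real_le_rsqrt) (simp add: fip_self norm_power)
  then show ?thesis using that[of "sqrt C"] C(1) by simp
qed

lemma L1_formD:
  assumes "\<beta> \<in> L1_forms A g"
  shows "borel_form A \<beta>" "integrable V (fnm \<beta>)" "L1_norm_form A g \<beta> = ennreal (\<integral>x. fnm \<beta> x \<partial>V)"
proof -
  show b: "borel_form A \<beta>" using assms by (simp add: L1_forms_def)
  have fin: "(\<integral>\<^sup>+x. ennreal (fnm \<beta> x) \<partial>V) < \<infinity>" using assms by (simp add: L1_forms_def L1_norm_form_def)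
  show i: "integrable V (fnm \<beta>)"
    by (rule integrableI_nonneg) (use fin measurable_fnm[OF b] in auto)
  show "L1_norm_form A g \<beta> = ennreal (\<integral>x. fnm \<beta> x \<partial>V)"
    unfolding L1_norm_form_def by (rule nn_integral_eq_integral[OF i]) simp
qed

lemma L1_formI:
  assumes "borel_form A \<beta>" "integrable V (fnm \<beta>)"
  shows "\<beta> \<in> L1_forms A g"
  using assms nn_integral_eq_integral[OF assms(2)] by (simp add: L1_forms_def L1_norm_form_def)

lemma finite_density_fnm:
  assumes "\<beta> \<in> L1_forms A g"
  shows "finite_measure (density V (\<lambda>x. ennreal (fnm \<beta> x)))"
proof
  have "emeasure (density V (\<lambda>x. ennreal (fnm \<beta> x))) UNIV = L1_norm_form A g \<beta>"
    unfolding L1_norm_form_def using measurable_fnm[OF L1_formD(1)[OF assms]]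
    by (subst emeasure_density) auto
  then show "emeasure (density V (\<lambda>x. ennreal (fnm \<beta> x))) (space (density V (\<lambda>x. ennreal (fnm \<beta> x)))) \<noteq> \<infinity>"
    by (simp add: L1_formD(3)[OF assms])
qed

lemma Linf_le_1:
  assumes "\<alpha> \<in> test_forms A"
  shows "Linf_norm_form A g \<alpha> \<le> 1 \<longleftrightarrow> (AE x in V. fnm \<alpha> x \<le> 1)"
proof
  assume le: "Linf_norm_form A g \<alpha> \<le> 1"
  have "AE x in V. ennreal (fnm \<alpha> x) \<le> Linf_norm_form A g \<alpha>"
    unfolding Linf_norm_form_def by (rule esssup_AE)
  then show "AE x in V. fnm \<alpha> x \<le> 1"
  proof eventually_elim
    case (elim x)
    then have "ennreal (fnm \<alpha> x) \<le> 1" using le by (rule order_trans)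
    then show ?case by (simp add: ennreal_le_1)
  qed
next
  assume "AE x in V. fnm \<alpha> x \<le> 1"
  then have "AE x in V. ennreal (fnm \<alpha> x) \<le> 1"
    by eventually_elim (simp add: ennreal_le_1)
  then show "Linf_norm_form A g \<alpha> \<le> 1"
    unfolding Linf_norm_form_def
    using measurable_fnm[OF test_form_borel[OF assms]] by (intro esssup_I) auto
qed

lemma Var_ge:
  assumes "\<alpha> \<in> test_forms A" "\<And>x. fnm \<alpha> x \<le> 1"
  shows "ennreal (cmod (dist_d A g f \<alpha>)) \<le> Var A g f"
  unfolding Var_def by (rule SUP_upper) (use assms Linf_le_1 in auto)

text \<open>Being valid for every weak derivative, it shows that the arbitrary choice in
  \<open>weak_d\<close> does not affect \<open>W11_norm\<close>. The upper bound is Cauchy-Schwarz;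
  for the lower one the supremum is approached along test forms close to \<beta>/|\<beta>|.\<close>

theorem Var_eq_L1_norm:
  assumes "is_weak_d A g f \<beta>"
  shows "Var A g f = L1_norm_form A g \<beta>"
proof (rule antisym)
  have L1: "\<beta> \<in> L1_forms A g" and dist: "\<And>\<alpha>. \<alpha> \<in> test_forms A \<Longrightarrow> dist_d A g f \<alpha> = (\<integral>x. fip \<beta> \<alpha> x \<partial>V)"
    using assms by (simp_all add: is_weak_d_def)
  note \<beta> = L1_formD[OF L1]
  show "Var A g f \<le> L1_norm_form A g \<beta>"
    unfolding Var_def
  proof (rule SUP_least)
    fix \<alpha> assume "\<alpha> \<in> {\<alpha> \<in> test_forms A. Linf_norm_form A g \<alpha> \<le> 1}"
    then have \<alpha>: "\<alpha> \<in> test_forms A" and le: "AE x in V. fnm \<alpha> x \<le> 1" using Linf_le_1 by auto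
    have int: "integrable V (fip \<beta> \<alpha>)"
      by (rule integrable_pairing[OF sets_vol \<beta>(1,2) test_form_borel[OF \<alpha>] le])
    have "cmod (dist_d A g f \<alpha>) \<le> (\<integral>x. cmod (fip \<beta> \<alpha> x) \<partial>V)"
      unfolding dist[OF \<alpha>] by (rule integral_norm_bound)
    also have "\<dots> \<le> (\<integral>x. fnm \<beta> x \<partial>V)"
    proof (rule integral_mono_AE)
      from le show "AE x in V. cmod (fip \<beta> \<alpha> x) \<le> fnm \<beta> x"
      proof eventually_elim
        case (elim x)
        show ?case using fip_le[of \<beta> \<alpha> x] mult_left_mono[OF elim fnm_nonneg[of \<beta> x]] by simp
      qed
    qed (use int \<beta> in auto)
    finally show "ennreal (cmod (dist_d A g f \<alpha>)) \<le> L1_norm_form A g \<beta>"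
      unfolding \<beta>(3) by (rule ennreal_leI)
  qed
  \<comment> \<open>Since \<open>inverse 0 = 0\<close>, this form is 0 where \<beta> vanishes and
    has norm 1 elsewhere, as the density of unit forms requires.\<close>
  define \<gamma> where "\<gamma> = fscale (\<lambda>x. of_real (inverse (fnm \<beta> x))) \<beta>"
  have [measurable]: "fnm \<beta> \<in> borel_measurable borel" by (rule measurable_fnm[OF \<beta>(1)])
  have \<gamma>: "borel_form A \<gamma>" unfolding \<gamma>_def by (intro borel_form_fscale \<beta>) measurable
  have "fnm \<gamma> x = inverse (fnm \<beta> x) * fnm \<beta> x" for x
    by (simp add: \<gamma>_def fnm_scale del: of_real_inverse)
  then have unit: "fnm \<gamma> x = 0 \<or> fnm \<gamma> x = 1" for x
    by (cases "fnm \<beta> x = 0") auto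
  \<comment> \<open>The volume may be infinite, so density is applied to the measure with density
    |\<beta>|, which is finite.\<close>
  define \<nu> where "\<nu> = density V (\<lambda>x. ennreal (fnm \<beta> x))"
  have sets_nu: "sets \<nu> = sets borel" by (simp add: \<nu>_def)
  have "finite_measure \<nu>" unfolding \<nu>_def by (rule finite_density_fnm[OF L1])
  then obtain \<alpha> :: "nat \<Rightarrow> ('a, 'n) form" where \<alpha>: "\<And>k. \<alpha> k \<in> test_forms A" "\<And>k x. fnm (\<alpha> k) x \<le> 1"
    and lim: "AE x in \<nu>. (\<lambda>k. fnm (fsub \<gamma> (\<alpha> k)) x) \<longlonglongrightarrow> 0"
    using unit_test_forms_dense[OF sets_nu _ \<gamma> unit] by blast
  have "AE x in V. 0 < fnm \<beta> x \<longrightarrow> (\<lambda>k. fnm (fsub \<gamma> (\<alpha> k)) x) \<longlonglongrightarrow> 0"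
    using lim unfolding \<nu>_def by (subst (asm) AE_density) auto
  then have "(\<lambda>k. \<integral>x. fip \<beta> (\<alpha> k) x \<partial>V) \<longlonglongrightarrow> (\<integral>x. fip \<beta> \<gamma> x \<partial>V)"
    using \<alpha> by (intro pairing_limit sets_vol \<beta> \<gamma> test_form_borel) auto
  moreover have "fip \<beta> \<gamma> x = of_real (fnm \<beta> x)" for x
    by (cases "fnm \<beta> x = 0") (simp_all add: \<gamma>_def fip_simps fip_self power2_eq_square)
  ultimately have "(\<lambda>k. dist_d A g f (\<alpha> k)) \<longlonglongrightarrow> of_real (\<integral>x. fnm \<beta> x \<partial>V)"
    by (simp add: dist \<alpha>)
  then have "(\<lambda>k. ennreal (cmod (dist_d A g f (\<alpha> k)))) \<longlonglongrightarrow> ennreal (cmod (of_real (\<integral>x. fnm \<beta> x \<partial>V)))"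
    by (intro tendsto_ennrealI tendsto_norm)
  moreover have "cmod (of_real (\<integral>x. fnm \<beta> x \<partial>V)) = (\<integral>x. fnm \<beta> x \<partial>V)"
    by (simp add: integral_nonneg_AE)
  ultimately have "(\<lambda>k. ennreal (cmod (dist_d A g f (\<alpha> k)))) \<longlonglongrightarrow> L1_norm_form A g \<beta>"
    by (simp add: \<beta>(3))
  then show "L1_norm_form A g \<beta> \<le> Var A g f"
    by (rule LIMSEQ_le_const2) (use Var_ge[OF \<alpha>] in auto)
qed

lemma W11D:
  assumes "f \<in> W11 A g"
  shows "integrable V f" "is_weak_d A g f (weak_d A g f)"
  using assms someI_ex[of "is_weak_d A g f"] by (auto simp: W11_def weak_d_def)

lemma BV_norm_eq_W11_norm: "f \<in> W11 A g \<Longrightarrow> BV_norm A g f = W11_norm A g f"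
  using Var_eq_L1_norm[OF W11D(2)] by (simp add: BV_norm_def W11_norm_def)

lemma W11_subset_BV: "W11 A g \<subseteq> BV A g"
proof
  fix f assume f: "f \<in> W11 A g"
  have "weak_d A g f \<in> L1_forms A g" using W11D(2)[OF f] by (simp add: is_weak_d_def)
  then show "f \<in> BV A g"
    using W11D[OF f] Var_eq_L1_norm[OF W11D(2)[OF f]] L1_formD(3) by (simp add: BV_def)
qed

section \<open>The variation measure\<close>

text \<open>One sequence of test forms has to converge almost everywhere for two measures at once; a
  set that is null for the sum is null for both.\<close>

lemma sum_measure_exists:
  assumes M: "sets M = sets borel" "finite_measure M" and N: "sets N = sets borel" "finite_measure N"
  obtains K :: "'a measure" where "sets K = sets borel" "finite_measure K"
    "absolutely_continuous K M" "absolutely_continuous K N"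
proof -
  \<comment> \<open>The sum of two measures is obtained as a series whose further terms are
    zero.\<close>
  define \<nu> where "\<nu> k = (if k = 0 then M else if k = 1 then N else null_measure borel)" for k :: nat
  obtain K where sets_K: "sets K = sets borel" and
    series: "\<And>B. B \<in> sets borel \<Longrightarrow> emeasure K B = (\<Sum>k. emeasure (\<nu> k) B)"
  proof (rule measure_series[of \<nu>])
    show "sets (\<nu> k) = sets borel" for k using M N by (simp add: \<nu>_def)
  qed (rule that)
  have K: "emeasure K B = emeasure M B + emeasure N B" if "B \<in> sets borel" for B
    unfolding series[OF that] by (subst suminf_finite[of "{0, 1}"]) (auto simp: \<nu>_def)
  show ?thesis
  proof
    show "finite_measure K"
    proof
      have "space K = UNIV" using sets_eq_imp_space_eq[OF sets_K] by simp
      moreover have "space M = UNIV" "space N = UNIV"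
        using sets_eq_imp_space_eq[OF M(1)] sets_eq_imp_space_eq[OF N(1)] by simp_all
      ultimately show "emeasure K (space K) \<noteq> \<infinity>"
        using K[of UNIV] finite_measure.emeasure_finite[OF M(2), of UNIV] finite_measure.emeasure_finite[OF N(2), of UNIV]
        by simp
    qed
  qed (use K M N in \<open>auto simp: sets_K absolutely_continuous_def null_sets_def\<close>)
qed

lemma weak_d_imp_absolutely_continuous:
  assumes f: "f \<in> W11 A g" and \<mu>: "is_variation_measure A g f \<mu>"
  shows "absolutely_continuous V \<mu>"
  unfolding absolutely_continuous_def
proof
  fix N assume N: "N \<in> null_sets V"
  obtain \<beta> where "is_weak_d A g f \<beta>" using W11D(2)[OF f] by blast
  then have L1: "\<beta> \<in> L1_forms A g" and dist: "\<And>\<alpha>. \<alpha> \<in> test_forms A \<Longrightarrow> dist_d A g f \<alpha> = (\<integral>x. fip \<beta> \<alpha> x \<partial>V)"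
    by (simp_all add: is_weak_d_def)
  note \<beta> = L1_formD[OF L1]
  obtain \<sigma> where sets_mu[measurable_cong]: "sets \<mu> = sets borel" and fin: "finite_measure \<mu>" and \<sigma>: "borel_form A \<sigma>"
    and unit: "AE x in \<mu>. fnm \<sigma> x = 1"
    and dist': "\<And>\<alpha>. \<alpha> \<in> test_forms A \<Longrightarrow> dist_d A g f \<alpha> = (\<integral>x. fip \<sigma> \<alpha> x \<partial>\<mu>)"
    using \<mu> unfolding is_variation_measure_def by blast
  have [measurable]: "fnm \<beta> \<in> borel_measurable borel" "fnm \<sigma> \<in> borel_measurable borel"
    by (intro measurable_fnm \<beta> \<sigma>)+
  have Nb[measurable]: "N \<in> sets borel" using N by (auto simp: null_sets_def)
  \<comment> \<open>The norm of \<sigma> is 1 only almost everywhere, while the density of unit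
    forms asks for norm 0 or 1 at every point; the points dropped from \<open>N\<close> are
    \<open>\<mu>\<close>-null.\<close>
  define S where "S = N \<inter> {x. fnm \<sigma> x = 1}"
  have S[measurable]: "S \<in> sets borel" unfolding S_def by measurable
  define \<gamma> where "\<gamma> = fscale (indicator S) \<sigma>"
  have \<gamma>: "borel_form A \<gamma>" unfolding \<gamma>_def by (intro borel_form_fscale \<sigma>) measurable
  have u: "fnm \<gamma> x = 0 \<or> fnm \<gamma> x = 1" for x
    by (auto simp: \<gamma>_def fnm_scale S_def indicator_def)
  define \<nu> where "\<nu> = density V (\<lambda>x. ennreal (fnm \<beta> x))"
  have sets_nu: "sets \<nu> = sets borel" by (simp add: \<nu>_def)
  have "finite_measure \<nu>" unfolding \<nu>_def by (rule finite_density_fnm[OF L1])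
  then obtain K :: "'a measure" where K: "sets K = sets borel" "finite_measure K"
    "absolutely_continuous K \<mu>" "absolutely_continuous K \<nu>"
    using sum_measure_exists[OF sets_mu fin sets_nu] by blast
  obtain \<alpha> :: "nat \<Rightarrow> ('a, 'n) form" where \<alpha>: "\<And>k. \<alpha> k \<in> test_forms A" "\<And>k x. fnm (\<alpha> k) x \<le> 1"
    and lim: "AE x in K. (\<lambda>k. fnm (fsub \<gamma> (\<alpha> k)) x) \<longlonglongrightarrow> 0"
    using unit_test_forms_dense[OF K(1,2) \<gamma> u] by blast
  have lim_mu: "AE x in \<mu>. (\<lambda>k. fnm (fsub \<gamma> (\<alpha> k)) x) \<longlonglongrightarrow> 0"
    by (rule absolutely_continuous_AE[OF _ K(3) lim]) (simp add: K sets_mu)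
  have "AE x in \<nu>. (\<lambda>k. fnm (fsub \<gamma> (\<alpha> k)) x) \<longlonglongrightarrow> 0"
    by (rule absolutely_continuous_AE[OF _ K(4) lim]) (simp add: K sets_nu)
  then have lim_V: "AE x in V. 0 < fnm \<beta> x \<longrightarrow> (\<lambda>k. fnm (fsub \<gamma> (\<alpha> k)) x) \<longlonglongrightarrow> 0"
    unfolding \<nu>_def by (subst (asm) AE_density) auto
  have int_\<sigma>: "integrable \<mu> (fnm \<sigma>)"
  proof (rule integrable_cong_AE[THEN iffD2])
    show "AE x in \<mu>. fnm \<sigma> x = 1" by (rule unit)
    show "integrable \<mu> (\<lambda>x. 1 :: real)" by (rule finite_measure.integrable_const[OF fin])
  qed measurable
  have "(\<lambda>k. \<integral>x. fip \<beta> (\<alpha> k) x \<partial>V) \<longlonglongrightarrow> (\<integral>x. fip \<beta> \<gamma> x \<partial>V)"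
    using \<alpha> lim_V by (intro pairing_limit sets_vol \<beta> \<gamma> test_form_borel) auto
  \<comment> \<open>\<gamma> lives on \<open>N\<close>, which the volume does not see. The same
    limit computed through \<sigma> will be the \<open>\<mu>\<close>-measure of
    \<open>S\<close>.\<close>
  moreover have "(\<integral>x. fip \<beta> \<gamma> x \<partial>V) = 0"
  proof (rule integral_eq_zero_AE)
    show "AE x in V. fip \<beta> \<gamma> x = 0"
      using AE_not_in[OF N] by eventually_elim (auto simp: \<gamma>_def fip_simps S_def)
  qed
  ultimately have l1: "(\<lambda>k. dist_d A g f (\<alpha> k)) \<longlonglongrightarrow> 0" by (simp add: dist \<alpha>)
  have "(\<lambda>k. \<integral>x. fip \<sigma> (\<alpha> k) x \<partial>\<mu>) \<longlonglongrightarrow> (\<integral>x. fip \<sigma> \<gamma> x \<partial>\<mu>)"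
    using \<alpha> lim_mu by (intro pairing_limit sets_mu \<sigma> int_\<sigma> \<gamma> test_form_borel) auto
  then have l2: "(\<lambda>k. dist_d A g f (\<alpha> k)) \<longlonglongrightarrow> (\<integral>x. fip \<sigma> \<gamma> x \<partial>\<mu>)" by (simp add: dist' \<alpha>)
  have "(\<integral>x. fip \<sigma> \<gamma> x \<partial>\<mu>) = (\<integral>x. of_real (indicator S x) \<partial>\<mu>)"
    by (intro Bochner_Integration.integral_cong refl) (auto simp: \<gamma>_def fip_simps fip_self S_def indicator_def)
  also have "\<dots> = of_real (measure \<mu> S)"
    using S sets_mu sets.sets_into_space[of S \<mu>] by (simp add: Int_absorb2)
  finally have "measure \<mu> S = 0" using LIMSEQ_unique[OF l1 l2] by simp
  then have "emeasure \<mu> S = 0"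
    using finite_measure.emeasure_eq_measure[OF fin] by simp
  moreover have "emeasure \<mu> N = emeasure \<mu> S"
    by (rule emeasure_eq_AE) (use unit in \<open>auto simp: S_def sets_mu\<close>)
  ultimately show "N \<in> null_sets \<mu>" using Nb sets_mu by (simp add: null_sets_def)
qed

lemma absolutely_continuous_imp_weak_d:
  assumes f: "integrable V f" and \<mu>: "is_variation_measure A g f \<mu>" and ac: "absolutely_continuous V \<mu>"
  shows "f \<in> W11 A g"
proof -
  obtain \<sigma> where sets_mu: "sets \<mu> = sets borel" and fin: "finite_measure \<mu>" and \<sigma>: "borel_form A \<sigma>"
    and unit: "AE x in \<mu>. fnm \<sigma> x = 1"
    and dist: "\<And>\<alpha>. \<alpha> \<in> test_forms A \<Longrightarrow> dist_d A g f \<alpha> = (\<integral>x. fip \<sigma> \<alpha> x \<partial>\<mu>)"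
    using \<mu> unfolding is_variation_measure_def by blast
  interpret V: sigma_finite_measure V by (rule sigma_finite_vol)
  \<comment> \<open>Finiteness of \<mu> makes the density finite almost everywhere, so that a real
    version of it can scale \<sigma>.\<close>
  obtain D where D: "D \<in> borel_measurable V" "AE x in V. RN_deriv V \<mu> x = ennreal (D x)" "\<And>x. 0 \<le> D x"
  proof (rule V.real_RN_deriv[OF fin ac])
    show "sets \<mu> = sets V" by (simp add: sets_mu)
  qed (rule that)
  have [measurable]: "D \<in> borel_measurable borel" using D(1) by simp
  have [measurable]: "fnm \<sigma> \<in> borel_measurable borel" by (rule measurable_fnm[OF \<sigma>])
  have "density V (RN_deriv V \<mu>) = \<mu>"
    using ac sets_mu by (intro V.density_RN_deriv) auto
  moreover have "density V (RN_deriv V \<mu>) = density V (\<lambda>x. ennreal (D x))"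
    using D by (intro density_cong) auto
  ultimately have \<mu>_eq: "\<mu> = density V (\<lambda>x. ennreal (D x))" by simp
  define \<beta> where "\<beta> = fscale (\<lambda>x. of_real (D x)) \<sigma>"
  have \<beta>: "borel_form A \<beta>" unfolding \<beta>_def by (intro borel_form_fscale \<sigma>) measurable
  \<comment> \<open>The L1 norm turns out to be the total mass of \<mu>, because \<sigma> has norm 1
    for \<mu>.\<close>
  have "L1_norm_form A g \<beta> = (\<integral>\<^sup>+x. ennreal (D x) * ennreal (fnm \<sigma> x) \<partial>V)"
    unfolding L1_norm_form_def using D(3) by (simp add: \<beta>_def fnm_scale ennreal_mult)
  also have "\<dots> = (\<integral>\<^sup>+x. ennreal (fnm \<sigma> x) \<partial>\<mu>)"
    unfolding \<mu>_eq by (subst nn_integral_density) auto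
  also have "\<dots> = (\<integral>\<^sup>+x. 1 \<partial>\<mu>)"
    by (intro nn_integral_cong_AE) (use unit in auto)
  also have "\<dots> < \<infinity>"
    using finite_measure.emeasure_finite[OF fin] by (simp add: less_top[symmetric])
  finally have L1: "\<beta> \<in> L1_forms A g" using \<beta> by (simp add: L1_forms_def)
  have "dist_d A g f \<alpha> = (\<integral>x. fip \<beta> \<alpha> x \<partial>V)" if \<alpha>: "\<alpha> \<in> test_forms A" for \<alpha>
  proof -
    have "(\<integral>x. fip \<sigma> \<alpha> x \<partial>\<mu>) = (\<integral>x. D x *\<^sub>R fip \<sigma> \<alpha> x \<partial>V)"
      unfolding \<mu>_eq using measurable_fip[OF \<sigma> test_form_borel[OF \<alpha>]] D
      by (intro integral_density) auto
    then show ?thesis by (simp add: dist[OF \<alpha>] \<beta>_def fip_simps scaleR_conv_of_real)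
  qed
  then have "is_weak_d A g f \<beta>" using L1 by (simp add: is_weak_d_def)
  then show ?thesis using f by (auto simp: W11_def)
qed

end

section \<open>Completeness\<close>

context riemannian
begin

text \<open>A pointwise limit exists where the series of the differences converges, and that set does
  not depend on a chart.\<close>

lemma L1_forms_limit:
  fixes \<beta> :: "nat \<Rightarrow> ('a, 'n) form"
  assumes L1: "\<And>n. \<beta> n \<in> L1_forms A g"
    and fast: "\<And>n. L1_norm_form A g (fsub (\<beta> (Suc n)) (\<beta> n)) \<le> ennreal (C * (1/2) ^ n)" and C: "0 \<le> C"
  obtains \<beta>' where "\<beta>' \<in> L1_forms A g"
    "\<And>\<alpha>. \<alpha> \<in> test_forms A \<Longrightarrow> (\<lambda>n. \<integral>x. fip (\<beta> n) \<alpha> x \<partial>V) \<longlonglongrightarrow> (\<integral>x. fip \<beta>' \<alpha> x \<partial>V)"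
proof -
  define \<delta> where "\<delta> n = fsub (\<beta> (Suc n)) (\<beta> n)" for n
  note b = L1_formD(1)[OF L1]
  have bd: "borel_form A (\<delta> n)" for n unfolding \<delta>_def by (intro borel_form_fsub b)
  have [measurable]: "fnm (\<delta> n) \<in> borel_measurable borel" "fnm (\<beta> n) \<in> borel_measurable borel" for n
    by (intro measurable_fnm bd b)+
  \<comment> \<open>\<open>W\<close> bounds every |\<beta> n| at once: the norm of the first form
    plus the norms of all increments. Its integral is finite because the increments decay
    geometrically.\<close>
  define W where "W x = ennreal (fnm (\<beta> 0) x) + (\<Sum>n. ennreal (fnm (\<delta> n) x))" for x
  have [measurable]: "W \<in> borel_measurable borel" unfolding W_def by measurable
  have "(\<integral>\<^sup>+x. W x \<partial>V) = L1_norm_form A g (\<beta> 0) + (\<Sum>n. L1_norm_form A g (\<delta> n))"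
    unfolding W_def L1_norm_form_def by (subst nn_integral_add) (auto simp: nn_integral_suminf)
  also have "(\<Sum>n. L1_norm_form A g (\<delta> n)) \<le> (\<Sum>n. ennreal (C * (1/2) ^ n))"
    using fast unfolding \<delta>_def by (intro suminf_le) auto
  also have "(\<Sum>n. ennreal (C * (1/2) ^ n)) = ennreal (\<Sum>n. C * (1/2) ^ n)"
    using C by (intro suminf_ennreal2 summable_mult) (auto intro: summable_geometric)
  finally have "(\<integral>\<^sup>+x. W x \<partial>V) \<le> L1_norm_form A g (\<beta> 0) + ennreal (\<Sum>n. C * (1/2) ^ n)"
    by simp
  also have "\<dots> < \<infinity>" using L1_formD(3)[OF L1[of 0]] by simp
  finally have W_fin: "(\<integral>\<^sup>+x. W x \<partial>V) < \<infinity>" .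
  define G where "G = {x. W x \<noteq> \<infinity>}"
  have [measurable]: "G \<in> sets borel" unfolding G_def by measurable
  have AE_G: "AE x in V. x \<in> G"
    unfolding G_def using nn_integral_PInf_AE[of W V] W_fin by simp
  \<comment> \<open>A real majorant. Where \<open>W\<close> is infinite it defaults to 0, which is
    consistent because the forms will be cut off to 0 there.\<close>
  define w where "w x = enn2real (W x)" for x
  have w: "integrable V w"
  proof (rule integrableI_nonneg)
    show "w \<in> borel_measurable V" unfolding w_def by simp
    have "(\<integral>\<^sup>+x. ennreal (w x) \<partial>V) \<le> (\<integral>\<^sup>+x. W x \<partial>V)"
      by (intro nn_integral_mono) (simp add: w_def ennreal_enn2real_if)
    then show "(\<integral>\<^sup>+x. ennreal (w x) \<partial>V) < \<infinity>" using W_fin by (rule order.strict_trans1)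
  qed (simp add: w_def)
  have "fnm (\<beta> n) x \<le> fnm (\<beta> 0) x + (\<Sum>k<n. fnm (\<delta> k) x)" for n x
  proof (induction n)
    case (Suc n)
    have "\<beta> (Suc n) = fadd (\<delta> n) (\<beta> n)"
      by (simp add: \<delta>_def fadd_def fscale_def fun_eq_iff vec_eq_iff)
    then have "fnm (\<beta> (Suc n)) x \<le> fnm (\<delta> n) x + fnm (\<beta> n) x" using fnm_triangle by metis
    then show ?case using Suc by simp
  qed simp
  then have "ennreal (fnm (\<beta> n) x) \<le> W x" for n x
  proof -
    assume *: "\<And>n x. fnm (\<beta> n) x \<le> fnm (\<beta> 0) x + (\<Sum>k<n. fnm (\<delta> k) x)"
    have "ennreal (fnm (\<beta> n) x) \<le> ennreal (fnm (\<beta> 0) x) + (\<Sum>k<n. ennreal (fnm (\<delta> k) x))"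
      using ennreal_leI[OF *[of n x]] by (simp add: ennreal_plus sum_nonneg sum_ennreal)
    also have "\<dots> \<le> W x"
      unfolding W_def by (intro add_left_mono sum_le_suminf) auto
    finally show ?thesis .
  qed
  then have \<beta>w: "fnm (\<beta> n) x \<le> w x" if "x \<in> G" for n x
    using that enn2real_mono[of "ennreal (fnm (\<beta> n) x)" "W x"]
    by (auto simp: w_def G_def less_top)
  \<comment> \<open>After the cut-off the components converge at every point of every chart, so the
    limit obeys the transformation law without exception and is a Borel form.\<close>
  define \<eta> where "\<eta> n = fscale (indicator G) (\<beta> n)" for n
  have b\<eta>: "borel_form A (\<eta> n)" for n unfolding \<eta>_def by (intro borel_form_fscale b) measurable
  define \<beta>' where "\<beta>' c x = (\<chi> i. lim (\<lambda>n. \<eta> n c x $ i))" for c x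
  have conv: "(\<lambda>n. \<eta> n c x $ i) \<longlonglongrightarrow> \<beta>' c x $ i" if c: "c \<in> A" "x \<in> fst c" for c x i
  proof (cases "x \<in> G")
    case False
    then show ?thesis by (simp add: \<beta>'_def \<eta>_def fscale_def)
  next
    case True
    \<comment> \<open>Summability is known for the norms; this constant, fixed for the given chart,
      point and index, turns it into summability of the i-th component.\<close>
    define k where "k = hnorm (ginv c x) (\<chi> j. of_real (g c x $ i $ j))"
    have "(\<Sum>n. ennreal (fnm (\<delta> n) x)) \<noteq> \<infinity>"
      using True by (auto simp: G_def W_def)
    then have "summable (\<lambda>n. fnm (\<delta> n) x)" by (intro summable_suminf_not_top) auto
    then have "summable (\<lambda>n. k * fnm (\<delta> n) x)" by (rule summable_mult)
    then have "summable (\<lambda>n. \<delta> n c x $ i)"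
    proof (rule summable_comparison_test'[where N = 0])
      show "cmod (\<delta> n c x $ i) \<le> k * fnm (\<delta> n) x" for n
        using component_le_hnorm[OF pos_def_metric[OF c], of "\<delta> n c x" i]
        by (simp add: k_def ginv_def fnm_chart[OF c borel_formD(1)[OF bd]])
    qed
    then have "convergent (\<lambda>n. \<Sum>m<n. \<delta> m c x $ i)"
      by (simp add: summable_iff_convergent)
    moreover have "(\<Sum>m<n. \<delta> m c x $ i) = \<beta> n c x $ i - \<beta> 0 c x $ i" for n
      by (subst sum_lessThan_telescope[symmetric]) (simp add: \<delta>_def fadd_def fscale_def)
    ultimately have "convergent (\<lambda>n. \<beta> n c x $ i - \<beta> 0 c x $ i)" by simp
    from convergent_add[OF this convergent_const[of "\<beta> 0 c x $ i"]] have "convergent (\<lambda>n. \<beta> n c x $ i)"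
      by simp
    then show ?thesis using True by (simp add: \<beta>'_def \<eta>_def fscale_def convergent_LIMSEQ_iff)
  qed
  have b': "borel_form A \<beta>'" by (rule borel_form_limit[OF b\<eta> conv])
  have fip_conv: "(\<lambda>n. fip (\<eta> n) \<alpha> x) \<longlonglongrightarrow> fip \<beta>' \<alpha> x" for \<alpha> x
    unfolding fip_herm herm_def by (intro tendsto_intros conv chart_at)
  have fip_le_w: "cmod (fip (\<eta> n) \<alpha> x) \<le> w x * fnm \<alpha> x" for n \<alpha> x
  proof (cases "x \<in> G")
    case True
    then have "cmod (fip (\<eta> n) \<alpha> x) = cmod (fip (\<beta> n) \<alpha> x)" by (simp add: \<eta>_def fip_simps)
    also have "\<dots> \<le> fnm (\<beta> n) x * fnm \<alpha> x" by (rule fip_le)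
    also have "\<dots> \<le> w x * fnm \<alpha> x" by (intro mult_right_mono \<beta>w True fnm_nonneg)
    finally show ?thesis .
  qed (simp add: \<eta>_def fip_simps w_def)
  have \<beta>'w: "fnm \<beta>' x \<le> w x" for x
  proof -
    \<comment> \<open>Convergence is known for products with a fixed form; taking
      \<open>\<beta>'\<close> itself as that form and cancelling one factor of its norm gives the
      bound.\<close>
    have "cmod (fip \<beta>' \<beta>' x) \<le> w x * fnm \<beta>' x"
      by (rule LIMSEQ_le_const2[OF tendsto_norm[OF fip_conv]]) (use fip_le_w in blast)
    then have "fnm \<beta>' x * fnm \<beta>' x \<le> w x * fnm \<beta>' x"
      by (simp add: fip_self norm_mult power2_eq_square)
    then show ?thesis
      using fnm_nonneg[of \<beta>' x] by (cases "fnm \<beta>' x = 0") (auto simp: w_def)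
  qed
  show ?thesis
  proof (rule that)
    show "\<beta>' \<in> L1_forms A g"
    proof (rule L1_formI[OF b' Bochner_Integration.integrable_bound[OF w]])
      show "fnm \<beta>' \<in> borel_measurable V" using measurable_fnm[OF b'] by simp
      show "AE x in V. norm (fnm \<beta>' x) \<le> norm (w x)"
        using \<beta>'w by (intro AE_I2) (simp add: w_def)
    qed
    fix \<alpha> assume \<alpha>: "\<alpha> \<in> test_forms A"
    obtain K where K: "0 \<le> K" "\<And>x. fnm \<alpha> x \<le> K" using fnm_test_bounded[OF \<alpha>] by blast
    have "(\<lambda>n. \<integral>x. fip (\<eta> n) \<alpha> x \<partial>V) \<longlonglongrightarrow> (\<integral>x. fip \<beta>' \<alpha> x \<partial>V)"
    proof (rule integral_dominated_convergence[where w = "\<lambda>x. w x * K"])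
      show "fip \<beta>' \<alpha> \<in> borel_measurable V" "fip (\<eta> n) \<alpha> \<in> borel_measurable V" for n
        using measurable_fip test_form_borel[OF \<alpha>] b' b\<eta> by simp_all
      show "integrable V (\<lambda>x. w x * K)" using w by simp
      show "AE x in V. (\<lambda>n. fip (\<eta> n) \<alpha> x) \<longlonglongrightarrow> fip \<beta>' \<alpha> x" using fip_conv by simp
      show "AE x in V. norm (fip (\<eta> n) \<alpha> x) \<le> w x * K" for n
      proof (rule AE_I2)
        fix x
        have "w x * fnm \<alpha> x \<le> w x * K" by (intro mult_left_mono K) (simp add: w_def)
        then show "norm (fip (\<eta> n) \<alpha> x) \<le> w x * K" using fip_le_w[of n \<alpha> x] by linarith
      qed
    qed
    moreover have "(\<integral>x. fip (\<eta> n) \<alpha> x \<partial>V) = (\<integral>x. fip (\<beta> n) \<alpha> x \<partial>V)" for n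
    proof (rule integral_cong_AE)
      show "fip (\<eta> n) \<alpha> \<in> borel_measurable V" "fip (\<beta> n) \<alpha> \<in> borel_measurable V"
        using measurable_fip test_form_borel[OF \<alpha>] b b\<eta> by simp_all
      show "AE x in V. fip (\<eta> n) \<alpha> x = fip (\<beta> n) \<alpha> x"
        using AE_G by eventually_elim (simp add: \<eta>_def fip_simps)
    qed
    ultimately show "(\<lambda>n. \<integral>x. fip (\<beta> n) \<alpha> x \<partial>V) \<longlonglongrightarrow> (\<integral>x. fip \<beta>' \<alpha> x \<partial>V)" by simp
  qed
qed

section \<open>Vector space structure of W11\<close>

lemma is_weak_d_add:
  assumes f: "integrable V f" "is_weak_d A g f \<beta>" and h: "integrable V h" "is_weak_d A g h \<gamma>"
  shows "is_weak_d A g (\<lambda>x. f x + h x) (fadd \<beta> \<gamma>)"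
proof -
  have L1: "\<beta> \<in> L1_forms A g" "\<gamma> \<in> L1_forms A g" using assms by (simp_all add: is_weak_d_def)
  note \<beta> = L1_formD[OF L1(1)] and \<gamma> = L1_formD[OF L1(2)]
  have "fadd \<beta> \<gamma> \<in> L1_forms A g"
  proof (rule L1_formI)
    show b: "borel_form A (fadd \<beta> \<gamma>)" by (intro borel_form_fadd \<beta> \<gamma>)
    show "integrable V (fnm (fadd \<beta> \<gamma>))"
    proof (rule Bochner_Integration.integrable_bound)
      show "integrable V (\<lambda>x. fnm \<beta> x + fnm \<gamma> x)" using \<beta> \<gamma> by simp
      show "fnm (fadd \<beta> \<gamma>) \<in> borel_measurable V" using measurable_fnm[OF b] by simp
      show "AE x in V. norm (fnm (fadd \<beta> \<gamma>) x) \<le> norm (fnm \<beta> x + fnm \<gamma> x)"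
        using fnm_triangle[of \<beta> \<gamma>] by (intro AE_I2) simp
    qed
  qed
  moreover have "dist_d A g (\<lambda>x. f x + h x) \<alpha> = (\<integral>x. fip (fadd \<beta> \<gamma>) \<alpha> x \<partial>V)" if \<alpha>: "\<alpha> \<in> test_forms A" for \<alpha>
  proof -
    obtain K where K: "\<And>x. fnm \<alpha> x \<le> K" using fnm_test_bounded[OF \<alpha>] by blast
    have "integrable V (fip \<beta> \<alpha>)" "integrable V (fip \<gamma> \<alpha>)"
      using K by (auto intro!: integrable_pairing[where C = K] \<beta> \<gamma> test_form_borel \<alpha>)
    then show ?thesis
      using assms \<alpha> by (simp add: dist_d_add fip_simps is_weak_d_def)
  qed
  ultimately show ?thesis by (simp add: is_weak_d_def)
qed

lemma is_weak_d_scale: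
  assumes "is_weak_d A g f \<beta>"
  shows "is_weak_d A g (\<lambda>x. a * f x) (fscale (\<lambda>_. a) \<beta>)"
proof -
  have L1: "\<beta> \<in> L1_forms A g" using assms by (simp add: is_weak_d_def)
  note \<beta> = L1_formD[OF L1]
  have "fscale (\<lambda>_. a) \<beta> \<in> L1_forms A g"
  proof (rule L1_formI)
    show "borel_form A (fscale (\<lambda>_. a) \<beta>)" by (intro borel_form_fscale \<beta>) auto
    have "fnm (fscale (\<lambda>_. a) \<beta>) = (\<lambda>x. cmod a * fnm \<beta> x)" by (rule ext) (rule fnm_scale)
    then show "integrable V (fnm (fscale (\<lambda>_. a) \<beta>))" using \<beta>(2) by simp
  qed
  then show ?thesis using assms by (simp add: is_weak_d_def dist_d_scale fip_simps)
qed

lemma W11I: "integrable V f \<Longrightarrow> is_weak_d A g f \<beta> \<Longrightarrow> f \<in> W11 A g"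
  by (auto simp: W11_def)

lemma W11_add: "f \<in> W11 A g \<Longrightarrow> h \<in> W11 A g \<Longrightarrow> (\<lambda>x. f x + h x) \<in> W11 A g"
  by (rule W11I[OF Bochner_Integration.integrable_add is_weak_d_add[OF _ W11D(2) _ W11D(2)]])
    (simp_all add: W11D(1))

lemma W11_scale: "f \<in> W11 A g \<Longrightarrow> (\<lambda>x. a * f x) \<in> W11 A g"
  by (rule W11I[OF Bochner_Integration.integrable_mult_right is_weak_d_scale[OF W11D(2)]])
    (simp_all add: W11D(1))

lemma W11_diff:
  assumes "f \<in> W11 A g" "h \<in> W11 A g"
  shows "(\<lambda>x. f x - h x) \<in> W11 A g"
  using W11_add[OF assms(1) W11_scale[OF assms(2), of "- 1"]] by simp

lemma W11_zero: "(\<lambda>x. 0) \<in> W11 A g"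
proof -
  have zero: "(\<lambda>c x. 0) \<in> test_forms A"
    by (rule test_formI) (simp_all add: is_form_def form_support_def smooth_on_const)
  have 0: "fnm (\<lambda>c x. 0) x = 0" for x by (simp add: fnm_hnorm hnorm_eq_0 pos_def_at)
  have 1: "fip (\<lambda>c x. 0) \<alpha> x = 0" for \<alpha> x by (simp add: fip_herm herm_def)
  have "(\<lambda>c x. 0) \<in> L1_forms A g"
    using test_form_borel[OF zero] by (simp add: L1_forms_def L1_norm_form_def 0)
  then have "is_weak_d A g (\<lambda>x. 0) (\<lambda>c x. 0)"
    by (simp add: is_weak_d_def dist_d_def 1)
  then show ?thesis by (auto simp: W11_def)
qed

section \<open>The BV seminorm\<close>

lemma BV_integrable: "f \<in> BV A g \<Longrightarrow> integrable V f"
  by (simp add: BV_def)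

lemma L1_norm_add:
  assumes "integrable V f" "integrable V h"
  shows "L1_norm V (\<lambda>x. f x + h x) \<le> L1_norm V f + L1_norm V h"
proof -
  have [measurable]: "f \<in> borel_measurable borel" "h \<in> borel_measurable borel"
    using borel_measurable_integrable[OF assms(1)] borel_measurable_integrable[OF assms(2)] by simp_all
  have "L1_norm V (\<lambda>x. f x + h x) \<le> (\<integral>\<^sup>+x. ennreal (cmod (f x)) + ennreal (cmod (h x)) \<partial>V)"
    unfolding L1_norm_def
    by (intro nn_integral_mono) (simp add: ennreal_plus[symmetric] norm_triangle_ineq ennreal_leI del: ennreal_plus)
  also have "\<dots> = L1_norm V f + L1_norm V h"
    unfolding L1_norm_def by (rule nn_integral_add) auto
  finally show ?thesis .
qed

lemma Var_add:
  assumes "integrable V f" "integrable V h"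
  shows "Var A g (\<lambda>x. f x + h x) \<le> Var A g f + Var A g h"
  unfolding Var_def[of A g "\<lambda>x. f x + h x"]
proof (rule SUP_least)
  fix \<alpha> assume \<alpha>: "\<alpha> \<in> {\<alpha> \<in> test_forms A. Linf_norm_form A g \<alpha> \<le> 1}"
  then have "ennreal (cmod (dist_d A g (\<lambda>x. f x + h x) \<alpha>)) \<le> ennreal (cmod (dist_d A g f \<alpha>)) + ennreal (cmod (dist_d A g h \<alpha>))"
    using assms by (simp add: dist_d_add ennreal_plus[symmetric] norm_triangle_ineq ennreal_leI del: ennreal_plus)
  also have "\<dots> \<le> Var A g f + Var A g h"
    unfolding Var_def by (intro add_mono SUP_upper \<alpha>)
  finally show "ennreal (cmod (dist_d A g (\<lambda>x. f x + h x) \<alpha>)) \<le> Var A g f + Var A g h" .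
qed

lemma BV_norm_add:
  assumes "integrable V f" "integrable V h"
  shows "BV_norm A g (\<lambda>x. f x + h x) \<le> BV_norm A g f + BV_norm A g h"
  using add_mono[OF L1_norm_add[OF assms] Var_add[OF assms]]
  by (simp add: BV_norm_def ac_simps)

lemma BV_norm_scale:
  assumes "integrable V f"
  shows "BV_norm A g (\<lambda>x. a * f x) \<le> ennreal (cmod a) * BV_norm A g f"
proof -
  have [measurable]: "f \<in> borel_measurable borel"
    using borel_measurable_integrable[OF assms] by simp
  have "L1_norm V (\<lambda>x. a * f x) = (\<integral>\<^sup>+x. ennreal (cmod a) * ennreal (cmod (f x)) \<partial>V)"
    unfolding L1_norm_def by (simp add: norm_mult ennreal_mult)
  also have "\<dots> = ennreal (cmod a) * L1_norm V f"
    unfolding L1_norm_def by (rule nn_integral_cmult) simp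
  finally have 1: "L1_norm V (\<lambda>x. a * f x) = ennreal (cmod a) * L1_norm V f" .
  have 2: "Var A g (\<lambda>x. a * f x) \<le> ennreal (cmod a) * Var A g f"
    unfolding Var_def[of A g "\<lambda>x. a * f x"]
  proof (rule SUP_least)
    fix \<alpha> assume \<alpha>: "\<alpha> \<in> {\<alpha> \<in> test_forms A. Linf_norm_form A g \<alpha> \<le> 1}"
    have "ennreal (cmod (dist_d A g (\<lambda>x. a * f x) \<alpha>)) = ennreal (cmod a) * ennreal (cmod (dist_d A g f \<alpha>))"
      by (simp add: dist_d_scale norm_mult ennreal_mult)
    also have "\<dots> \<le> ennreal (cmod a) * Var A g f"
      unfolding Var_def by (intro mult_left_mono SUP_upper \<alpha>) simp
    finally show "ennreal (cmod (dist_d A g (\<lambda>x. a * f x) \<alpha>)) \<le> ennreal (cmod a) * Var A g f" .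
  qed
  show ?thesis using add_left_mono[OF 2] unfolding BV_norm_def 1 distrib_left by blast
qed

lemma BV_norm_commute:
  assumes "integrable V f" "integrable V h"
  shows "BV_norm A g (\<lambda>x. f x - h x) \<le> BV_norm A g (\<lambda>x. h x - f x)"
proof -
  have "integrable V (\<lambda>x. h x - f x)" using assms by simp
  from BV_norm_scale[OF this, of "- 1"] show ?thesis by simp
qed

lemma BV_norm_triangle:
  assumes "integrable V f" "integrable V h" "integrable V k"
  shows "BV_norm A g (\<lambda>x. f x - k x) \<le> BV_norm A g (\<lambda>x. f x - h x) + BV_norm A g (\<lambda>x. h x - k x)"
  using BV_norm_add[of "\<lambda>x. f x - h x" "\<lambda>x. h x - k x"] assms by simp

lemma BV_norm_zero: "BV_norm A g (\<lambda>x. 0) = 0"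
proof -
  have "Var A g (\<lambda>x. 0) \<le> 0"
    unfolding Var_def by (rule SUP_least) (simp add: dist_d_def)
  then show ?thesis by (simp add: BV_norm_def L1_norm_def)
qed

text \<open>Below every positive extended radius there is a positive real one; real radii can then
  be halved and rescaled.\<close>

lemma closure_wrt_iff:
  "f \<in> closure_wrt N X S \<longleftrightarrow> f \<in> X \<and> (\<forall>r>0. \<exists>h\<in>S. N (\<lambda>x. f x - h x) < ennreal r)"
proof safe
  assume f: "f \<in> closure_wrt N X S"
  then show "f \<in> X" by (simp add: closure_wrt_def)
  fix r :: real assume "0 < r"
  then have "0 < ennreal r" by simp
  then show "\<exists>h\<in>S. N (\<lambda>x. f x - h x) < ennreal r" using f unfolding closure_wrt_def by blast
next
  assume f: "f \<in> X" "\<forall>r>0. \<exists>h\<in>S. N (\<lambda>x. f x - h x) < ennreal r"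
  have "\<exists>h\<in>S. N (\<lambda>x. f x - h x) < e" if e: "0 < e" for e
  proof -
    obtain z where z: "0 < z" "z < e" using dense[OF e] by blast
    then obtain r where r: "z = ennreal r" "0 \<le> r" by (cases z) auto
    with z have "0 < r" by simp
    with f obtain h where "h \<in> S" "N (\<lambda>x. f x - h x) < ennreal r" by blast
    then show ?thesis using r(1) z(2) by (meson order.strict_trans)
  qed
  with f(1) show "f \<in> closure_wrt N X S" by (simp add: closure_wrt_def)
qed

text \<open>The variation of a difference is the L1 norm of the difference of weak derivatives, so
  approximants at BV distance 2^(-n) have weak derivatives with geometrically small increments.
  Their limit represents df because both sides of the defining identity converge for each test
  form.\<close>

theorem W11_closed:
  assumes f: "f \<in> closure_wrt (BV_norm A g) (BV A g) (W11 A g)"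
  shows "f \<in> W11 A g"
proof -
  have fi: "integrable V f" using f by (simp add: closure_wrt_iff BV_integrable)
  have "\<exists>h\<in>W11 A g. BV_norm A g (\<lambda>x. f x - h x) < ennreal ((1/2) ^ n)" for n :: nat
    using f unfolding closure_wrt_iff by simp
  then obtain h where h: "\<And>n. h n \<in> W11 A g" and near: "\<And>n. BV_norm A g (\<lambda>x. f x - h n x) < ennreal ((1/2) ^ n)"
    by metis
  have hi: "integrable V (h n)" for n by (rule W11D(1)[OF h])
  define \<beta> where "\<beta> n = weak_d A g (h n)" for n
  have \<beta>: "is_weak_d A g (h n) (\<beta> n)" for n unfolding \<beta>_def by (rule W11D(2)[OF h])
  have L1: "\<beta> n \<in> L1_forms A g" for n using \<beta> by (simp add: is_weak_d_def)
  have fast: "L1_norm_form A g (fsub (\<beta> (Suc n)) (\<beta> n)) \<le> ennreal (2 * (1/2) ^ n)" for n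
  proof -
    have "is_weak_d A g (\<lambda>x. h (Suc n) x + (- 1) * h n x) (fsub (\<beta> (Suc n)) (\<beta> n))"
      using hi by (intro is_weak_d_add is_weak_d_scale \<beta>) auto
    then have "L1_norm_form A g (fsub (\<beta> (Suc n)) (\<beta> n)) = Var A g (\<lambda>x. h (Suc n) x - h n x)"
      using Var_eq_L1_norm by fastforce
    also have "\<dots> \<le> BV_norm A g (\<lambda>x. h (Suc n) x - h n x)" by (simp add: BV_norm_def)
    also have "\<dots> \<le> BV_norm A g (\<lambda>x. h (Suc n) x - f x) + BV_norm A g (\<lambda>x. f x - h n x)"
      by (rule BV_norm_triangle[OF hi fi hi])
    \<comment> \<open>Both consecutive approximants lie within (1/2)^n of \<open>f\<close>, the
      later one even within half of that; this is the origin of the constant 2.\<close>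
    also have "\<dots> \<le> ennreal ((1/2) ^ n) + ennreal ((1/2) ^ n)"
    proof (rule add_mono)
      have "BV_norm A g (\<lambda>x. h (Suc n) x - f x) \<le> ennreal ((1/2) ^ Suc n)"
        using BV_norm_commute[OF hi fi] near[of "Suc n"] by (meson less_imp_le order_trans)
      also have "\<dots> \<le> ennreal ((1/2) ^ n)" by (intro ennreal_leI power_decreasing) auto
      finally show "BV_norm A g (\<lambda>x. h (Suc n) x - f x) \<le> ennreal ((1/2) ^ n)" .
    qed (use near in \<open>auto intro: less_imp_le\<close>)
    also have "\<dots> = ennreal (2 * (1/2) ^ n)"
      by (simp add: ennreal_plus[symmetric] del: ennreal_plus)
    finally show ?thesis .
  qed
  obtain \<beta>' where L1': "\<beta>' \<in> L1_forms A g" and lim: "\<And>\<alpha>. \<alpha> \<in> test_forms A \<Longrightarrow>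
      (\<lambda>n. \<integral>x. fip (\<beta> n) \<alpha> x \<partial>V) \<longlonglongrightarrow> (\<integral>x. fip \<beta>' \<alpha> x \<partial>V)"
    using L1_forms_limit[OF L1 fast] by auto
  have "dist_d A g f \<alpha> = (\<integral>x. fip \<beta>' \<alpha> x \<partial>V)" if \<alpha>: "\<alpha> \<in> test_forms A" for \<alpha>
  proof -
    obtain C where C: "0 \<le> C" "\<And>f. integrable V f \<Longrightarrow> cmod (dist_d A g f \<alpha>) \<le> C * (\<integral>x. cmod (f x) \<partial>V)"
      using dist_d_bound[OF \<alpha>] by blast
    have bound: "cmod (dist_d A g (h n) \<alpha> - dist_d A g f \<alpha>) \<le> C * (1/2) ^ n" for n
    proof -
      have i: "integrable V (\<lambda>x. f x - h n x)" using fi hi by simp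
      have "ennreal (\<integral>x. cmod (f x - h n x) \<partial>V) = L1_norm V (\<lambda>x. f x - h n x)"
        unfolding L1_norm_def using i by (intro nn_integral_eq_integral[symmetric]) auto
      also have "\<dots> \<le> BV_norm A g (\<lambda>x. f x - h n x)" by (simp add: BV_norm_def)
      also have "\<dots> \<le> ennreal ((1/2) ^ n)" using near by (rule less_imp_le)
      finally have "(\<integral>x. cmod (f x - h n x) \<partial>V) \<le> (1/2) ^ n" by (simp add: ennreal_le_iff)
      then have "cmod (dist_d A g (\<lambda>x. f x - h n x) \<alpha>) \<le> C * (1/2) ^ n"
        using C(2)[OF i] mult_left_mono[OF _ C(1)] by (meson order_trans)
      then show ?thesis
        by (simp add: dist_d_diff[OF fi hi \<alpha>] norm_minus_commute)
    qed
    have null: "(\<lambda>n. C * (1/2) ^ n) \<longlonglongrightarrow> 0"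
      by (intro tendsto_mult_right_zero LIMSEQ_realpow_zero) auto
    have "(\<lambda>n. dist_d A g (h n) \<alpha> - dist_d A g f \<alpha>) \<longlonglongrightarrow> 0"
      by (intro Lim_null_comparison[OF _ null] always_eventually allI bound)
    then have "(\<lambda>n. dist_d A g (h n) \<alpha>) \<longlonglongrightarrow> dist_d A g f \<alpha>" by (rule LIM_zero_cancel)
    moreover have "dist_d A g (h n) \<alpha> = (\<integral>x. fip (\<beta> n) \<alpha> x \<partial>V)" for n
      using \<beta> \<alpha> by (simp add: is_weak_d_def)
    ultimately show ?thesis using lim[OF \<alpha>] LIMSEQ_unique by fastforce
  qed
  then have "is_weak_d A g f \<beta>'" using L1' by (simp add: is_weak_d_def)
  then show ?thesis using fi by (auto simp: W11_def)
qed

lemma closed_subspace_W11: "closed_subspace_wrt (BV_norm A g) (BV A g) (W11 A g)"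
  unfolding closed_subspace_wrt_def
proof (intro conjI W11_subset_BV W11_zero ballI allI W11_add W11_scale)
  show "closure_wrt (BV_norm A g) (BV A g) (W11 A g) = W11 A g"
  proof
    show "W11 A g \<subseteq> closure_wrt (BV_norm A g) (BV A g) (W11 A g)"
    proof
      fix f assume f: "f \<in> W11 A g"
      have "\<exists>h\<in>W11 A g. BV_norm A g (\<lambda>x. f x - h x) < ennreal r" if "r > 0" for r
        using that by (intro bexI[OF _ f]) (simp add: BV_norm_zero)
      then show "f \<in> closure_wrt (BV_norm A g) (BV A g) (W11 A g)"
        using f W11_subset_BV by (auto simp: closure_wrt_iff)
    qed
  qed (use W11_closed in blast)
qed

text \<open>The difference of two members of \<open>W11\<close> lies in \<open>W11\<close>, where
  the two norms agree, so the closure may be taken in the BV norm.\<close>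

lemma H11_iff:
  "f \<in> H11 A g \<longleftrightarrow> f \<in> W11 A g \<and>
    (\<forall>r>0. \<exists>h\<in>W11 A g. smooth_fun A h \<and> BV_norm A g (\<lambda>x. f x - h x) < ennreal r)"
proof (cases "f \<in> W11 A g")
  case True
  have "W11_norm A g (\<lambda>x. f x - h x) = BV_norm A g (\<lambda>x. f x - h x)" if "h \<in> W11 A g" for h
    using BV_norm_eq_W11_norm[OF W11_diff[OF True that]] by simp
  then show ?thesis
    using True unfolding H11_def closure_wrt_iff by auto
qed (simp add: H11_def closure_wrt_iff)

text \<open>A BV limit of members of \<open>H11\<close> is in particular a limit of members of
  \<open>W11\<close>, hence lies in \<open>W11\<close>; smooth approximants of those members then
  approximate it by the triangle inequality.\<close>

lemma closed_subspace_H11: "closed_subspace_wrt (BV_norm A g) (BV A g) (H11 A g)"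
  unfolding closed_subspace_wrt_def
proof (intro conjI ballI allI)
  have sub: "H11 A g \<subseteq> W11 A g" using H11_iff by blast
  then show "H11 A g \<subseteq> BV A g" using W11_subset_BV by blast
  have self: "(\<forall>r>0. \<exists>h\<in>X. BV_norm A g (\<lambda>x. f x - h x) < ennreal r)" if "f \<in> X" for f X
    using that by (intro allI impI bexI[of _ f]) (simp_all add: BV_norm_zero)
  show "(\<lambda>x. 0) \<in> H11 A g"
    unfolding H11_iff
  proof (intro conjI W11_zero allI impI bexI[of _ "\<lambda>x. 0"] smooth_fun_const)
    show "BV_norm A g (\<lambda>x. 0 - 0) < ennreal r" if "r > 0" for r
      using that by (simp add: BV_norm_zero)
  qed
  show "(\<lambda>x. f x + h x) \<in> H11 A g" if f: "f \<in> H11 A g" and h: "h \<in> H11 A g" for f h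
    unfolding H11_iff
  proof (intro conjI allI impI)
    show "(\<lambda>x. f x + h x) \<in> W11 A g" using f h sub by (blast intro: W11_add)
    fix r :: real assume "r > 0"
    then have "r / 2 > 0" by simp
    then obtain f' h' where f': "f' \<in> W11 A g" "smooth_fun A f'" "BV_norm A g (\<lambda>x. f x - f' x) < ennreal (r / 2)"
      and h': "h' \<in> W11 A g" "smooth_fun A h'" "BV_norm A g (\<lambda>x. h x - h' x) < ennreal (r / 2)"
      using f h unfolding H11_iff by blast
    have "BV_norm A g (\<lambda>x. (f x - f' x) + (h x - h' x)) \<le> BV_norm A g (\<lambda>x. f x - f' x) + BV_norm A g (\<lambda>x. h x - h' x)"
      using W11D(1) f h f' h' sub by (intro BV_norm_add Bochner_Integration.integrable_diff) blast+
    then have "BV_norm A g (\<lambda>x. (f x - f' x) + (h x - h' x)) < ennreal r"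
      using f'(3) h'(3) \<open>r > 0\<close> by (rule less_ennreal_halves)
    then have "BV_norm A g (\<lambda>x. f x + h x - (f' x + h' x)) < ennreal r"
      by (simp add: algebra_simps)
    then show "\<exists>k\<in>W11 A g. smooth_fun A k \<and> BV_norm A g (\<lambda>x. f x + h x - k x) < ennreal r"
      using W11_add[OF f'(1) h'(1)] smooth_fun_add[OF f'(2) h'(2)] by (intro bexI[of _ "\<lambda>x. f' x + h' x"] conjI)
  qed
  show "(\<lambda>x. a * f x) \<in> H11 A g" if f: "f \<in> H11 A g" for a f
    unfolding H11_iff
  proof (intro conjI allI impI)
    show "(\<lambda>x. a * f x) \<in> W11 A g" using f sub by (blast intro: W11_scale)
    fix r :: real assume "r > 0"
    \<comment> \<open>Adding 1 keeps the divisor positive when a = 0 and makes the final inequality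
      strict.\<close>
    then have "r / (cmod a + 1) > 0" by (simp add: add_nonneg_pos)
    then obtain f' where f': "f' \<in> W11 A g" "smooth_fun A f'" "BV_norm A g (\<lambda>x. f x - f' x) < ennreal (r / (cmod a + 1))"
      using f unfolding H11_iff by blast
    have "BV_norm A g (\<lambda>x. a * (f x - f' x)) \<le> ennreal (cmod a) * BV_norm A g (\<lambda>x. f x - f' x)"
      using W11D(1) f f' sub by (intro BV_norm_scale Bochner_Integration.integrable_diff) blast+
    also have "\<dots> \<le> ennreal (cmod a) * ennreal (r / (cmod a + 1))"
      using f' by (intro mult_left_mono) (auto intro: less_imp_le)
    also have "\<dots> = ennreal (cmod a * (r / (cmod a + 1)))"
      using \<open>r > 0\<close> by (intro ennreal_mult[symmetric]) auto
    also have "\<dots> < ennreal r"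
    proof (rule ennreal_lessI[OF \<open>r > 0\<close>])
      show "cmod a * (r / (cmod a + 1)) < r"
      proof -
        have "0 < cmod a + 1" using norm_ge_zero[of a] by linarith
        then show ?thesis using \<open>r > 0\<close> by (simp add: divide_less_eq algebra_simps)
      qed
    qed
    finally have "BV_norm A g (\<lambda>x. a * f x - a * f' x) < ennreal r"
      by (simp add: right_diff_distrib)
    then show "\<exists>k\<in>W11 A g. smooth_fun A k \<and> BV_norm A g (\<lambda>x. a * f x - k x) < ennreal r"
      using W11_scale[OF f'(1)] smooth_fun_mult[OF smooth_fun_const f'(2)]
      by (intro bexI[of _ "\<lambda>x. a * f' x"] conjI)
  qed
  show "closure_wrt (BV_norm A g) (BV A g) (H11 A g) = H11 A g"
  proof
    show "H11 A g \<subseteq> closure_wrt (BV_norm A g) (BV A g) (H11 A g)"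
      using self[of _ "H11 A g"] sub W11_subset_BV unfolding closure_wrt_iff[abs_def] subset_iff
      by (simp add: closure_wrt_iff)
    show "closure_wrt (BV_norm A g) (BV A g) (H11 A g) \<subseteq> H11 A g"
    proof
      fix f assume f: "f \<in> closure_wrt (BV_norm A g) (BV A g) (H11 A g)"
      then have "f \<in> closure_wrt (BV_norm A g) (BV A g) (W11 A g)"
        using sub unfolding closure_wrt_iff by blast
      then have fW: "f \<in> W11 A g" by (rule W11_closed)
      show "f \<in> H11 A g"
        unfolding H11_iff
      proof (intro conjI fW allI impI)
        fix r :: real assume "r > 0"
        then have r2: "r / 2 > 0" by simp
        then obtain h where h: "h \<in> H11 A g" "BV_norm A g (\<lambda>x. f x - h x) < ennreal (r / 2)"
          using f unfolding closure_wrt_iff by blast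
        from h(1) r2 obtain k where k: "k \<in> W11 A g" "smooth_fun A k" "BV_norm A g (\<lambda>x. h x - k x) < ennreal (r / 2)"
          unfolding H11_iff by blast
        have "BV_norm A g (\<lambda>x. f x - k x) \<le> BV_norm A g (\<lambda>x. f x - h x) + BV_norm A g (\<lambda>x. h x - k x)"
          using W11D(1) fW h k sub by (intro BV_norm_triangle) blast+
        then have "BV_norm A g (\<lambda>x. f x - k x) < ennreal r"
          using h(2) k(3) \<open>r > 0\<close> by (rule less_ennreal_halves)
        then show "\<exists>k\<in>W11 A g. smooth_fun A k \<and> BV_norm A g (\<lambda>x. f x - k x) < ennreal r"
          using k by blast
      qed
    qed
  qed
qed

end

theorem proposition2p11:
  fixes A :: "('a::{second_countable_topology, t2_space}, 'n::finite) chart set"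
    and g :: "('a, 'n) chart \<Rightarrow> 'a \<Rightarrow> real ^ 'n ^ 'n"
  assumes "connected_riemannian_manifold A g"
  shows "(\<forall>f\<in>W11 A g. BV_norm A g f = W11_norm A g f) \<and>
         closed_subspace_wrt (BV_norm A g) (BV A g) (H11 A g) \<and>
         closed_subspace_wrt (BV_norm A g) (BV A g) (W11 A g) \<and>
         (\<forall>f\<in>BV A g. \<forall>\<mu>. is_variation_measure A g f \<mu> \<longrightarrow>
            (f \<in> W11 A g \<longleftrightarrow> absolutely_continuous (vol A g) \<mu>))"
proof -
  interpret riemannian A g by standard (rule assms)
  show ?thesis
    using BV_norm_eq_W11_norm closed_subspace_H11 closed_subspace_W11 BV_integrable
      weak_d_imp_absolutely_continuous absolutely_continuous_imp_weak_d by blast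
qed

end
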